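(* Let $\gamma>0$ and let $r^s_\lambda(x,dy)$ be the resolvent kernel of the Brownian motion $B^s$ on $\mathbb{R}_+$ with sticky origin and stickiness parameter $\gamma$. Then for all $\lambda>0$, $x,y\in\mathbb{R}_+$, $$r^s_\lambda(x,dy)=r^D_\lambda(x,y)\,dy+\frac{1}{\sqrt{2\lambda}+\gamma\lambda}\Bigl(2e^{-\sqrt{2\lambda}(x+y)}\,dy+\gamma e^{-\sqrt{2\lambda}\,x}\,\varepsilon_0(dy)\Bigr),$$ where $r^D_\lambda(x,y)=\frac{1}{\sqrt{2\lambda}}\bigl(e^{-\sqrt{2\lambda}|x-y|}-e^{-\sqrt{2\lambda}(x+y)}\bigr)$ and $\varepsilon_0$ is the Dirac measure at $0$.
   Context: Setting. $(\Omega,\mathcal{A})$ is a measurable space with probability measures $(P_x,\,x\in\mathbb{R})$ and a right continuous filtration $\mathcal{F}=(\mathcal{F}_t,\,t\ge0)$, complete with respect to $(P_x)$; $B=(B_t,\,t\ge0)$ is a standard one-dimensional Brownian motion relative to $\mathcal{F}$ with $P_x(B_0=x)=1$, equipped with shift operators $\theta_t:\Omega\to\Omega$ with $B_s\circ\theta_t=B_{s+t}$. $L=(L_t,\,t\ge0)$ is the local time of $B$ at $0$, normalized so that Tanaka's formula reads $d|B_t|=\operatorname{sign}(B_t)\,dB_t+dL_t$. All paths of $B$ and $L$ are continuous. Sticky Brownian motion. For $\gamma>0$ let $\tau^{-1}(t)=t+\gamma L_t$, $t\ge0$; this is a strictly increasing continuous bijection of $\mathbb{R}_+=[0,+\infty)$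 and $\tau$ denotes its inverse. Put $B^s_t=|B_{\tau(t)}|$, $t\ge0$. The resolvent kernel is the kernel on $\mathbb{R}_+$ determined by $\int_{\mathbb{R}_+}f(y)\,r^s_\lambda(x,dy)=R^s_\lambda f(x)=E_x\bigl(\int_0^\infty e^{-\lambda t}f(B^s_t)\,dt\bigr)$ for $f\in C_0(\mathbb{R}_+)$, the real continuous functions on $[0,+\infty)$ vanishing at infinity. *)

theory Defs
  imports "HOL-Probability.Probability"
begin

section \<open>Brownian motion with a family of starting points\<close>

text \<open>Processes are functions \<open>X t \<omega>\<close> of a real time \<open>t\<close>; only times \<open>t \<ge> 0\<close> matter. The
  filtration is indexed by all reals in order to use the library locale, but nothing is required at
  negative times beyond monotonicity (one may take \<open>F t = F 0\<close> for \<open>t < 0\<close>).\<close>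

definition brownian_motion_rel ::
  "'a measure \<Rightarrow> (real \<Rightarrow> 'a measure) \<Rightarrow> (real \<Rightarrow> 'a \<Rightarrow> real) \<Rightarrow> bool" where
  "brownian_motion_rel P F B \<longleftrightarrow>
     prob_space P \<and>
     (\<forall>t\<ge>0. B t \<in> borel_measurable (F t)) \<and>
     (\<forall>\<omega>\<in>space P. continuous_on {0..} (\<lambda>t. B t \<omega>)) \<and>
     (\<forall>s t. 0 \<le> s \<and> s < t \<longrightarrow>
        distributed P lborel (\<lambda>\<omega>. B t \<omega> - B s \<omega>) (normal_density 0 (sqrt (t - s))) \<and>
        prob_space.indep_set P (sets (F s))
          (sets (vimage_algebra (space P) (\<lambda>\<omega>. B t \<omega> - B s \<omega>) borel)))"

locale brownian_family = filtration "space A" F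
  for A :: "'a measure" and F :: "real \<Rightarrow> 'a measure" +
  fixes P :: "real \<Rightarrow> 'a measure" and B :: "real \<Rightarrow> 'a \<Rightarrow> real" and \<theta> :: "real \<Rightarrow> 'a \<Rightarrow> 'a"
  assumes prob_P: "\<And>x. prob_space (P x)"
    and sets_P: "\<And>x. sets (P x) = sets A"
    and subalgebra_F: "\<And>t. 0 \<le> t \<Longrightarrow> subalgebra A (F t)"
    and right_continuous_F: "\<And>t. 0 \<le> t \<Longrightarrow> sets (F t) = (\<Inter>s\<in>{t<..}. sets (F s))"
    and complete_F: "\<And>N. (\<And>x. \<exists>Z\<in>null_sets (P x). N \<subseteq> Z) \<Longrightarrow> N \<in> sets (F 0)"
    and brownian: "\<And>x. brownian_motion_rel (P x) F B"
    and start: "\<And>x. measure (P x) {\<omega>\<in>space A. B 0 \<omega> = x} = 1"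
    and shift_space: "\<And>t. 0 \<le> t \<Longrightarrow> \<theta> t \<in> space A \<rightarrow> space A"
    and shift: "\<And>s t \<omega>. 0 \<le> s \<Longrightarrow> 0 \<le> t \<Longrightarrow> \<omega> \<in> space A \<Longrightarrow> B s (\<theta> t \<omega>) = B (s + t) \<omega>"


section \<open>The Ito integral with respect to Brownian motion\<close>

text \<open>A list entry \<open>(a, b, \<xi>)\<close> stands for the elementary integrand \<open>\<xi> 1\<^bsub>(a, b]\<^esub>\<close>.\<close>

type_synonym 'a elementary_integrands = "(real \<times> real \<times> ('a \<Rightarrow> real)) list"

definition simple_integrand :: "(real \<Rightarrow> 'a measure) \<Rightarrow> 'a elementary_integrands \<Rightarrow> bool" where
  "simple_integrand F hs \<longleftrightarrow>
     (\<forall>(a, b, \<xi>)\<in>set hs. 0 \<le> a \<and> a \<le> b \<and> \<xi> \<in> borel_measurable (F a) \<and>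
        (\<exists>C. \<forall>\<omega>\<in>space (F a). \<bar>\<xi> \<omega>\<bar> \<le> C))"

definition simple_value :: "'a elementary_integrands \<Rightarrow> real \<Rightarrow> 'a \<Rightarrow> real" where
  "simple_value hs s \<omega> = (\<Sum>(a, b, \<xi>)\<leftarrow>hs. \<xi> \<omega> * indicator {a<..b} s)"

definition simple_integral ::
  "(real \<Rightarrow> 'a \<Rightarrow> real) \<Rightarrow> 'a elementary_integrands \<Rightarrow> real \<Rightarrow> 'a \<Rightarrow> real" where
  "simple_integral B hs t \<omega> = (\<Sum>(a, b, \<xi>)\<leftarrow>hs. \<xi> \<omega> * (B (min b t) \<omega> - B (min a t) \<omega>))"

text \<open>\<open>I t = \<integral>\<^sub>0\<^sup>t H dB\<close> almost surely under \<open>P\<close>, as the \<open>L\<^sup>2\<close> limit of integrals of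
  simple integrands.\<close>

definition is_ito_integral ::
  "'a measure \<Rightarrow> (real \<Rightarrow> 'a measure) \<Rightarrow> (real \<Rightarrow> 'a \<Rightarrow> real) \<Rightarrow>
   (real \<Rightarrow> 'a \<Rightarrow> real) \<Rightarrow> (real \<Rightarrow> 'a \<Rightarrow> real) \<Rightarrow> bool" where
  "is_ito_integral P F B H I \<longleftrightarrow>
     (\<forall>t\<ge>0. I t \<in> borel_measurable P) \<and>
     (\<forall>\<omega>\<in>space P. continuous_on {0..} (\<lambda>t. I t \<omega>)) \<and>
     (\<exists>hs. (\<forall>k::nat. simple_integrand F (hs k)) \<and>
        (\<forall>t\<ge>0.
          (\<lambda>k. \<integral>\<^sup>+\<omega>. (\<integral>\<^sup>+s\<in>{0..t}. ennreal ((simple_value (hs k) s \<omega> - H s \<omega>)\<^sup>2) \<partial>lborel) \<partial>P)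
             \<longlonglongrightarrow> 0 \<and>
          (\<lambda>k. \<integral>\<^sup>+\<omega>. ennreal ((simple_integral B (hs k) t \<omega> - I t \<omega>)\<^sup>2) \<partial>P)
             \<longlonglongrightarrow> 0))"


section \<open>Local time at the origin and sticky Brownian motion\<close>

text \<open>The last conjunct is Tanaka's formula \<open>\<bar>B t\<bar> = \<bar>B 0\<bar> + \<integral>\<^sub>0\<^sup>t sgn B dB + L t\<close>. The value of the
  sign at \<open>0\<close> does not affect the integral.\<close>

definition is_local_time_at_zero ::
  "(real \<Rightarrow> 'a measure) \<Rightarrow> (real \<Rightarrow> 'a measure) \<Rightarrow> (real \<Rightarrow> 'a \<Rightarrow> real) \<Rightarrow>
   (real \<Rightarrow> 'a \<Rightarrow> real) \<Rightarrow> bool" where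
  "is_local_time_at_zero P F B L \<longleftrightarrow>
     (\<forall>t\<ge>0. L t \<in> borel_measurable (F t)) \<and>
     (\<forall>\<omega>\<in>space (F 0).
        L 0 \<omega> = 0 \<and> mono_on {0..} (\<lambda>t. L t \<omega>) \<and> continuous_on {0..} (\<lambda>t. L t \<omega>)) \<and>
     (\<forall>x. is_ito_integral (P x) F B (\<lambda>s \<omega>. sgn (B s \<omega>)) (\<lambda>t \<omega>. \<bar>B t \<omega>\<bar> - \<bar>B 0 \<omega>\<bar> - L t \<omega>))"

definition sticky_time :: "(real \<Rightarrow> 'a \<Rightarrow> real) \<Rightarrow> real \<Rightarrow> real \<Rightarrow> 'a \<Rightarrow> real" where
  "sticky_time L \<gamma> t \<omega> = the_inv_into {0..} (\<lambda>u. u + \<gamma> * L u \<omega>) t"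

definition sticky_bm ::
  "(real \<Rightarrow> 'a \<Rightarrow> real) \<Rightarrow> (real \<Rightarrow> 'a \<Rightarrow> real) \<Rightarrow> real \<Rightarrow> real \<Rightarrow> 'a \<Rightarrow> real" where
  "sticky_bm B L \<gamma> t \<omega> = \<bar>B (sticky_time L \<gamma> t \<omega>) \<omega>\<bar>"


section \<open>Resolvents and their kernels on the half-line\<close>

definition resolvent ::
  "(real \<Rightarrow> 'a measure) \<Rightarrow> (real \<Rightarrow> 'a \<Rightarrow> real) \<Rightarrow> real \<Rightarrow> (real \<Rightarrow> real) \<Rightarrow> real \<Rightarrow> real" where
  "resolvent P X lam f x = (\<integral>\<omega>. (LINT t:{0..}|lborel. exp (- lam * t) * f (X t \<omega>)) \<partial>P x)"

definition C0_halfline :: "(real \<Rightarrow> real) set" where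
  "C0_halfline = {f. continuous_on {0..} f \<and> (f \<longlongrightarrow> 0) at_top}"

definition represents_resolvent ::
  "(real \<Rightarrow> 'a measure) \<Rightarrow> (real \<Rightarrow> 'a \<Rightarrow> real) \<Rightarrow> real \<Rightarrow> real \<Rightarrow> real measure \<Rightarrow> bool" where
  "represents_resolvent P X lam x \<mu> \<longleftrightarrow>
     sets \<mu> = sets (restrict_space borel {0..}) \<and> finite_measure \<mu> \<and>
     (\<forall>f\<in>C0_halfline. (\<integral>y. f y \<partial>\<mu>) = resolvent P X lam f x)"

definition resolvent_kernel ::
  "(real \<Rightarrow> 'a measure) \<Rightarrow> (real \<Rightarrow> 'a \<Rightarrow> real) \<Rightarrow> real \<Rightarrow> real \<Rightarrow> real measure" where
  "resolvent_kernel P X lam x = (THE \<mu>. represents_resolvent P X lam x \<mu>)"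

definition dirichlet_resolvent_density :: "real \<Rightarrow> real \<Rightarrow> real \<Rightarrow> real" where
  "dirichlet_resolvent_density lam x y =
     1 / sqrt (2 * lam) * (exp (- sqrt (2 * lam) * \<bar>x - y\<bar>) - exp (- sqrt (2 * lam) * (x + y)))"

definition add_measure :: "'b measure \<Rightarrow> 'b measure \<Rightarrow> 'b measure" where
  "add_measure M N = measure_of (space M) (sets M) (\<lambda>S. emeasure M S + emeasure N S)"

lemma sets_add_measure [simp, measurable_cong]: "sets (add_measure M N) = sets M"
  by (simp add: add_measure_def)

lemma space_add_measure [simp]: "space (add_measure M N) = space M"
  by (simp add: add_measure_def)

lemma emeasure_add_measure:
  assumes "sets N = sets M" and "S \<in> sets M"
  shows "emeasure (add_measure M N) S = emeasure M S + emeasure N S"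
proof -
  have "countably_additive (sets M) (\<lambda>S. emeasure M S + emeasure N S)"
  proof (rule countably_additiveI)
    fix T :: "nat \<Rightarrow> 'a set"
    assume "range T \<subseteq> sets M" "disjoint_family T"
    then show "(\<Sum>i. emeasure M (T i) + emeasure N (T i))
        = emeasure M (\<Union>i. T i) + emeasure N (\<Union>i. T i)"
      using assms(1) by (simp add: suminf_add[symmetric] suminf_emeasure)
  qed
  with assms show ?thesis
    unfolding add_measure_def
    by (intro emeasure_measure_of_sigma) (auto simp: positive_def sets.sigma_algebra_axioms)
qed

abbreviation lborel_halfline :: "real measure" where
  "lborel_halfline \<equiv> restrict_space lborel {0..}"

end

theory Submission
  imports Defs
begin

text \<open>With \<open>w t = exp (- lam * (t + \<gamma> * L t))\<close>, the change of variables \<open>s = t + \<gamma> * L t\<close> turns the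
  resolvent of the sticky process into the limit of the sums of \<open>f (B t) * - dw / lam\<close> over partitions
  of \<open>[0, T]\<close>. For a bounded \<open>u = g - a * \<bar>\<cdot>\<bar>\<close> with smooth \<open>g\<close>, expanding \<open>w T * u (B T)\<close> along the partition gives
  \<open>E (w T * u (B T)) - u x = - E (\<integral> w * (lam * u - g''/2) dt) - (a + lam * \<gamma> * u 0) * E (\<integral> w dL)\<close>,
  where Tanaka's formula handles \<open>\<bar>B\<bar>\<close> and \<open>dL\<close> is carried by the zeros of \<open>B\<close>. Taking
  \<open>u = exp (- sqrt (2 * lam) * \<bar>\<cdot>\<bar>)\<close> determines \<open>E (\<integral> w dL)\<close>, and then taking for \<open>u\<close> the free resolvent
  of an even function \<open>f\<close> determines the resolvent at \<open>f\<close>. All limits are taken for expectations of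
  finite sums, so no stochastic calculus beyond the martingale property of \<open>\<bar>B\<bar> - L\<close> is used.\<close>

section \<open>Increments of Brownian motion\<close>

text \<open>The stochastic integral is given as an \<open>L^2\<close> limit of simple integrals, and
  \<open>L\<close> as an adapted, nondecreasing, continuous process satisfying Tanaka's formula.
  That \<open>dL\<close> is carried by the zeros of \<open>B\<close> must therefore be derived.
  Testing the martingales \<open>|B| - L\<close> and \<open>B\<close> against \<open>|B s|\<close>
  and \<open>B s\<close> gives E(|B s| (L t - L s)) = E(|B s| |B t| - B s B t). The integrand on the
  right vanishes unless \<open>B\<close> changes sign between \<open>s\<close> and \<open>t\<close>,
  and Gaussian estimates make the sum over a partition tend to 0. The split u = g - a |.| isolates
  the kink at the origin: \<open>g\<close> is expanded by Taylor's formula, and the increments of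
  |.| become those of \<open>L\<close> in expectation. For u = exp(- a |.|) with a^2 = 2 lam, the
  operator lam - (1/2) d^2/db^2 annihilates \<open>u\<close> off the origin, so only the boundary
  coefficient a + lam \<gamma> survives; this is the denominator of the kernel. For the free
  resolvent the kink is 0 and lam u - u''/2 = f. The terminal term at the horizon \<open>T\<close>
  is of order exp(- lam T) and disappears at the end. As the kernel is a definite description,
  uniqueness of the representing measure has to be proved as well.\<close>

locale brownian_local_time = prob_space M for M :: "'a measure" +
  fixes F :: "real \<Rightarrow> 'a measure" and B L :: "real \<Rightarrow> 'a \<Rightarrow> real" and x :: real
  assumes bm: "brownian_motion_rel M F B"
    and subalgebra_F: "\<And>t. 0 \<le> t \<Longrightarrow> subalgebra M (F t)"
    and sets_F_mono: "\<And>s t. s \<le> t \<Longrightarrow> sets (F s) \<subseteq> sets (F t)"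
    and start: "AE \<omega> in M. B 0 \<omega> = x"
    and L_adapted: "\<And>t. 0 \<le> t \<Longrightarrow> L t \<in> borel_measurable (F t)"
    and L_0: "\<And>\<omega>. \<omega> \<in> space M \<Longrightarrow> L 0 \<omega> = 0"
    and L_mono_on: "\<And>\<omega>. \<omega> \<in> space M \<Longrightarrow> mono_on {0..} (\<lambda>t. L t \<omega>)"
    and L_cont: "\<And>\<omega>. \<omega> \<in> space M \<Longrightarrow> continuous_on {0..} (\<lambda>t. L t \<omega>)"
    and tanaka: "is_ito_integral M F B (\<lambda>s \<omega>. sgn (B s \<omega>))
      (\<lambda>t \<omega>. \<bar>B t \<omega>\<bar> - \<bar>B 0 \<omega>\<bar> - L t \<omega>)"
begin

lemma space_F: "0 \<le> t \<Longrightarrow> space (F t) = space M"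
  using subalgebra_F by (auto simp: subalgebra_def)

lemma measurable_F_mono:
  assumes f: "f \<in> borel_measurable (F s)" and st: "0 \<le> s" "s \<le> t"
  shows "f \<in> borel_measurable (F t)"
proof (rule measurable_from_subalg[OF _ f])
  have "space (F s) = space (F t)" using space_F[OF st(1)] space_F[OF order_trans[OF st]] by (rule trans[OF _ sym])
  then show "subalgebra (F t) (F s)"
    unfolding subalgebra_def using sets_F_mono[OF st(2)] by blast
qed

lemma measurable_F_M: "f \<in> borel_measurable (F s) \<Longrightarrow> 0 \<le> s \<Longrightarrow> f \<in> borel_measurable M"
  using measurable_from_subalg subalgebra_F by blast

lemma B_adapted: "0 \<le> t \<Longrightarrow> B t \<in> borel_measurable (F t)"
  using bm by (auto simp: brownian_motion_rel_def)

lemma B_adapted': "0 \<le> s \<Longrightarrow> s \<le> t \<Longrightarrow> B s \<in> borel_measurable (F t)"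
  using B_adapted measurable_F_mono by blast

lemma L_adapted': "0 \<le> s \<Longrightarrow> s \<le> t \<Longrightarrow> L s \<in> borel_measurable (F t)"
  using L_adapted measurable_F_mono by blast

lemma B_measurable [measurable]: "0 \<le> t \<Longrightarrow> B t \<in> borel_measurable M"
  using B_adapted measurable_F_M by blast

lemma L_measurable [measurable]: "0 \<le> t \<Longrightarrow> L t \<in> borel_measurable M"
  using L_adapted measurable_F_M by blast

lemma B_cont: "\<omega> \<in> space M \<Longrightarrow> continuous_on {0..} (\<lambda>t. B t \<omega>)"
  using bm by (auto simp: brownian_motion_rel_def)

lemma L_mono: "\<omega> \<in> space M \<Longrightarrow> 0 \<le> s \<Longrightarrow> s \<le> t \<Longrightarrow> L s \<omega> \<le> L t \<omega>"
  using L_mono_on[of \<omega>] by (auto simp: mono_on_def)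

lemma L_nonneg: "\<omega> \<in> space M \<Longrightarrow> 0 \<le> t \<Longrightarrow> 0 \<le> L t \<omega>"
  using L_mono[of \<omega> 0 t] L_0 by auto

lemma increment_distributed:
  "0 \<le> s \<Longrightarrow> s < t \<Longrightarrow>
    distributed M lborel (\<lambda>\<omega>. B t \<omega> - B s \<omega>) (normal_density 0 (sqrt (t - s)))"
  using bm by (auto simp: brownian_motion_rel_def)

text \<open>The sigma-algebra generated by \<open>\<eta>\<close> is contained in
  \<open>sets (F s)\<close>, so the independence of \<open>F s\<close> and the increment passes to
  the smaller system.\<close>

lemma increment_indep:
  assumes "0 \<le> s" "s < t" and \<eta>: "\<eta> \<in> borel_measurable (F s)"
  shows "indep_var borel \<eta> borel (\<lambda>\<omega>. B t \<omega> - B s \<omega>)"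
  unfolding indep_var_eq
proof (intro conjI)
  have [measurable]: "B t \<in> borel_measurable M" "B s \<in> borel_measurable M"
    using assms by auto
  show "random_variable borel \<eta>" using measurable_F_M assms by auto
  show "random_variable borel (\<lambda>\<omega>. B t \<omega> - B s \<omega>)" by measurable
  have ind: "indep_set (sets (F s))
      (sets (vimage_algebra (space M) (\<lambda>\<omega>. B t \<omega> - B s \<omega>) borel))"
    using bm assms by (auto simp: brownian_motion_rel_def)
  have 1: "sigma_sets (space M) {\<eta> -` A \<inter> space M |A. A \<in> sets borel} \<subseteq> sets (F s)"
    using sets.sigma_sets_subset[of "{\<eta> -` A \<inter> space M |A. A \<in> sets borel}" "F s"]
      space_F[of s] measurable_sets[OF \<eta>] assms by auto
  have 2: "sigma_sets (space M) {(\<lambda>\<omega>. B t \<omega> - B s \<omega>) -` A \<inter> space M |A. A \<in> sets borel}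
     = sets (vimage_algebra (space M) (\<lambda>\<omega>. B t \<omega> - B s \<omega>) borel)"
    by (subst sets_vimage_algebra) auto
  show "indep_set (sigma_sets (space M) {\<eta> -` A \<inter> space M |A. A \<in> sets borel})
      (sigma_sets (space M) {(\<lambda>\<omega>. B t \<omega> - B s \<omega>) -` A \<inter> space M |A. A \<in> sets borel})"
    using ind unfolding 2 indep_set_def
    by (rule indep_sets_mono_sets) (use 1 in \<open>auto split: bool.split\<close>)
qed

text \<open>Moments of a centred Gaussian law of variance \<open>t - s\<close>. The fourth moment is
  of order \<open>(t - s)^2\<close>, so over n steps of length T/n it adds up to O(1/n). Sign
  changes far from the origin and Taylor remainders are therefore bounded by fourth powers
  below.\<close>

lemma
  assumes "0 \<le> s" "s < t"
  shows integrable_increment_power: "integrable M (\<lambda>\<omega>. (B t \<omega> - B s \<omega>) ^ k)"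
    and increment_expectation: "expectation (\<lambda>\<omega>. B t \<omega> - B s \<omega>) = 0"
    and increment_second_moment: "expectation (\<lambda>\<omega>. (B t \<omega> - B s \<omega>)\<^sup>2) = t - s"
    and increment_fourth_moment: "expectation (\<lambda>\<omega>. (B t \<omega> - B s \<omega>) ^ 4) = 3 * (t - s)\<^sup>2"
proof -
  have \<sigma>: "sqrt (t - s) > 0" using assms by simp
  note D = increment_distributed[OF assms]
  show "integrable M (\<lambda>\<omega>. (B t \<omega> - B s \<omega>) ^ k)"
    using distributed_integrable[OF D, of "\<lambda>y. y ^ k"] integrable_normal_moment[OF \<sigma>, of 0 k] by simp
  show "expectation (\<lambda>\<omega>. B t \<omega> - B s \<omega>) = 0"
    using normal_distributed_expectation[OF \<sigma> D] .
  have "(\<integral>y. normal_density 0 (sqrt (t - s)) y * y ^ (2 * 1) \<partial>lborel) = t - s"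
    using integral_normal_moment_even[OF \<sigma>, of 0 1] assms by (simp add: power_divide)
  then show "expectation (\<lambda>\<omega>. (B t \<omega> - B s \<omega>)\<^sup>2) = t - s"
    using distributed_integral[OF D, of "\<lambda>y. y\<^sup>2"] by simp
  have "(\<integral>y. normal_density 0 (sqrt (t - s)) y * y ^ (2 * 2) \<partial>lborel) = 3 * (t - s)\<^sup>2"
    using integral_normal_moment_even[OF \<sigma>, of 0 2] assms
    by (simp add: power_divide fact_numeral)
  then show "expectation (\<lambda>\<omega>. (B t \<omega> - B s \<omega>) ^ 4) = 3 * (t - s)\<^sup>2"
    using distributed_integral[OF D, of "\<lambda>y. y ^ 4"] by simp
qed

text \<open>Independence factorizes the expectations. The last two claims are the martingale
  properties of \<open>B t\<close> and \<open>(B t)^2 - t\<close>, tested against a variable known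
  at time \<open>s\<close>.\<close>

lemma
  assumes "0 \<le> s" "s < t" and \<eta>: "\<eta> \<in> borel_measurable (F s)" "integrable M \<eta>"
  shows integrable_mult_increment_power: "integrable M (\<lambda>\<omega>. \<eta> \<omega> * (B t \<omega> - B s \<omega>) ^ k)"
    and expectation_mult_increment: "expectation (\<lambda>\<omega>. \<eta> \<omega> * (B t \<omega> - B s \<omega>)) = 0"
    and expectation_mult_increment_sq:
      "expectation (\<lambda>\<omega>. \<eta> \<omega> * (B t \<omega> - B s \<omega>)\<^sup>2) = (t - s) * expectation \<eta>"
proof -
  have ind: "indep_var borel \<eta> borel (\<lambda>\<omega>. (B t \<omega> - B s \<omega>) ^ k)" for k
    using indep_var_compose[OF increment_indep[OF assms(1-3)], of "\<lambda>y. y" borel "\<lambda>y. y ^ k" borel]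
    by (simp add: comp_def)
  note int = integrable_increment_power[OF assms(1,2)]
  show "integrable M (\<lambda>\<omega>. \<eta> \<omega> * (B t \<omega> - B s \<omega>) ^ k)"
    using indep_var_integrable[OF ind \<eta>(2) int] .
  show "expectation (\<lambda>\<omega>. \<eta> \<omega> * (B t \<omega> - B s \<omega>)) = 0"
    using indep_var_lebesgue_integral[OF ind \<eta>(2) int[of 1]] increment_expectation[OF assms(1,2)]
    by simp
  show "expectation (\<lambda>\<omega>. \<eta> \<omega> * (B t \<omega> - B s \<omega>)\<^sup>2) = (t - s) * expectation \<eta>"
    using indep_var_lebesgue_integral[OF ind \<eta>(2) int[of 2]] increment_second_moment[OF assms(1,2)]
    by simp
qed

lemma B_sq_integrable:
  assumes "0 \<le> t"
  shows "integrable M (\<lambda>\<omega>. (B t \<omega>)\<^sup>2)"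
proof (cases "t = 0")
  case True
  have "integrable M (\<lambda>\<omega>. (B 0 \<omega>)\<^sup>2) \<longleftrightarrow> integrable M (\<lambda>\<omega>. x\<^sup>2)"
    by (rule integrable_cong_AE) (use start in auto)
  with True show ?thesis by simp
next
  case False
  then have t: "0 < t" using assms by simp
  have [measurable]: "B t \<in> borel_measurable M" using assms by simp
  have "integrable M (\<lambda>\<omega>. 2 * (B t \<omega> - B 0 \<omega>)\<^sup>2 + 2 * x\<^sup>2)"
    using integrable_increment_power[OF order.refl t, of 2] by auto
  then show ?thesis
  proof (rule Bochner_Integration.integrable_bound)
    show "AE \<omega> in M. norm ((B t \<omega>)\<^sup>2) \<le> norm (2 * (B t \<omega> - B 0 \<omega>)\<^sup>2 + 2 * x\<^sup>2)"
      using start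
    proof eventually_elim
      case (elim \<omega>)
      have "(B t \<omega>)\<^sup>2 = ((B t \<omega> - B 0 \<omega>) + x)\<^sup>2" using elim by simp
      also have "\<dots> \<le> 2 * (B t \<omega> - B 0 \<omega>)\<^sup>2 + 2 * x\<^sup>2"
        using sum_squares_ge_zero[of "(B t \<omega> - B 0 \<omega>) - x" 0] by (simp add: power2_eq_square algebra_simps)
      finally show ?case by simp
    qed
  qed measurable
qed

lemma B_integrable: "0 \<le> t \<Longrightarrow> integrable M (B t)"
  by (rule square_integrable_imp_integrable[OF B_measurable B_sq_integrable])

end

section \<open>The martingale in Tanaka's formula\<close>

text \<open>A class stable under sums, differences and bounded factors, in which products of two
  members are integrable. With these closure rules most integrability checks below reduce to
  introduction rules.\<close>

definition sq_integrable :: "'a measure \<Rightarrow> ('a \<Rightarrow> real) \<Rightarrow> bool" where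
  "sq_integrable M f \<longleftrightarrow> f \<in> borel_measurable M \<and> integrable M (\<lambda>\<omega>. (f \<omega>)\<^sup>2)"

lemma sq_integrable_bound:
  assumes "g \<in> borel_measurable M" "integrable M h" "\<And>\<omega>. \<omega> \<in> space M \<Longrightarrow> (g \<omega>)\<^sup>2 \<le> h \<omega>"
  shows "sq_integrable M g"
  unfolding sq_integrable_def
proof (intro conjI)
  show "integrable M (\<lambda>\<omega>. (g \<omega>)\<^sup>2)"
    by (rule Bochner_Integration.integrable_bound[OF assms(2)])
      (use assms(1) in measurable, auto intro!: AE_I2 order.trans[OF assms(3)])
qed (rule assms(1))

lemma sq_integrable_add:
  assumes "sq_integrable M f" "sq_integrable M g"
  shows "sq_integrable M (\<lambda>\<omega>. f \<omega> + g \<omega>)"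
proof (rule sq_integrable_bound)
  show "integrable M (\<lambda>\<omega>. 2 * (f \<omega>)\<^sup>2 + 2 * (g \<omega>)\<^sup>2)"
    using assms by (auto simp: sq_integrable_def)
  show "(f \<omega> + g \<omega>)\<^sup>2 \<le> 2 * (f \<omega>)\<^sup>2 + 2 * (g \<omega>)\<^sup>2" for \<omega>
    using sum_squares_bound[of "f \<omega>" "g \<omega>"] by (simp add: power2_sum)
qed (use assms in \<open>auto simp: sq_integrable_def\<close>)

lemma sq_integrable_mult_bounded:
  assumes "sq_integrable M f" "\<xi> \<in> borel_measurable M" "\<And>\<omega>. \<omega> \<in> space M \<Longrightarrow> \<bar>\<xi> \<omega>\<bar> \<le> C"
  shows "sq_integrable M (\<lambda>\<omega>. \<xi> \<omega> * f \<omega>)"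
proof (rule sq_integrable_bound)
  show "integrable M (\<lambda>\<omega>. C\<^sup>2 * (f \<omega>)\<^sup>2)"
    using assms by (auto simp: sq_integrable_def)
  show "(\<xi> \<omega> * f \<omega>)\<^sup>2 \<le> C\<^sup>2 * (f \<omega>)\<^sup>2" if "\<omega> \<in> space M" for \<omega>
    using power_mono[OF assms(3)[OF that], of 2] by (simp add: power_mult_distrib mult_right_mono)
qed (use assms in \<open>auto simp: sq_integrable_def\<close>)

lemma sq_integrable_diff:
  assumes "sq_integrable M f" "sq_integrable M g"
  shows "sq_integrable M (\<lambda>\<omega>. f \<omega> - g \<omega>)"
proof -
  have "sq_integrable M (\<lambda>\<omega>. - g \<omega>)" using assms(2) by (simp add: sq_integrable_def)
  from sq_integrable_add[OF assms(1) this] show ?thesis by simp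
qed

lemma sq_integrable_abs: "sq_integrable M f \<Longrightarrow> sq_integrable M (\<lambda>\<omega>. \<bar>f \<omega>\<bar>)"
  by (auto simp: sq_integrable_def)

lemma sq_integrable_measurable: "sq_integrable M f \<Longrightarrow> f \<in> borel_measurable M"
  by (simp add: sq_integrable_def)

lemma integrable_mult_sq_integrable:
  assumes "sq_integrable M f" "sq_integrable M g"
  shows "integrable M (\<lambda>\<omega>. f \<omega> * g \<omega>)"
proof (rule Bochner_Integration.integrable_bound)
  show "integrable M (\<lambda>\<omega>. (f \<omega>)\<^sup>2 + (g \<omega>)\<^sup>2)" using assms by (auto simp: sq_integrable_def)
  show "AE \<omega> in M. norm (f \<omega> * g \<omega>) \<le> norm ((f \<omega>)\<^sup>2 + (g \<omega>)\<^sup>2)"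
  proof (rule AE_I2)
    fix \<omega>
    have "2 * \<bar>f \<omega>\<bar> * \<bar>g \<omega>\<bar> \<le> \<bar>f \<omega>\<bar>\<^sup>2 + \<bar>g \<omega>\<bar>\<^sup>2" by (rule sum_squares_bound)
    moreover have "0 \<le> \<bar>f \<omega>\<bar> * \<bar>g \<omega>\<bar>" by simp
    ultimately have "\<bar>f \<omega>\<bar> * \<bar>g \<omega>\<bar> \<le> \<bar>f \<omega>\<bar>\<^sup>2 + \<bar>g \<omega>\<bar>\<^sup>2" by linarith
    then show "norm (f \<omega> * g \<omega>) \<le> norm ((f \<omega>)\<^sup>2 + (g \<omega>)\<^sup>2)" by (simp add: abs_mult)
  qed
qed (use assms in \<open>auto simp: sq_integrable_def\<close>)

lemma (in prob_space) integrable_sq_integrable: "sq_integrable M f \<Longrightarrow> integrable M f"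
  using square_integrable_imp_integrable by (auto simp: sq_integrable_def)

text \<open>A weighted Young inequality, |\<eta> D| \<le> d \<eta>^2 + D^2 / d, takes the place of
  Cauchy-Schwarz: \<open>d\<close> is fixed first to make the \<eta> term small, and then
  \<open>k\<close> is taken large.\<close>

lemma sq_integrable_expectation_tendsto_0:
  assumes \<eta>: "sq_integrable M \<eta>" and D: "\<And>k::nat. sq_integrable M (D k)"
    and lim: "(\<lambda>k. \<integral>\<^sup>+\<omega>. ennreal ((D k \<omega>)\<^sup>2) \<partial>M) \<longlonglongrightarrow> 0"
  shows "(\<lambda>k. \<integral>\<omega>. \<eta> \<omega> * D k \<omega> \<partial>M) \<longlonglongrightarrow> 0"
proof (rule LIMSEQ_I)
  fix e :: real assume e: "0 < e"
  define c where "c = (\<integral>\<omega>. (\<eta> \<omega>)\<^sup>2 \<partial>M)"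
  have c: "0 \<le> c" unfolding c_def by simp
  \<comment> \<open>The added 1 covers \<open>c = 0\<close> and gives the strict bound
    \<open>d * c < e / 2\<close>; the other half of \<open>e\<close> is left for the second moment
    of \<open>D k\<close> divided by \<open>d\<close>.\<close>
  define d where "d = e / (2 * (c + 1))"
  have d: "0 < d" "d * c < e / 2"
    using e c by (auto simp: d_def field_simps)
  have "(\<integral>\<^sup>+\<omega>. ennreal ((D k \<omega>)\<^sup>2) \<partial>M) = ennreal (\<integral>\<omega>. (D k \<omega>)\<^sup>2 \<partial>M)" for k
    using D[of k] by (intro nn_integral_eq_integral) (auto simp: sq_integrable_def)
  with lim have "(\<lambda>k. ennreal (\<integral>\<omega>. (D k \<omega>)\<^sup>2 \<partial>M)) \<longlonglongrightarrow> ennreal 0" by simp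
  then have "(\<lambda>k. (\<integral>\<omega>. (D k \<omega>)\<^sup>2 \<partial>M)) \<longlonglongrightarrow> 0"
    by (rule tendsto_ennrealD) auto
  then have "eventually (\<lambda>k. (\<integral>\<omega>. (D k \<omega>)\<^sup>2 \<partial>M) < d * e / 2) sequentially"
    using d e by (intro order_tendstoD) auto
  then obtain N where N: "\<And>k. k \<ge> N \<Longrightarrow> (\<integral>\<omega>. (D k \<omega>)\<^sup>2 \<partial>M) < d * e / 2"
    by (auto simp: eventually_sequentially)
  have "norm ((\<integral>\<omega>. \<eta> \<omega> * D k \<omega> \<partial>M) - 0) < e" if "k \<ge> N" for k
  proof -
    have int: "integrable M (\<lambda>\<omega>. d * (\<eta> \<omega>)\<^sup>2 + (D k \<omega>)\<^sup>2 / d)"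
      using \<eta> D[of k] by (auto simp: sq_integrable_def)
    have "norm (\<integral>\<omega>. \<eta> \<omega> * D k \<omega> \<partial>M) \<le> (\<integral>\<omega>. norm (\<eta> \<omega> * D k \<omega>) \<partial>M)"
      by (rule integral_norm_bound)
    also have "\<dots> \<le> (\<integral>\<omega>. d * (\<eta> \<omega>)\<^sup>2 + (D k \<omega>)\<^sup>2 / d \<partial>M)"
    proof (rule integral_mono)
      show "integrable M (\<lambda>\<omega>. norm (\<eta> \<omega> * D k \<omega>))"
        using integrable_mult_sq_integrable[OF \<eta> D[of k]] by (rule integrable_norm)
      fix \<omega>
      have "0 \<le> (d * \<bar>\<eta> \<omega>\<bar> - \<bar>D k \<omega>\<bar>)\<^sup>2 / d" using d by simp
      also have "\<dots> = d * (\<eta> \<omega>)\<^sup>2 + (D k \<omega>)\<^sup>2 / d - 2 * (\<bar>\<eta> \<omega>\<bar> * \<bar>D k \<omega>\<bar>)"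
        using d by (simp add: power2_diff field_simps power2_eq_square)
      finally have "2 * (\<bar>\<eta> \<omega>\<bar> * \<bar>D k \<omega>\<bar>) \<le> d * (\<eta> \<omega>)\<^sup>2 + (D k \<omega>)\<^sup>2 / d" by simp
      moreover have "0 \<le> \<bar>\<eta> \<omega>\<bar> * \<bar>D k \<omega>\<bar>" by simp
      ultimately have "\<bar>\<eta> \<omega>\<bar> * \<bar>D k \<omega>\<bar> \<le> d * (\<eta> \<omega>)\<^sup>2 + (D k \<omega>)\<^sup>2 / d" by linarith
      then show "norm (\<eta> \<omega> * D k \<omega>) \<le> d * (\<eta> \<omega>)\<^sup>2 + (D k \<omega>)\<^sup>2 / d"
        by (simp add: abs_mult)
    qed (rule int)
    also have "\<dots> = d * c + (\<integral>\<omega>. (D k \<omega>)\<^sup>2 \<partial>M) / d"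
      using \<eta> D[of k] by (auto simp: sq_integrable_def c_def)
    also have "\<dots> < e / 2 + e / 2"
      using N[OF that] d by (intro add_strict_mono) (auto simp: field_simps)
    finally show ?thesis by simp
  qed
  then show "\<exists>N. \<forall>k\<ge>N. norm ((\<integral>\<omega>. \<eta> \<omega> * D k \<omega> \<partial>M) - 0) < e" by blast
qed

context brownian_local_time
begin

lemma sq_integrable_B: "0 \<le> t \<Longrightarrow> sq_integrable M (B t)"
  unfolding sq_integrable_def using B_sq_integrable B_measurable by blast

text \<open>Adds the degenerate case \<open>s = t\<close>, which has no Gaussian density but occurs
  when an interval is clipped to an empty one.\<close>

lemma expectation_mult_increment_le:
  assumes "0 \<le> s" "s \<le> t" and \<eta>: "\<eta> \<in> borel_measurable (F s)" "integrable M \<eta>"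
  shows "integrable M (\<lambda>\<omega>. \<eta> \<omega> * (B t \<omega> - B s \<omega>))"
    and "expectation (\<lambda>\<omega>. \<eta> \<omega> * (B t \<omega> - B s \<omega>)) = 0"
proof -
  have "integrable M (\<lambda>\<omega>. \<eta> \<omega> * (B t \<omega> - B s \<omega>)) \<and> expectation (\<lambda>\<omega>. \<eta> \<omega> * (B t \<omega> - B s \<omega>)) = 0"
  proof (cases "s = t")
    case False
    with assms have "s < t" by simp
    from integrable_mult_increment_power[OF assms(1) this \<eta>, of 1]
      expectation_mult_increment[OF assms(1) this \<eta>]
    show ?thesis by simp
  qed simp
  then show "integrable M (\<lambda>\<omega>. \<eta> \<omega> * (B t \<omega> - B s \<omega>))"
    "expectation (\<lambda>\<omega>. \<eta> \<omega> * (B t \<omega> - B s \<omega>)) = 0" by auto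
qed

lemma sq_integrable_elementary:
  assumes "0 \<le> a" "a \<le> b" "\<xi> \<in> borel_measurable (F a)" "\<And>\<omega>. \<omega> \<in> space M \<Longrightarrow> \<bar>\<xi> \<omega>\<bar> \<le> C" "0 \<le> t"
  shows "sq_integrable M (\<lambda>\<omega>. \<xi> \<omega> * (B (min b t) \<omega> - B (min a t) \<omega>))"
  by (rule sq_integrable_mult_bounded[where C = C])
    (auto intro!: sq_integrable_diff sq_integrable_B assms(4) measurable_F_M[OF assms(3,1)]
      simp: assms(1,5) order_trans[OF assms(1,2)])

lemma expectation_mult_elementary:
  assumes "0 \<le> a" "a \<le> b" and \<xi>: "\<xi> \<in> borel_measurable (F a)"
      "\<And>\<omega>. \<omega> \<in> space M \<Longrightarrow> \<bar>\<xi> \<omega>\<bar> \<le> C"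
    and "0 \<le> s" "s \<le> t" and \<eta>: "\<eta> \<in> borel_measurable (F s)" "sq_integrable M \<eta>"
  shows "expectation (\<lambda>\<omega>. \<eta> \<omega> * (\<xi> \<omega> * (B (min b t) \<omega> - B (min a t) \<omega>)
    - \<xi> \<omega> * (B (min b s) \<omega> - B (min a s) \<omega>))) = 0"
proof -
  \<comment> \<open>The interval from \<open>a'\<close> to \<open>b'\<close> is the part of (a, b]
    inside (s, t]. If \<open>a \<le> t\<close>, then \<open>a'\<close> lies after both
    \<open>a\<close> and \<open>s\<close>, so \<open>\<xi>\<close> and \<open>\<eta>\<close> are
    both known at time \<open>a'\<close> and the later increment is independent of their product. If
    \<open>a > t\<close>, the interval is empty.\<close>
  define a' where "a' = min (max a s) t"
  define b' where "b' = max (min b t) a'"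
  have eq: "\<xi> \<omega> * (B (min b t) \<omega> - B (min a t) \<omega>) - \<xi> \<omega> * (B (min b s) \<omega> - B (min a s) \<omega>)
    = \<xi> \<omega> * (B b' \<omega> - B a' \<omega>)" for \<omega>
    using assms(2,6) unfolding a'_def b'_def by (auto simp: min_def max_def algebra_simps)
  show ?thesis
  proof (cases "a \<le> t")
    case True
    then have a': "0 \<le> a'" "a \<le> a'" "s \<le> a'" "a' \<le> b'" using assms by (auto simp: a'_def b'_def)
    have m: "(\<lambda>\<omega>. \<xi> \<omega> * \<eta> \<omega>) \<in> borel_measurable (F a')"
      using measurable_F_mono[OF \<xi>(1) assms(1) a'(2)] measurable_F_mono[OF \<eta>(1) assms(5) a'(3)]
      by (rule borel_measurable_times)
    have "integrable M (\<lambda>\<omega>. \<xi> \<omega> * \<eta> \<omega>)"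
      by (rule integrable_sq_integrable, rule sq_integrable_mult_bounded[OF \<eta>(2) _ \<xi>(2)])
        (rule measurable_F_M[OF \<xi>(1) assms(1)])
    from expectation_mult_increment_le(2)[OF a'(1,4) m this] show ?thesis
      unfolding eq by (simp add: mult_ac)
  next
    case False
    then have "a' = b'" using assms by (auto simp: a'_def b'_def)
    then show ?thesis unfolding eq by simp
  qed
qed

section \<open>Simple integrals and their martingale property\<close>

lemma simple_integral_Cons:
  "simple_integral B ((a, b, \<xi>) # hs) t \<omega>
    = \<xi> \<omega> * (B (min b t) \<omega> - B (min a t) \<omega>) + simple_integral B hs t \<omega>"
  by (simp add: simple_integral_def)

lemma simple_integrand_Cons:
  assumes "simple_integrand F ((a, b, \<xi>) # hs)"
  obtains C where "0 \<le> a" "a \<le> b" "\<xi> \<in> borel_measurable (F a)"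
    "\<forall>\<omega>\<in>space M. \<bar>\<xi> \<omega>\<bar> \<le> C" "simple_integrand F hs"
  using assms space_F by (auto simp: simple_integrand_def)

lemma sq_integrable_simple_integral:
  assumes "simple_integrand F hs" "0 \<le> t"
  shows "sq_integrable M (simple_integral B hs t)"
  using assms
proof (induction hs)
  case Nil
  then show ?case by (simp add: simple_integral_def sq_integrable_def)
next
  case (Cons h hs)
  obtain a b \<xi> where h: "h = (a, b, \<xi>)" by (cases h)
  from Cons.prems(1)[unfolded h] obtain C where
    C': "0 \<le> a" "a \<le> b" "\<xi> \<in> borel_measurable (F a)" "\<forall>\<omega>\<in>space M. \<bar>\<xi> \<omega>\<bar> \<le> C"
    and hs: "simple_integrand F hs"
    by (rule simple_integrand_Cons)
  note C = C'(1-3) bspec[OF C'(4)]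
  have "sq_integrable M (\<lambda>\<omega>. \<xi> \<omega> * (B (min b t) \<omega> - B (min a t) \<omega>) + simple_integral B hs t \<omega>)"
    by (rule sq_integrable_add[OF sq_integrable_elementary[OF C Cons.prems(2)] Cons.IH[OF hs Cons.prems(2)]])
  then show ?case unfolding h simple_integral_Cons[abs_def] .
qed

lemma expectation_mult_simple_integral:
  assumes "simple_integrand F hs" "0 \<le> s" "s \<le> t"
    and \<eta>: "\<eta> \<in> borel_measurable (F s)" "sq_integrable M \<eta>"
  shows "expectation (\<lambda>\<omega>. \<eta> \<omega> * (simple_integral B hs t \<omega> - simple_integral B hs s \<omega>)) = 0"
  using assms(1)
proof (induction hs)
  case Nil
  then show ?case by (simp add: simple_integral_def)
next
  case (Cons h hs)
  obtain a b \<xi> where h: "h = (a, b, \<xi>)" by (cases h)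
  from Cons.prems(1)[unfolded h] obtain C where
    C': "0 \<le> a" "a \<le> b" "\<xi> \<in> borel_measurable (F a)" "\<forall>\<omega>\<in>space M. \<bar>\<xi> \<omega>\<bar> \<le> C"
    and hs: "simple_integrand F hs"
    by (rule simple_integrand_Cons)
  note C = C'(1-3) bspec[OF C'(4)]
  have t: "0 \<le> t" using assms by simp
  have eq: "\<eta> \<omega> * (simple_integral B (h # hs) t \<omega> - simple_integral B (h # hs) s \<omega>)
    = \<eta> \<omega> * (\<xi> \<omega> * (B (min b t) \<omega> - B (min a t) \<omega>) - \<xi> \<omega> * (B (min b s) \<omega> - B (min a s) \<omega>))
      + \<eta> \<omega> * (simple_integral B hs t \<omega> - simple_integral B hs s \<omega>)" for \<omega>
    unfolding h simple_integral_Cons by (simp add: algebra_simps)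
  show ?case unfolding eq
    by (subst Bochner_Integration.integral_add)
      (auto intro!: integrable_mult_sq_integrable sq_integrable_diff \<eta>(2) sq_integrable_elementary[OF C]
        sq_integrable_simple_integral hs assms(2) t
        simp: expectation_mult_elementary[OF C assms(2,3) \<eta>] Cons.IH[OF hs])
qed

text \<open>By Tanaka's formula this process is the stochastic integral of sgn(B) against
  \<open>B\<close>.\<close>

definition tanaka_martingale :: "real \<Rightarrow> 'a \<Rightarrow> real" where
  "tanaka_martingale t \<omega> = \<bar>B t \<omega>\<bar> - \<bar>B 0 \<omega>\<bar> - L t \<omega>"

lemma tanaka_martingale_approx:
  obtains hs :: "nat \<Rightarrow> 'a elementary_integrands" where
    "\<forall>k. simple_integrand F (hs k)"
    "\<forall>t\<ge>0. (\<lambda>k. \<integral>\<^sup>+\<omega>. ennreal ((simple_integral B (hs k) t \<omega> - tanaka_martingale t \<omega>)\<^sup>2) \<partial>M)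
             \<longlonglongrightarrow> 0"
  using tanaka unfolding is_ito_integral_def tanaka_martingale_def[symmetric] by blast

lemma tanaka_martingale_measurable [measurable]:
  "0 \<le> t \<Longrightarrow> tanaka_martingale t \<in> borel_measurable M"
  using tanaka unfolding is_ito_integral_def tanaka_martingale_def[abs_def] by blast

text \<open>Convergence of the squared distances to 0 makes one of them less than 1, hence finite;
  so the process differs from a square integrable simple integral by a square integrable
  variable.\<close>

lemma sq_integrable_tanaka_martingale:
  assumes "0 \<le> t"
  shows "sq_integrable M (tanaka_martingale t)"
proof -
  obtain hs :: "nat \<Rightarrow> 'a elementary_integrands" where hs': "\<forall>k. simple_integrand F (hs k)"
    "\<forall>t\<ge>0. (\<lambda>k. \<integral>\<^sup>+\<omega>. ennreal ((simple_integral B (hs k) t \<omega> - tanaka_martingale t \<omega>)\<^sup>2) \<partial>M)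
             \<longlonglongrightarrow> 0"
    by (rule tanaka_martingale_approx)
  note hs = spec[OF hs'(1)] hs'(2)[rule_format]
  note S = sq_integrable_simple_integral[OF hs(1) assms]
  note [measurable] = tanaka_martingale_measurable[OF assms] sq_integrable_measurable[OF S]
  from order_tendstoD(2)[OF hs(2)[OF assms], of 1]
  obtain k where k: "(\<integral>\<^sup>+\<omega>. ennreal ((simple_integral B (hs k) t \<omega> - tanaka_martingale t \<omega>)\<^sup>2) \<partial>M) < 1"
    by (auto simp: eventually_sequentially)
  have "integrable M (\<lambda>\<omega>. (simple_integral B (hs k) t \<omega> - tanaka_martingale t \<omega>)\<^sup>2)"
    by (rule integrableI_nonneg) (auto intro: order.strict_trans[OF k])
  then have "sq_integrable M (\<lambda>\<omega>. simple_integral B (hs k) t \<omega> - tanaka_martingale t \<omega>)"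
    unfolding sq_integrable_def by simp
  from sq_integrable_diff[OF S[of k] this] show ?thesis by simp
qed

text \<open>Simple integrals have this property exactly, and pairing with a square integrable
  \<open>\<eta>\<close> is continuous for \<open>L^2\<close> convergence.\<close>

lemma expectation_mult_tanaka_martingale:
  assumes s: "0 \<le> s" and st: "s \<le> t"
    and \<eta>: "\<eta> \<in> borel_measurable (F s)" "sq_integrable M \<eta>"
  shows "expectation (\<lambda>\<omega>. \<eta> \<omega> * (tanaka_martingale t \<omega> - tanaka_martingale s \<omega>)) = 0"
proof -
  have t: "0 \<le> t" using s st by simp
  obtain hs :: "nat \<Rightarrow> 'a elementary_integrands" where hs': "\<forall>k. simple_integrand F (hs k)"
    "\<forall>t\<ge>0. (\<lambda>k. \<integral>\<^sup>+\<omega>. ennreal ((simple_integral B (hs k) t \<omega> - tanaka_martingale t \<omega>)\<^sup>2) \<partial>M)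
             \<longlonglongrightarrow> 0"
    by (rule tanaka_martingale_approx)
  note hs = spec[OF hs'(1)] hs'(2)[rule_format]
  define D where "D k r \<omega> = simple_integral B (hs k) r \<omega> - tanaka_martingale r \<omega>" for k r \<omega>
  have D: "sq_integrable M (D k r)" if "0 \<le> r" for k r
    unfolding D_def[abs_def]
    by (intro sq_integrable_diff sq_integrable_simple_integral hs sq_integrable_tanaka_martingale that)
  have lim: "(\<lambda>k. expectation (\<lambda>\<omega>. \<eta> \<omega> * D k r \<omega>)) \<longlonglongrightarrow> 0" if "0 \<le> r" for r
    by (rule sq_integrable_expectation_tendsto_0[OF \<eta>(2) D[OF that]])
      (use hs(2)[OF that] in \<open>simp add: D_def\<close>)
  \<comment> \<open>The increment of the k-th simple integral contributes 0, so only the two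
    approximation errors remain. The left side does not depend on \<open>k\<close>, while the right
    side tends to 0.\<close>
  have eq: "expectation (\<lambda>\<omega>. \<eta> \<omega> * (tanaka_martingale t \<omega> - tanaka_martingale s \<omega>))
    = expectation (\<lambda>\<omega>. \<eta> \<omega> * D k s \<omega>) - expectation (\<lambda>\<omega>. \<eta> \<omega> * D k t \<omega>)" for k
  proof -
    have "expectation (\<lambda>\<omega>. \<eta> \<omega> * (tanaka_martingale t \<omega> - tanaka_martingale s \<omega>))
      = expectation (\<lambda>\<omega>. \<eta> \<omega> * (simple_integral B (hs k) t \<omega> - simple_integral B (hs k) s \<omega>)
          + (\<eta> \<omega> * D k s \<omega> - \<eta> \<omega> * D k t \<omega>))"
      by (simp add: D_def algebra_simps)
    also have "\<dots> = 0 + (expectation (\<lambda>\<omega>. \<eta> \<omega> * D k s \<omega>) - expectation (\<lambda>\<omega>. \<eta> \<omega> * D k t \<omega>))"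
      by (subst Bochner_Integration.integral_add, intro integrable_mult_sq_integrable \<eta>(2)
          sq_integrable_diff sq_integrable_simple_integral hs s t,
          intro Bochner_Integration.integrable_diff integrable_mult_sq_integrable \<eta>(2) D s t,
          subst Bochner_Integration.integral_diff)
        (auto intro!: integrable_mult_sq_integrable \<eta>(2) D s t
          simp: expectation_mult_simple_integral[OF hs(1) s st \<eta>])
    finally show ?thesis by simp
  qed
  have "(\<lambda>k. expectation (\<lambda>\<omega>. \<eta> \<omega> * D k s \<omega>) - expectation (\<lambda>\<omega>. \<eta> \<omega> * D k t \<omega>)) \<longlonglongrightarrow> 0 - 0"
    by (intro tendsto_diff lim s t)
  then show ?thesis unfolding eq[symmetric] by (simp add: LIMSEQ_const_iff)
qed

lemma sq_integrable_L: "0 \<le> t \<Longrightarrow> sq_integrable M (L t)"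
proof -
  assume t: "0 \<le> t"
  have "sq_integrable M (\<lambda>\<omega>. \<bar>B t \<omega>\<bar> - \<bar>B 0 \<omega>\<bar> - tanaka_martingale t \<omega>)"
    by (intro sq_integrable_diff sq_integrable_abs sq_integrable_B sq_integrable_tanaka_martingale t order.refl)
  then show ?thesis by (simp add: tanaka_martingale_def)
qed

text \<open>\<open>L\<close> compensates \<open>|B|\<close>. From here on Tanaka's formula is used
  only in this form, together with the square integrability of \<open>L\<close>.\<close>

lemma expectation_mult_L_increment:
  assumes s: "0 \<le> s" and st: "s \<le> t"
    and \<eta>: "\<eta> \<in> borel_measurable (F s)" "sq_integrable M \<eta>"
  shows "expectation (\<lambda>\<omega>. \<eta> \<omega> * (L t \<omega> - L s \<omega>)) = expectation (\<lambda>\<omega>. \<eta> \<omega> * (\<bar>B t \<omega>\<bar> - \<bar>B s \<omega>\<bar>))"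
proof -
  have t: "0 \<le> t" using s st by simp
  have "expectation (\<lambda>\<omega>. \<eta> \<omega> * (\<bar>B t \<omega>\<bar> - \<bar>B s \<omega>\<bar>))
     = expectation (\<lambda>\<omega>. \<eta> \<omega> * (L t \<omega> - L s \<omega>) + \<eta> \<omega> * (tanaka_martingale t \<omega> - tanaka_martingale s \<omega>))"
    by (simp add: tanaka_martingale_def algebra_simps)
  also have "\<dots> = expectation (\<lambda>\<omega>. \<eta> \<omega> * (L t \<omega> - L s \<omega>))"
    by (subst Bochner_Integration.integral_add)
      (auto intro!: integrable_mult_sq_integrable \<eta>(2) sq_integrable_diff sq_integrable_L
        sq_integrable_tanaka_martingale s t simp: expectation_mult_tanaka_martingale[OF s st \<eta>])
  finally show ?thesis by simp
qed

end

section \<open>Local time grows only at the origin\<close>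

text \<open>For \<open>n = 0\<close> division by zero puts all points at 0, so the last point equals
  \<open>T\<close> only for \<open>0 < n\<close>; limits are therefore examined for
  \<open>0 < n\<close>.\<close>

definition grid :: "real \<Rightarrow> nat \<Rightarrow> nat \<Rightarrow> real" where
  "grid T n i = T * real i / real n"

lemma grid_0 [simp]: "grid T n 0 = 0"
  by (simp add: grid_def)

lemma grid_n [simp]: "0 < n \<Longrightarrow> grid T n n = T"
  by (simp add: grid_def)

lemma grid_Suc: "grid T n (Suc i) = grid T n i + T / real n"
  by (simp add: grid_def add_divide_distrib ring_distribs)

lemma grid_nonneg: "0 < T \<Longrightarrow> 0 \<le> grid T n i"
  by (simp add: grid_def)

lemma grid_less_Suc: "0 < T \<Longrightarrow> i < n \<Longrightarrow> grid T n i < grid T n (Suc i)"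
  by (simp add: grid_Suc)

lemma grid_le: "0 < T \<Longrightarrow> i \<le> n \<Longrightarrow> grid T n i \<le> T"
  by (cases "n = 0") (auto simp: grid_def field_simps)

lemma sum_le_const_times:
  assumes "\<And>i. i < n \<Longrightarrow> f i \<le> (c :: real)"
  shows "(\<Sum>i<n. f i) \<le> real n * c"
  using sum_bounded_above[of "{..<n}" f c] assms by simp

text \<open>Comparison with the telescoping sum of 2 (sqrt(i + 1) - sqrt i). It serves to add up the
  probabilities, of order 1 / sqrt(s), that \<open>B s\<close> is close to 0.\<close>

lemma sum_inverse_sqrt_le: "(\<Sum>i<n. 1 / sqrt (real (Suc i))) \<le> 2 * sqrt (real n)"
proof (induction n)
  case (Suc n)
  have "1 / sqrt (real (Suc n)) \<le> 2 * (sqrt (real (Suc n)) - sqrt (real n))"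
  proof -
    have 1: "1 = (sqrt (real (Suc n)) - sqrt (real n)) * (sqrt (real (Suc n)) + sqrt (real n))"
      by (simp add: algebra_simps)
    have "(sqrt (real (Suc n)) - sqrt (real n)) * (sqrt (real (Suc n)) + sqrt (real n))
      \<le> (sqrt (real (Suc n)) - sqrt (real n)) * (2 * sqrt (real (Suc n)))"
      by (intro mult_left_mono) auto
    then have "1 \<le> 2 * (sqrt (real (Suc n)) - sqrt (real n)) * sqrt (real (Suc n))"
      using 1 by linarith
    then show ?thesis by (subst pos_divide_le_eq) auto
  qed
  with Suc show ?case by simp
qed simp

text \<open>The left side is 0 unless \<open>b\<close> and \<open>b'\<close> have opposite signs. In
  that case |b' - b| = |b| + |b'|, and it equals 2 |b| |b'|, at most (b' - b)^2 / 2. Either |b| <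
  \<rho>, which the indicator records, or the jump is at least \<rho> and its square is at most its
  fourth power divided by \<rho>^2.\<close>

lemma sign_change_bound:
  fixes b b' \<rho> :: real
  assumes "0 < \<rho>"
  shows "\<bar>b\<bar> * \<bar>b'\<bar> - b * b' \<le> (indicator {-\<rho><..<\<rho>} b * (b' - b)\<^sup>2 + (b' - b) ^ 4 / \<rho>\<^sup>2) / 2"
proof (cases "0 \<le> b * b'")
  case True
  then have "\<bar>b\<bar> * \<bar>b'\<bar> - b * b' = 0" by (simp add: abs_mult[symmetric])
  moreover have "0 \<le> indicator {-\<rho><..<\<rho>} b * (b' - b)\<^sup>2 + (b' - b) ^ 4 / \<rho>\<^sup>2"
    by (auto intro!: add_nonneg_nonneg)
  ultimately show ?thesis by simp
next
  case False
  then have eq: "\<bar>b\<bar> * \<bar>b'\<bar> - b * b' = 2 * \<bar>b\<bar> * \<bar>b'\<bar>" by (simp add: abs_mult[symmetric])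
  have N: "\<bar>b' - b\<bar> = \<bar>b\<bar> + \<bar>b'\<bar>" using False by (auto simp: abs_if mult_less_0_iff not_le)
  have "4 * \<bar>b\<bar> * \<bar>b'\<bar> \<le> (\<bar>b\<bar> + \<bar>b'\<bar>)\<^sup>2"
    using sum_squares_bound[of "\<bar>b\<bar>" "\<bar>b'\<bar>"] by (simp add: power2_sum)
  then have 1: "4 * \<bar>b\<bar> * \<bar>b'\<bar> \<le> (b' - b)\<^sup>2" using N by (metis power2_abs)
  then have 2: "2 * (\<bar>b\<bar> * \<bar>b'\<bar> - b * b') \<le> (b' - b)\<^sup>2" unfolding eq by simp
  have "(b' - b)\<^sup>2 \<le> indicator {-\<rho><..<\<rho>} b * (b' - b)\<^sup>2 + (b' - b) ^ 4 / \<rho>\<^sup>2"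
  proof (cases "\<bar>b\<bar> < \<rho>")
    case True
    then have "indicator {-\<rho><..<\<rho>} b = (1::real)" by (simp add: indicator_def abs_less_iff)
    then show ?thesis by simp
  next
    case F: False
    then have "\<rho> \<le> \<bar>b' - b\<bar>" using N by simp
    then have "\<rho>\<^sup>2 \<le> (b' - b)\<^sup>2" using assms by (simp add: abs_le_square_iff[symmetric])
    then have "\<rho>\<^sup>2 * (b' - b)\<^sup>2 \<le> (b' - b)\<^sup>2 * (b' - b)\<^sup>2" by (rule mult_right_mono) simp
    then have "(b' - b)\<^sup>2 \<le> (b' - b) ^ 4 / \<rho>\<^sup>2"
      using assms by (simp add: field_simps power4_eq_xxxx power2_eq_square)
    then show ?thesis by (rule order.trans) simp
  qed
  with 2 have "2 * (\<bar>b\<bar> * \<bar>b'\<bar> - b * b')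
    \<le> indicator {-\<rho><..<\<rho>} b * (b' - b)\<^sup>2 + (b' - b) ^ 4 / \<rho>\<^sup>2" by (rule order.trans)
  then show ?thesis by (subst pos_le_divide_eq) (simp_all only: mult.commute zero_less_numeral)
qed

context brownian_local_time
begin

text \<open>The Gaussian density is at most 1 / sqrt(2 pi s) whatever the starting point, the window
  has length 2 \<rho>, and 2 \<le> sqrt(2 pi).\<close>

lemma prob_B_near_0:
  assumes "0 < s" "0 < \<rho>"
  shows "expectation (\<lambda>\<omega>. indicator {-\<rho><..<\<rho>} (B s \<omega>)) \<le> \<rho> / sqrt s"
proof -
  have [measurable]: "B s \<in> borel_measurable M" using assms by simp
  have D: "distributed M lborel (\<lambda>\<omega>. B s \<omega> - B 0 \<omega>) (normal_density 0 (sqrt s))"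
    using increment_distributed[of 0 s] assms by simp
  have dens: "normal_density 0 (sqrt s) y \<le> 1 / sqrt (2 * pi * s)" for y
    using assms by (auto simp: normal_density_def intro!: divide_right_mono)
  let ?I = "{-\<rho>-x<..<\<rho>-x}"
  have "expectation (\<lambda>\<omega>. indicator {-\<rho><..<\<rho>} (B s \<omega>)) = expectation (\<lambda>\<omega>. indicator ?I (B s \<omega> - B 0 \<omega>))"
    by (rule integral_cong_AE) (use start in \<open>auto simp: indicator_def\<close>)
  also have "\<dots> = (\<integral>y. normal_density 0 (sqrt s) y * indicator ?I y \<partial>lborel)"
    by (rule distributed_integral[OF D, symmetric]) auto
  also have "\<dots> \<le> (\<integral>y. 1 / sqrt (2 * pi * s) * indicator ?I y \<partial>lborel)"
    using integrable_real_mult_indicator[of ?I lborel "normal_density 0 (sqrt s)"] assms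
    by (intro integral_mono mult_right_mono dens) (auto simp: mult.commute)
  also have "\<dots> = 1 / sqrt (2 * pi * s) * (2 * \<rho>)"
    using assms by (simp add: measure_def)
  also have "\<dots> \<le> \<rho> / sqrt s"
  proof -
    have "2 \<le> sqrt (2 * pi)" using pi_gt3 by (intro real_le_rsqrt) simp
    then have "2 * \<rho> / (sqrt (2 * pi) * sqrt s) \<le> sqrt (2 * pi) * \<rho> / (sqrt (2 * pi) * sqrt s)"
      using assms by (intro divide_right_mono mult_right_mono) auto
    then show ?thesis by (simp add: real_sqrt_mult)
  qed
  finally show ?thesis .
qed

text \<open>Replacing the increment of \<open>L\<close> by that of \<open>|B|\<close> and
  subtracting the zero expectation of \<open>B s * (B t - B s)\<close> cancels the squares and
  leaves |B s| |B t| - B s B t, to which the sign change bound applies.\<close>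

lemma expectation_abs_B_mult_L_increment:
  assumes s: "0 \<le> s" and st: "s < t" and \<rho>: "0 < \<rho>"
  shows "expectation (\<lambda>\<omega>. \<bar>B s \<omega>\<bar> * (L t \<omega> - L s \<omega>))
    \<le> ((t - s) * expectation (\<lambda>\<omega>. indicator {-\<rho><..<\<rho>} (B s \<omega>)) + 3 * (t - s)\<^sup>2 / \<rho>\<^sup>2) / 2"
proof -
  have t: "0 \<le> t" using s st by simp
  note [measurable] = B_adapted[OF s]
  have ind: "(\<lambda>\<omega>. indicator {-\<rho><..<\<rho>} (B s \<omega>) :: real) \<in> borel_measurable (F s)" by measurable
  have indM: "integrable M (\<lambda>\<omega>. indicator {-\<rho><..<\<rho>} (B s \<omega>) :: real)"
    by (rule integrable_const_bound[of _ 1]) (use measurable_F_M[OF ind s] in auto)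
  have abs: "(\<lambda>\<omega>. \<bar>B s \<omega>\<bar>) \<in> borel_measurable (F s)" by measurable
  have "expectation (\<lambda>\<omega>. \<bar>B s \<omega>\<bar> * (L t \<omega> - L s \<omega>)) = expectation (\<lambda>\<omega>. \<bar>B s \<omega>\<bar> * (\<bar>B t \<omega>\<bar> - \<bar>B s \<omega>\<bar>))"
    using expectation_mult_L_increment[OF s _ abs sq_integrable_abs[OF sq_integrable_B[OF s]]] st by simp
  also have "\<dots> = expectation (\<lambda>\<omega>. \<bar>B s \<omega>\<bar> * (\<bar>B t \<omega>\<bar> - \<bar>B s \<omega>\<bar>)) - expectation (\<lambda>\<omega>. B s \<omega> * (B t \<omega> - B s \<omega>))"
    using expectation_mult_increment[OF s st B_adapted[OF s] B_integrable[OF s]] by simp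
  also have "\<dots> = expectation (\<lambda>\<omega>. \<bar>B s \<omega>\<bar> * (\<bar>B t \<omega>\<bar> - \<bar>B s \<omega>\<bar>) - B s \<omega> * (B t \<omega> - B s \<omega>))"
    by (rule Bochner_Integration.integral_diff[symmetric])
      (intro integrable_mult_sq_integrable sq_integrable_abs sq_integrable_diff sq_integrable_B s t)+
  also have "\<dots> = expectation (\<lambda>\<omega>. \<bar>B s \<omega>\<bar> * \<bar>B t \<omega>\<bar> - B s \<omega> * B t \<omega>)"
    by (simp add: algebra_simps)
  also have "\<dots> \<le> expectation (\<lambda>\<omega>. (indicator {-\<rho><..<\<rho>} (B s \<omega>) * (B t \<omega> - B s \<omega>)\<^sup>2 + (B t \<omega> - B s \<omega>) ^ 4 / \<rho>\<^sup>2) / 2)"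
  proof (rule integral_mono)
    show "integrable M (\<lambda>\<omega>. \<bar>B s \<omega>\<bar> * \<bar>B t \<omega>\<bar> - B s \<omega> * B t \<omega>)"
      by (intro Bochner_Integration.integrable_diff integrable_mult_sq_integrable sq_integrable_abs
          sq_integrable_B s t)
    show "integrable M (\<lambda>\<omega>. (indicator {-\<rho><..<\<rho>} (B s \<omega>) * (B t \<omega> - B s \<omega>)\<^sup>2 + (B t \<omega> - B s \<omega>) ^ 4 / \<rho>\<^sup>2) / 2)"
      using integrable_mult_increment_power[OF s st ind indM, of 2] integrable_increment_power[OF s st, of 4]
      by auto
  qed (rule sign_change_bound[OF \<rho>])
  also have "\<dots> = ((t - s) * expectation (\<lambda>\<omega>. indicator {-\<rho><..<\<rho>} (B s \<omega>)) + 3 * (t - s)\<^sup>2 / \<rho>\<^sup>2) / 2"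
    using integrable_mult_increment_power[OF s st ind indM, of 2] integrable_increment_power[OF s st, of 4]
      expectation_mult_increment_sq[OF s st ind indM] increment_fourth_moment[OF s st]
    by simp
  finally show ?thesis .
qed

lemma sum_abs_B_mult_L_increment_le:
  assumes T: "0 < T" and n: "0 < n" and \<rho>: "0 < \<rho>"
  shows "(\<Sum>i<n. expectation (\<lambda>\<omega>. \<bar>B (grid T n i) \<omega>\<bar> * (L (grid T n (Suc i)) \<omega> - L (grid T n i) \<omega>)))
    \<le> (T / n + 2 * \<rho> * sqrt T + 3 * T\<^sup>2 / \<rho>\<^sup>2 / n) / 2"
proof -
  define h where "h = T / real n"
  have h: "0 < h" using T n by (simp add: h_def)
  define p :: "nat \<Rightarrow> real" where "p i = expectation (\<lambda>\<omega>. indicator {-\<rho><..<\<rho>} (B (grid T n i) \<omega>))" for i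
  obtain m where m: "n = Suc m" using n by (cases n) auto
  have p0: "p 0 \<le> 1"
  proof -
    have "p 0 \<le> expectation (\<lambda>\<omega>. 1)" unfolding p_def
    proof (rule integral_mono)
      show "integrable M (\<lambda>\<omega>. indicator {- \<rho><..<\<rho>} (B (grid T n 0) \<omega>) :: real)"
        by (rule integrable_const_bound[where B = 1]) (use B_measurable[of 0] in auto)
    qed (auto simp: indicator_def)
    then show ?thesis by (simp add: prob_space)
  qed
  have pS: "p (Suc i) \<le> \<rho> / sqrt h * (1 / sqrt (real (Suc i)))" for i
  proof -
    have g: "grid T n (Suc i) = h * real (Suc i)" by (simp add: grid_def h_def)
    then have "0 < grid T n (Suc i)" using h by simp
    from prob_B_near_0[OF this \<rho>] show ?thesis
      unfolding p_def g by (simp add: real_sqrt_mult)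
  qed
  have "(\<Sum>i<n. p i) = p 0 + (\<Sum>i<m. p (Suc i))" unfolding m by (rule sum.lessThan_Suc_shift)
  also have "\<dots> \<le> 1 + (\<Sum>i<m. \<rho> / sqrt h * (1 / sqrt (real (Suc i))))"
    by (intro add_mono p0 sum_mono pS)
  also have "\<dots> = 1 + \<rho> / sqrt h * (\<Sum>i<m. 1 / sqrt (real (Suc i)))" by (simp only: sum_distrib_left)
  also have "\<dots> \<le> 1 + \<rho> / sqrt h * (2 * sqrt (real m))"
    using \<rho> h by (intro add_left_mono mult_left_mono sum_inverse_sqrt_le) auto
  also have "\<dots> \<le> 1 + \<rho> / sqrt h * (2 * sqrt (real n))"
    using \<rho> h m by (intro add_left_mono mult_left_mono) auto
  finally have P: "(\<Sum>i<n. p i) \<le> 1 + \<rho> / sqrt h * (2 * sqrt (real n))" .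
  have "(\<Sum>i<n. expectation (\<lambda>\<omega>. \<bar>B (grid T n i) \<omega>\<bar> * (L (grid T n (Suc i)) \<omega> - L (grid T n i) \<omega>)))
    \<le> (\<Sum>i<n. (h * p i + 3 * h\<^sup>2 / \<rho>\<^sup>2) / 2)"
  proof (rule sum_mono)
    fix i assume "i \<in> {..<n}"
    then have "grid T n i < grid T n (Suc i)" using grid_less_Suc[OF T] by simp
    from expectation_abs_B_mult_L_increment[OF grid_nonneg[OF T] this \<rho>]
    show "expectation (\<lambda>\<omega>. \<bar>B (grid T n i) \<omega>\<bar> * (L (grid T n (Suc i)) \<omega> - L (grid T n i) \<omega>))
        \<le> (h * p i + 3 * h\<^sup>2 / \<rho>\<^sup>2) / 2"
      by (simp add: grid_Suc h_def p_def)
  qed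
  also have "\<dots> = (h * (\<Sum>i<n. p i) + real n * (3 * h\<^sup>2 / \<rho>\<^sup>2)) / 2"
    by (simp add: sum_divide_distrib[symmetric] sum.distrib sum_distrib_left)
  also have "\<dots> \<le> (h * (1 + \<rho> / sqrt h * (2 * sqrt (real n))) + real n * (3 * h\<^sup>2 / \<rho>\<^sup>2)) / 2"
    using h by (intro divide_right_mono add_right_mono mult_left_mono P) auto
  also have "\<dots> = (T / n + 2 * \<rho> * sqrt T + 3 * T\<^sup>2 / \<rho>\<^sup>2 / n) / 2"
  proof -
    have "h / sqrt h = sqrt h" using h by (simp add: real_div_sqrt)
    moreover have "sqrt h * sqrt (real n) = sqrt T" using n by (simp add: real_sqrt_mult[symmetric] h_def)
    ultimately have "h * (\<rho> / sqrt h * (2 * sqrt (real n))) = 2 * \<rho> * sqrt T"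
      by (metis (no_types, opaque_lifting) mult.assoc mult.commute times_divide_eq_left times_divide_eq_right)
    moreover have "real n * (3 * h\<^sup>2 / \<rho>\<^sup>2) = 3 * T\<^sup>2 / \<rho>\<^sup>2 / n"
      using n by (simp add: h_def field_simps power2_eq_square)
    ultimately show ?thesis by (simp add: ring_distribs h_def)
  qed
  finally show ?thesis .
qed

text \<open>Discrete form of the fact that \<open>dL\<close> is carried by the zeros of \<open>B\<close>. Since
  \<open>\<bar>B\<bar> - L\<close> and \<open>B\<close> are martingales, the sum only sees the sign changes of \<open>B\<close> along the grid.\<close>

lemma sum_abs_B_mult_L_increment_tendsto:
  assumes T: "0 < T"
  shows "(\<lambda>n. \<Sum>i<n. expectation (\<lambda>\<omega>. \<bar>B (grid T n i) \<omega>\<bar> * (L (grid T n (Suc i)) \<omega> - L (grid T n i) \<omega>)))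
    \<longlonglongrightarrow> 0" (is "?S \<longlonglongrightarrow> 0")
proof (rule LIMSEQ_I)
  fix e :: real assume e: "0 < e"
  \<comment> \<open>The term that does not decay in \<open>n\<close> becomes exactly
    \<open>e\<close>; the factor 1/2 in the estimate leaves room for the terms of order 1/n.\<close>
  define \<rho> where "\<rho> = e / (2 * sqrt T)"
  have \<rho>: "0 < \<rho>" "2 * \<rho> * sqrt T = e" using e T by (auto simp: \<rho>_def)
  have "(\<lambda>n. T / real n + 3 * T\<^sup>2 / \<rho>\<^sup>2 / real n) \<longlonglongrightarrow> 0 + 0"
    by (intro tendsto_add lim_const_over_n)
  then have "eventually (\<lambda>n. T / real n + 3 * T\<^sup>2 / \<rho>\<^sup>2 / real n < e) sequentially"
    using e by (intro order_tendstoD) auto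
  then have "eventually (\<lambda>n. norm (?S n - 0) < e) sequentially"
    using eventually_gt_at_top[of 0]
  proof eventually_elim
    case (elim n)
    have "0 \<le> ?S n"
    proof (intro sum_nonneg integral_nonneg_AE AE_I2 mult_nonneg_nonneg)
      fix i \<omega> assume i: "i \<in> {..<n}" and \<omega>: "\<omega> \<in> space M"
      have "grid T n i \<le> grid T n (Suc i)" using grid_less_Suc[OF T, of i n] i by simp
      from L_mono[OF \<omega> grid_nonneg[OF T] this]
      show "0 \<le> L (grid T n (Suc i)) \<omega> - L (grid T n i) \<omega>" by simp
    qed simp
    moreover have "?S n < e"
      using sum_abs_B_mult_L_increment_le[OF T elim(2) \<rho>(1)] elim(1) \<rho>(2) by simp
    ultimately show ?case by simp
  qed
  then show "\<exists>N. \<forall>n\<ge>N. norm (?S n - 0) < e" by (simp add: eventually_sequentially)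
qed

end

section \<open>The sticky clock\<close>

text \<open>Uniform continuity on the compact interval. It is applied path by path, so the threshold
  for \<open>n\<close> depends on the path and expectations are afterwards handled by dominated
  convergence.\<close>

lemma grid_oscillation:
  fixes q :: "real \<Rightarrow> real"
  assumes T: "0 < T" and q: "continuous_on {0..T} q" and e: "0 < e"
  shows "\<forall>\<^sub>F n in sequentially. \<forall>i<n. \<forall>r\<in>{grid T n i..grid T n (Suc i)}. \<bar>q r - q (grid T n i)\<bar> < e"
proof -
  have "uniformly_continuous_on {0..T} q"
    using q by (rule compact_uniformly_continuous) simp
  then obtain d where d: "0 < d" "\<And>r s. r \<in> {0..T} \<Longrightarrow> s \<in> {0..T} \<Longrightarrow> dist s r < d \<Longrightarrow> dist (q s) (q r) < e"
    using e unfolding uniformly_continuous_on_def by metis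
  have "(\<lambda>n. T / real n) \<longlonglongrightarrow> 0" by (rule lim_const_over_n)
  then have "\<forall>\<^sub>F n in sequentially. T / real n < d" using d(1) by (rule order_tendstoD)
  then show ?thesis
  proof eventually_elim
    case (elim n)
    show ?case
    proof (intro allI impI ballI)
      fix i r assume i: "i < n" and r: "r \<in> {grid T n i..grid T n (Suc i)}"
      have "r \<in> {0..T}" "grid T n i \<in> {0..T}"
        using r i grid_le[OF T, of "Suc i" n] grid_le[OF T, of i n] grid_nonneg[OF T, of n i] by auto
      moreover have "dist r (grid T n i) < d" using r elim by (simp add: dist_real_def grid_Suc)
      ultimately show "\<bar>q r - q (grid T n i)\<bar> < e" using d(2) by (simp add: dist_real_def)
    qed
  qed
qed

text \<open>The linear bound serves as a dominating function, the quadratic one gives convergence to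
  0.\<close>

lemma exp_increment_bounds:
  fixes lam z :: real
  assumes "0 < lam" "0 \<le> z"
  shows "\<bar>(1 - exp (- lam * z)) / lam - z\<bar> \<le> z"
    and "\<bar>(1 - exp (- lam * z)) / lam - z\<bar> \<le> lam * z\<^sup>2"
proof -
  have lz: "0 \<le> lam * z" using assms by simp
  have "1 - lam * z \<le> exp (- lam * z)" using exp_ge_add_one_self[of "- lam * z"] by simp
  then have up: "(1 - exp (- lam * z)) / lam \<le> z"
    using assms by (simp add: field_simps)
  have pos: "0 \<le> (1 - exp (- lam * z)) / lam" using assms by simp
  show "\<bar>(1 - exp (- lam * z)) / lam - z\<bar> \<le> z" using up pos by linarith
  have "exp (- lam * z) = 1 / exp (lam * z)" by (simp add: exp_minus inverse_eq_divide)
  also have "\<dots> \<le> 1 / (1 + lam * z)" using lz exp_ge_add_one_self[of "lam * z"]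
    by (intro divide_left_mono) auto
  \<comment> \<open>With y = lam z \<ge> 0, (1 - y + y^2)(1 + y) = 1 + y^3 \<ge> 1.\<close>
  also have "\<dots> \<le> 1 - lam * z + (lam * z)\<^sup>2"
  proof -
    have "1 \<le> (1 - lam * z + (lam * z)\<^sup>2) * (1 + lam * z)"
      using lz zero_le_power[OF lz, of 3] by (simp add: algebra_simps power2_eq_square power3_eq_cube)
    then show ?thesis using lz by (simp add: field_simps)
  qed
  finally have "lam * z - lam * (lam * z\<^sup>2) \<le> 1 - exp (- lam * z)"
    by (simp add: power2_eq_square algebra_simps)
  then have "z - lam * z\<^sup>2 \<le> (1 - exp (- lam * z)) / lam"
    using assms by (simp add: field_simps)
  then show "\<bar>(1 - exp (- lam * z)) / lam - z\<bar> \<le> lam * z\<^sup>2" using up by linarith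
qed

lemma (in prob_space) sq_integrable_bounded:
  assumes [measurable]: "f \<in> borel_measurable M" and "\<And>\<omega>. \<omega> \<in> space M \<Longrightarrow> \<bar>f \<omega>\<bar> \<le> C"
  shows "sq_integrable M f"
  by (rule sq_integrable_bound[where h = "\<lambda>_. C\<^sup>2"])
    (use assms in \<open>auto intro!: abs_le_square_iff[THEN iffD1] order.trans[OF assms(2)]\<close>)

lemma (in prob_space) expectation_tendsto_0:
  fixes X :: "nat \<Rightarrow> 'a \<Rightarrow> real"
  assumes "\<And>n. X n \<in> borel_measurable M" "integrable M D"
    and "\<And>n \<omega>. \<omega> \<in> space M \<Longrightarrow> \<bar>X n \<omega>\<bar> \<le> D \<omega>"
    and "\<And>\<omega>. \<omega> \<in> space M \<Longrightarrow> (\<lambda>n. X n \<omega>) \<longlonglongrightarrow> 0"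
  shows "(\<lambda>n. expectation (X n)) \<longlonglongrightarrow> 0"
proof -
  have "(\<lambda>n. expectation (X n)) \<longlonglongrightarrow> expectation (\<lambda>\<omega>. 0)"
    by (rule integral_dominated_convergence[where w = D]) (use assms in auto)
  then show ?thesis by simp
qed

locale sticky_brownian = brownian_local_time +
  fixes \<gamma> lam :: real
  assumes gamma_pos: "0 < \<gamma>" and lam_pos: "0 < lam"
begin

definition clock :: "real \<Rightarrow> 'a \<Rightarrow> real" where
  "clock t \<omega> = t + \<gamma> * L t \<omega>"

definition weight :: "real \<Rightarrow> 'a \<Rightarrow> real" where
  "weight t \<omega> = exp (- lam * clock t \<omega>)"

lemma clock_ge: "\<omega> \<in> space M \<Longrightarrow> 0 \<le> t \<Longrightarrow> t \<le> clock t \<omega>"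
  using L_nonneg gamma_pos by (simp add: clock_def)

lemma clock_0: "\<omega> \<in> space M \<Longrightarrow> clock 0 \<omega> = 0"
  using L_0 by (simp add: clock_def)

lemma clock_diff_ge: "\<omega> \<in> space M \<Longrightarrow> 0 \<le> s \<Longrightarrow> s \<le> t \<Longrightarrow> t - s \<le> clock t \<omega> - clock s \<omega>"
  using L_mono[of \<omega> s t] gamma_pos by (simp add: clock_def)

lemma clock_mono: "\<omega> \<in> space M \<Longrightarrow> 0 \<le> s \<Longrightarrow> s \<le> t \<Longrightarrow> clock s \<omega> \<le> clock t \<omega>"
  using clock_diff_ge[of \<omega> s t] by simp

lemma clock_cont: "\<omega> \<in> space M \<Longrightarrow> continuous_on {0..} (\<lambda>t. clock t \<omega>)"
  unfolding clock_def by (intro continuous_intros L_cont)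

lemma clock_measurable [measurable]: "0 \<le> t \<Longrightarrow> clock t \<in> borel_measurable M"
  unfolding clock_def[abs_def] by measurable

lemma clock_integrable: "0 \<le> t \<Longrightarrow> integrable M (clock t)"
  unfolding clock_def[abs_def] using integrable_sq_integrable[OF sq_integrable_L] by auto

lemma weight_adapted: "0 \<le> t \<Longrightarrow> weight t \<in> borel_measurable (F t)"
  using L_adapted[of t] unfolding weight_def[abs_def] clock_def by measurable

lemma weight_measurable [measurable]: "0 \<le> t \<Longrightarrow> weight t \<in> borel_measurable M"
  using weight_adapted measurable_F_M by blast

lemma weight_pos: "0 < weight t \<omega>"
  by (simp add: weight_def)

lemma weight_le: "\<omega> \<in> space M \<Longrightarrow> 0 \<le> t \<Longrightarrow> weight t \<omega> \<le> exp (- lam * t)"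
  using clock_ge[of \<omega> t] lam_pos by (simp add: weight_def)

lemma weight_0: "\<omega> \<in> space M \<Longrightarrow> weight 0 \<omega> = 1"
  by (simp add: weight_def clock_0)

lemma weight_antimono: "\<omega> \<in> space M \<Longrightarrow> 0 \<le> s \<Longrightarrow> s \<le> t \<Longrightarrow> weight t \<omega> \<le> weight s \<omega>"
  using clock_mono[of \<omega> s t] lam_pos by (simp add: weight_def)

lemma weight_le_1: "\<omega> \<in> space M \<Longrightarrow> 0 \<le> t \<Longrightarrow> weight t \<omega> \<le> 1"
  using weight_antimono[of \<omega> 0 t] weight_0 by simp

lemma abs_weight_le_1: "\<omega> \<in> space M \<Longrightarrow> 0 \<le> t \<Longrightarrow> \<bar>weight t \<omega>\<bar> \<le> 1"
  using weight_le_1[of \<omega> t] weight_pos[of t \<omega>] by simp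

text \<open>The error of the left endpoint rule in the identity - dw / lam = w (dt + \<gamma> dL),
  over one step.\<close>

definition clock_error :: "real \<Rightarrow> real \<Rightarrow> 'a \<Rightarrow> real" where
  "clock_error s t \<omega> = (weight s \<omega> - weight t \<omega>) / lam - weight s \<omega> * ((t - s) + \<gamma> * (L t \<omega> - L s \<omega>))"

lemma clock_error_measurable [measurable]:
  "0 \<le> s \<Longrightarrow> 0 \<le> t \<Longrightarrow> clock_error s t \<in> borel_measurable M"
  unfolding clock_error_def[abs_def] by measurable

text \<open>Taking \<open>weight s\<close>, which is at most 1, out of both terms leaves the error
  of the exponential at the clock increment.\<close>

lemma clock_error_bounds:
  assumes \<omega>: "\<omega> \<in> space M" and s: "0 \<le> s" and st: "s \<le> t"
  shows "\<bar>clock_error s t \<omega>\<bar> \<le> clock t \<omega> - clock s \<omega>"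
    and "\<bar>clock_error s t \<omega>\<bar> \<le> lam * (clock t \<omega> - clock s \<omega>)\<^sup>2"
proof -
  define z where "z = clock t \<omega> - clock s \<omega>"
  have z: "0 \<le> z" using clock_mono[OF \<omega> s st] by (simp add: z_def)
  have "weight t \<omega> = weight s \<omega> * exp (- lam * z)"
    by (simp add: weight_def z_def exp_add[symmetric] algebra_simps)
  moreover have "(t - s) + \<gamma> * (L t \<omega> - L s \<omega>) = z" by (simp add: z_def clock_def algebra_simps)
  ultimately have eq: "clock_error s t \<omega> = weight s \<omega> * ((1 - exp (- lam * z)) / lam - z)"
    by (simp add: clock_error_def field_simps)
  have le: "\<bar>clock_error s t \<omega>\<bar> \<le> \<bar>(1 - exp (- lam * z)) / lam - z\<bar>"
    unfolding eq abs_mult by (rule mult_left_le_one_le) (use abs_weight_le_1[OF \<omega> s] in auto)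
  show "\<bar>clock_error s t \<omega>\<bar> \<le> clock t \<omega> - clock s \<omega>"
    using le exp_increment_bounds(1)[OF lam_pos z] by (simp add: z_def)
  show "\<bar>clock_error s t \<omega>\<bar> \<le> lam * (clock t \<omega> - clock s \<omega>)\<^sup>2"
    using le exp_increment_bounds(2)[OF lam_pos z] by (simp add: z_def)
qed

lemma sum_clock_increments: "\<omega> \<in> space M \<Longrightarrow> 0 < n \<Longrightarrow>
    (\<Sum>i<n. clock (grid T n (Suc i)) \<omega> - clock (grid T n i) \<omega>) = clock T \<omega>"
  using sum_lessThan_telescope[of "\<lambda>i. clock (grid T n i) \<omega>" n] by (simp add: clock_0)

lemma sum_weight_decrements: "\<omega> \<in> space M \<Longrightarrow> 0 < n \<Longrightarrow>
    (\<Sum>i<n. weight (grid T n i) \<omega> - weight (grid T n (Suc i)) \<omega>) = 1 - weight T \<omega>"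
  using sum_lessThan_telescope'[of "\<lambda>i. weight (grid T n i) \<omega>" n] by (simp add: weight_0)

lemma integrable_clock_error:
  assumes "0 \<le> s" "s \<le> t"
  shows "integrable M (clock_error s t)"
proof (rule Bochner_Integration.integrable_bound)
  show "integrable M (\<lambda>\<omega>. clock t \<omega> - clock s \<omega>)"
    by (intro Bochner_Integration.integrable_diff clock_integrable) (use assms in auto)
  show "AE \<omega> in M. norm (clock_error s t \<omega>) \<le> norm (clock t \<omega> - clock s \<omega>)"
    using clock_error_bounds(1)[OF _ assms] by (intro AE_I2) (auto intro: order.trans abs_ge_self)
qed (use assms in auto)

text \<open>The linear bounds telescope to \<open>clock T\<close>, an integrable dominating
  variable. The quadratic bounds give at most lam times the largest clock increment times
  \<open>clock T\<close>, which tends to 0 on each path by continuity of the clock.\<close>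

lemma sum_clock_error_tendsto:
  assumes T: "0 < T"
  shows "(\<lambda>n. \<Sum>i<n. expectation (\<lambda>\<omega>. \<bar>clock_error (grid T n i) (grid T n (Suc i)) \<omega>\<bar>)) \<longlonglongrightarrow> 0"
proof -
  define X where "X n \<omega> = (\<Sum>i<n. \<bar>clock_error (grid T n i) (grid T n (Suc i)) \<omega>\<bar>)" for n \<omega>
  have g: "0 \<le> grid T n i" "i < n \<Longrightarrow> grid T n i \<le> grid T n (Suc i)" for n i
    using grid_nonneg[OF T] grid_less_Suc[OF T, of i n] by auto
  have T0: "0 \<le> T" using T by simp
  have eq: "expectation (X n) = (\<Sum>i<n. expectation (\<lambda>\<omega>. \<bar>clock_error (grid T n i) (grid T n (Suc i)) \<omega>\<bar>))" for n
    unfolding X_def[abs_def]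
    by (intro Bochner_Integration.integral_sum integrable_abs integrable_clock_error g) auto
  have "(\<lambda>n. expectation (X n)) \<longlonglongrightarrow> 0"
  proof (rule expectation_tendsto_0)
    show "X n \<in> borel_measurable M" for n
      unfolding X_def[abs_def] using g(1) by measurable
    show "integrable M (clock T)" by (rule clock_integrable[OF T0])
    show "\<bar>X n \<omega>\<bar> \<le> clock T \<omega>" if \<omega>: "\<omega> \<in> space M" for n \<omega>
    proof (cases "n = 0")
      case True
      then show ?thesis using clock_ge[OF \<omega> T0] T0 by (simp add: X_def)
    next
      case False
      have "X n \<omega> \<le> (\<Sum>i<n. clock (grid T n (Suc i)) \<omega> - clock (grid T n i) \<omega>)"
        unfolding X_def by (intro sum_mono clock_error_bounds(1) \<omega> g) auto
      also have "\<dots> = clock T \<omega>" using False by (intro sum_clock_increments \<omega>) simp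
      finally show ?thesis by (simp add: X_def sum_nonneg abs_of_nonneg)
    qed
    show "(\<lambda>n. X n \<omega>) \<longlonglongrightarrow> 0" if \<omega>: "\<omega> \<in> space M" for \<omega>
    proof (rule LIMSEQ_I)
      fix e :: real assume e: "0 < e"
      \<comment> \<open>The added 1 makes \<open>lam * d * clock T \<omega>\<close> strictly smaller
        than \<open>e\<close>.\<close>
      define d where "d = e / (lam * (clock T \<omega> + 1))"
      have cT: "0 \<le> clock T \<omega>" using clock_ge[OF \<omega> T0] T0 by simp
      have d0: "0 < d" unfolding d_def using e cT lam_pos by (intro divide_pos_pos mult_pos_pos) auto
      have "lam * d = e / (clock T \<omega> + 1)" using lam_pos by (simp add: d_def)
      then have d: "0 < d" "lam * d * clock T \<omega> < e" using d0 e cT lam_pos by (auto simp: field_simps)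
      have "continuous_on {0..T} (\<lambda>t. clock t \<omega>)"
        by (rule continuous_on_subset[OF clock_cont[OF \<omega>]]) auto
      from grid_oscillation[OF T this d(1)]
      have "\<forall>\<^sub>F n in sequentially. norm (X n \<omega> - 0) < e"
        using eventually_gt_at_top[of 0]
      proof eventually_elim
        case (elim n)
        have "X n \<omega> \<le> (\<Sum>i<n. lam * d * (clock (grid T n (Suc i)) \<omega> - clock (grid T n i) \<omega>))"
          unfolding X_def
        proof (rule sum_mono)
          fix i assume "i \<in> {..<n}"
          then have i: "i < n" by simp
          let ?z = "clock (grid T n (Suc i)) \<omega> - clock (grid T n i) \<omega>"
          have z: "0 \<le> ?z" using clock_mono[OF \<omega> g(1) g(2)[OF i]] by simp
          have "\<bar>?z\<bar> < d" using elim(1) i g(2)[OF i] by auto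
          then have "?z \<le> d" by linarith
          then have "?z * ?z \<le> d * ?z" using z by (intro mult_right_mono)
          then have "lam * ?z\<^sup>2 \<le> lam * d * ?z"
            unfolding power2_eq_square mult.assoc using lam_pos by (intro mult_left_mono) auto
          with clock_error_bounds(2)[OF \<omega> g(1) g(2)[OF i]]
          show "\<bar>clock_error (grid T n i) (grid T n (Suc i)) \<omega>\<bar> \<le> lam * d * ?z" by (rule order.trans)
        qed
        also have "\<dots> = lam * d * clock T \<omega>"
          by (simp only: sum_distrib_left[symmetric] sum_clock_increments[OF \<omega> elim(2)])
        finally have "X n \<omega> < e" using d(2) by simp
        moreover have "0 \<le> X n \<omega>" by (simp add: X_def sum_nonneg)
        ultimately show ?case by simp
      qed
      then show "\<exists>N. \<forall>n\<ge>N. norm (X n \<omega> - 0) < e" by (simp add: eventually_sequentially)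
    qed
  qed
  then show ?thesis by (simp add: eq)
qed

text \<open>The covariation of a continuous process and a monotone one vanishes:
  \<open>weight\<close> decreases by at most 1 in total, so on each path the sum is bounded by the
  largest increment of \<open>u (B t \<omega>)\<close> over the grid. Boundedness of
  \<open>u\<close> gives the domination.\<close>

lemma sum_cross_increments_tendsto:
  assumes T: "0 < T" and u: "continuous_on UNIV u" and C: "\<And>b. \<bar>u b\<bar> \<le> C"
  shows "(\<lambda>n. \<Sum>i<n. expectation (\<lambda>\<omega>. (u (B (grid T n (Suc i)) \<omega>) - u (B (grid T n i) \<omega>))
    * (weight (grid T n (Suc i)) \<omega> - weight (grid T n i) \<omega>))) \<longlonglongrightarrow> 0"
proof -
  define Y where "Y n i \<omega> = (u (B (grid T n (Suc i)) \<omega>) - u (B (grid T n i) \<omega>))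
    * (weight (grid T n (Suc i)) \<omega> - weight (grid T n i) \<omega>)" for n i \<omega>
  define X where "X n \<omega> = (\<Sum>i<n. Y n i \<omega>)" for n \<omega>
  have g: "0 \<le> grid T n i" "i < n \<Longrightarrow> grid T n i \<le> grid T n (Suc i)" for n i
    using grid_nonneg[OF T] grid_less_Suc[OF T, of i n] by auto
  have [measurable]: "u \<in> borel_measurable borel" by (rule borel_measurable_continuous_onI[OF u])
  have Ym [measurable]: "Y n i \<in> borel_measurable M" for n i
    unfolding Y_def[abs_def] using g(1)[of n i] g(1)[of n "Suc i"] by measurable
  have C0: "0 \<le> C" using C[of 0] by linarith
  have bound: "\<bar>X n \<omega>\<bar> \<le> d" if \<omega>: "\<omega> \<in> space M" and n: "0 < n" and d: "0 \<le> d"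
      and "\<And>i. i < n \<Longrightarrow> \<bar>u (B (grid T n (Suc i)) \<omega>) - u (B (grid T n i) \<omega>)\<bar> \<le> d" for n \<omega> d
  proof -
    have "\<bar>X n \<omega>\<bar> \<le> (\<Sum>i<n. \<bar>Y n i \<omega>\<bar>)" unfolding X_def by (rule sum_abs)
    also have "\<dots> \<le> (\<Sum>i<n. d * (weight (grid T n i) \<omega> - weight (grid T n (Suc i)) \<omega>))"
    proof (rule sum_mono)
      fix i assume "i \<in> {..<n}"
      then have i: "i < n" by simp
      show "\<bar>Y n i \<omega>\<bar> \<le> d * (weight (grid T n i) \<omega> - weight (grid T n (Suc i)) \<omega>)"
        unfolding Y_def abs_mult using that(4)[OF i] weight_antimono[OF \<omega> g(1) g(2)[OF i]] d
        by (intro mult_mono) auto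
    qed
    also have "\<dots> = d * (1 - weight T \<omega>)"
      by (simp only: sum_distrib_left[symmetric] sum_weight_decrements[OF \<omega> n])
    also have "\<dots> \<le> d * 1" using d weight_pos[of T \<omega>] by (intro mult_left_mono) auto
    finally show ?thesis by simp
  qed
  have uB: "\<bar>u b - u b'\<bar> \<le> 2 * C" for b b' using C[of b] C[of b'] by linarith
  have intY: "integrable M (Y n i)" if i: "i < n" for n i
  proof (rule integrable_const_bound[where B = "2 * C * 1"])
    show "AE \<omega> in M. norm (Y n i \<omega>) \<le> 2 * C * 1"
    proof (rule AE_I2)
      fix \<omega> assume \<omega>: "\<omega> \<in> space M"
      have "\<bar>weight (grid T n (Suc i)) \<omega> - weight (grid T n i) \<omega>\<bar> \<le> 1"
        using weight_le_1[OF \<omega> g(1), of n i] weight_le_1[OF \<omega> g(1), of n "Suc i"]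
          weight_pos[of "grid T n i" \<omega>] weight_pos[of "grid T n (Suc i)" \<omega>] by linarith
      then show "norm (Y n i \<omega>) \<le> 2 * C * 1"
        unfolding Y_def real_norm_def abs_mult using C0 by (intro mult_mono uB) auto
    qed
  qed simp
  have eq: "expectation (X n) = (\<Sum>i<n. expectation (Y n i))" for n
    unfolding X_def[abs_def] by (intro Bochner_Integration.integral_sum intY) auto
  have "(\<lambda>n. expectation (X n)) \<longlonglongrightarrow> 0"
  proof (rule expectation_tendsto_0)
    show "X n \<in> borel_measurable M" for n unfolding X_def[abs_def] by measurable
    show "integrable M (\<lambda>\<omega>. 2 * C)" by simp
    show "\<bar>X n \<omega>\<bar> \<le> 2 * C" if \<omega>: "\<omega> \<in> space M" for n \<omega>
    proof (cases "n = 0")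
      case True
      then show ?thesis using C0 by (simp add: X_def)
    next
      case False
      then show ?thesis by (intro bound \<omega> uB) (use C0 in auto)
    qed
    show "(\<lambda>n. X n \<omega>) \<longlonglongrightarrow> 0" if \<omega>: "\<omega> \<in> space M" for \<omega>
    proof (rule LIMSEQ_I)
      fix e :: real assume e: "0 < e"
      have "continuous_on {0..T} (\<lambda>t. u (B t \<omega>))"
        by (rule continuous_on_compose2[OF u continuous_on_subset[OF B_cont[OF \<omega>]]]) auto
      from grid_oscillation[OF T this half_gt_zero[OF e]]
      have "\<forall>\<^sub>F n in sequentially. norm (X n \<omega> - 0) < e"
        using eventually_gt_at_top[of 0]
      proof eventually_elim
        case (elim n)
        have "\<bar>X n \<omega>\<bar> \<le> e / 2"
          by (rule bound[OF \<omega> elim(2)]) (use e elim(1) g(2) in \<open>auto intro!: less_imp_le\<close>)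
        then show ?case using e by simp
      qed
      then show "\<exists>N. \<forall>n\<ge>N. norm (X n \<omega> - 0) < e" by (simp add: eventually_sequentially)
    qed
  qed
  then show ?thesis by (simp add: eq Y_def[abs_def])
qed

end

section \<open>Second-order expansions along a partition\<close>

text \<open>Locating \<open>c\<close> by its distance to \<open>b\<close> treats both orders of the
  points and the case \<open>b' = b\<close> alike.\<close>

lemma second_order_taylor:
  fixes g g1 g2 :: "real \<Rightarrow> real"
  assumes g: "\<And>b. (g has_real_derivative g1 b) (at b)"
    and g1: "\<And>b. (g1 has_real_derivative g2 b) (at b)"
  shows "\<exists>c. \<bar>c - b\<bar> \<le> \<bar>b' - b\<bar> \<and> g b' - g b = g1 b * (b' - b) + g2 c / 2 * (b' - b)\<^sup>2"
proof (cases "b' = b")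
  case True
  then show ?thesis by auto
next
  case False
  define diff where "diff m = (if m = 0 then g else if m = 1 then g1 else g2)" for m :: nat
  have "\<exists>t. (if b' < b then b' < t \<and> t < b else b < t \<and> t < b') \<and>
    g b' = (\<Sum>m<2. (diff m b / fact m) * (b' - b)^m) + (diff 2 t / fact 2) * (b' - b)^2"
    by (rule Taylor[where a = "min b b'" and b = "max b b'"])
      (use False g g1 in \<open>auto simp: diff_def less_2_cases_iff\<close>)
  then obtain t where t: "if b' < b then b' < t \<and> t < b else b < t \<and> t < b'"
    and eq: "g b' = (\<Sum>m<2. (diff m b / fact m) * (b' - b)^m) + (diff 2 t / fact 2) * (b' - b)^2"
    by blast
  have "g b' - g b = g1 b * (b' - b) + g2 t / 2 * (b' - b)\<^sup>2"
    using eq by (simp add: diff_def numeral_2_eq_2)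
  moreover have "\<bar>t - b\<bar> \<le> \<bar>b' - b\<bar>" using t by (auto split: if_splits)
  ultimately show ?thesis by blast
qed

text \<open>Within distance \<open>d\<close> the modulus of continuity of \<open>g2\<close> gives
  the small quadratic term; beyond it the bound on \<open>g2\<close> is paid for by (b' - b)^2 / d^2
  \<ge> 1. Both powers have explicit Gaussian expectations.\<close>

lemma second_order_taylor_remainder:
  fixes g g1 g2 :: "real \<Rightarrow> real"
  assumes g: "\<And>b. (g has_real_derivative g1 b) (at b)"
    and g1: "\<And>b. (g1 has_real_derivative g2 b) (at b)"
    and uc: "uniformly_continuous_on UNIV g2" and C: "\<And>b. \<bar>g2 b\<bar> \<le> C" and e: "0 < e"
  obtains K where "0 \<le> K" "\<forall>b b'. \<bar>g b' - g b - g1 b * (b' - b) - g2 b / 2 * (b' - b)\<^sup>2\<bar>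
    \<le> e * (b' - b)\<^sup>2 + K * (b' - b) ^ 4"
proof -
  from uc e obtain d where d: "0 < d" "\<And>b c. dist c b < d \<Longrightarrow> dist (g2 c) (g2 b) < e"
    unfolding uniformly_continuous_on_def by (metis UNIV_I)
  have C0: "0 \<le> C" using C[of 0] by linarith
  have "\<bar>g b' - g b - g1 b * (b' - b) - g2 b / 2 * (b' - b)\<^sup>2\<bar>
    \<le> e * (b' - b)\<^sup>2 + C / d\<^sup>2 * (b' - b) ^ 4" for b b'
  proof -
    obtain c where c: "\<bar>c - b\<bar> \<le> \<bar>b' - b\<bar>" "g b' - g b = g1 b * (b' - b) + g2 c / 2 * (b' - b)\<^sup>2"
      using second_order_taylor[of g g1 g2 b b', OF g g1] by blast
    have "g b' - g b - g1 b * (b' - b) - g2 b / 2 * (b' - b)\<^sup>2 = (g2 c - g2 b) / 2 * (b' - b)\<^sup>2"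
      using c(2) by (simp add: field_simps)
    then have eq: "\<bar>g b' - g b - g1 b * (b' - b) - g2 b / 2 * (b' - b)\<^sup>2\<bar> = \<bar>(g2 c - g2 b) / 2\<bar> * (b' - b)\<^sup>2"
      by (simp only: abs_mult abs_power2)
    have K4: "0 \<le> C / d\<^sup>2 * (b' - b) ^ 4" using C0 by simp
    have e4: "0 \<le> e * (b' - b)\<^sup>2" using e by simp
    show ?thesis
    proof (cases "\<bar>b' - b\<bar> < d")
      case True
      then have "\<bar>g2 c - g2 b\<bar> < e" using d(2)[of c b] c(1) by (simp add: dist_real_def)
      then have "\<bar>(g2 c - g2 b) / 2\<bar> * (b' - b)\<^sup>2 \<le> e * (b' - b)\<^sup>2"
        by (intro mult_right_mono) auto
      then show ?thesis using K4 unfolding eq by linarith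
    next
      case False
      then have "d\<^sup>2 \<le> (b' - b)\<^sup>2" using d(1) by (simp add: abs_le_square_iff[symmetric])
      then have "1 \<le> (b' - b)\<^sup>2 / d\<^sup>2" using d(1) by simp
      then have "C * 1 \<le> C * ((b' - b)\<^sup>2 / d\<^sup>2)" using C0 by (rule mult_left_mono)
      moreover have "\<bar>g2 c - g2 b\<bar> \<le> 2 * C" using C[of c] C[of b] by linarith
      then have "\<bar>(g2 c - g2 b) / 2\<bar> \<le> C" by simp
      ultimately have "\<bar>(g2 c - g2 b) / 2\<bar> \<le> C * ((b' - b)\<^sup>2 / d\<^sup>2)" by linarith
      then have "\<bar>(g2 c - g2 b) / 2\<bar> * (b' - b)\<^sup>2 \<le> C * ((b' - b)\<^sup>2 / d\<^sup>2) * (b' - b)\<^sup>2"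
        by (rule mult_right_mono) simp
      also have "\<dots> = C / d\<^sup>2 * (b' - b) ^ 4" by (simp add: power4_eq_xxxx power2_eq_square)
      finally show ?thesis using e4 unfolding eq by linarith
    qed
  qed
  then show thesis using C0 by (intro that[of "C / d\<^sup>2"]) auto
qed

text \<open>The null sequence may depend on \<open>e\<close>. This matters because the constants in
  the estimates below blow up as \<open>e\<close> tends to 0.\<close>

lemma tendsto_0_of_le:
  fixes S :: "nat \<Rightarrow> real"
  assumes "\<And>e. 0 < e \<Longrightarrow> \<exists>r. r \<longlonglongrightarrow> 0 \<and> (\<forall>\<^sub>F n in sequentially. \<bar>S n\<bar> \<le> e + r n)"
  shows "S \<longlonglongrightarrow> 0"
proof (rule tendstoI)
  fix e :: real assume e: "0 < e"
  from assms[OF half_gt_zero[OF e]] obtain r where r: "r \<longlonglongrightarrow> 0"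
    "\<forall>\<^sub>F n in sequentially. \<bar>S n\<bar> \<le> e / 2 + r n" by blast
  have "\<forall>\<^sub>F n in sequentially. r n < e / 2" by (rule order_tendstoD(2)[OF r(1) half_gt_zero[OF e]])
  with r(2) show "\<forall>\<^sub>F n in sequentially. dist (S n) 0 < e"
    by eventually_elim (simp add: dist_real_def)
qed

context sticky_brownian
begin

lemma measurable_comp_adapted:
  "(f :: real \<Rightarrow> real) \<in> borel_measurable borel \<Longrightarrow> 0 \<le> s \<Longrightarrow> (\<lambda>\<omega>. f (B s \<omega>)) \<in> borel_measurable (F s)"
  by (rule measurable_compose[OF B_adapted])

lemma measurable_comp_B:
  "(f :: real \<Rightarrow> real) \<in> borel_measurable borel \<Longrightarrow> 0 \<le> s \<Longrightarrow> (\<lambda>\<omega>. f (B s \<omega>)) \<in> borel_measurable M"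
  by (rule measurable_compose[OF B_measurable])

lemma sq_integrable_weight_mult:
  assumes "sq_integrable M f" "0 \<le> s"
  shows "sq_integrable M (\<lambda>\<omega>. weight s \<omega> * f \<omega>)"
  using assms(1) weight_measurable[OF assms(2)] abs_weight_le_1[OF _ assms(2)]
  by (rule sq_integrable_mult_bounded)

lemma sq_integrable_comp_B:
  assumes "f \<in> borel_measurable borel" "\<And>b. \<bar>f b\<bar> \<le> C" "0 \<le> s"
  shows "sq_integrable M (\<lambda>\<omega>. f (B s \<omega>))"
  using measurable_comp_B[OF assms(1,3)] assms(2) by (rule sq_integrable_bounded)

text \<open>Ito's formula for one step in expectation: the first order term has mean 0, in the
  second order term the squared increment is replaced by \<open>t - s\<close>, and the remainder is
  bounded through the second and fourth moments, as \<open>weight\<close> lies between 0 and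
  1.\<close>

lemma ito_step:
  fixes g g1 g2 :: "real \<Rightarrow> real"
  assumes s: "0 \<le> s" and st: "s < t"
    and g: "g \<in> borel_measurable borel"
    and g1: "g1 \<in> borel_measurable borel" "\<And>b. \<bar>g1 b\<bar> \<le> C1"
    and g2: "g2 \<in> borel_measurable borel" "\<And>b. \<bar>g2 b\<bar> \<le> C2"
    and K: "0 \<le> K" "0 \<le> e"
    and rem: "\<And>b b'. \<bar>g b' - g b - g1 b * (b' - b) - g2 b / 2 * (b' - b)\<^sup>2\<bar>
      \<le> e * (b' - b)\<^sup>2 + K * (b' - b) ^ 4"
  shows "integrable M (\<lambda>\<omega>. weight s \<omega> * (g (B t \<omega>) - g (B s \<omega>)))"
    and "\<bar>expectation (\<lambda>\<omega>. weight s \<omega> * (g (B t \<omega>) - g (B s \<omega>)))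
      - (t - s) * expectation (\<lambda>\<omega>. weight s \<omega> * g2 (B s \<omega>)) / 2\<bar> \<le> e * (t - s) + 3 * K * (t - s)\<^sup>2"
proof -
  have t: "0 \<le> t" using s st by simp
  define N where "N \<omega> = B t \<omega> - B s \<omega>" for \<omega>
  define R where "R \<omega> = weight s \<omega> * (g (B t \<omega>) - g (B s \<omega>) - g1 (B s \<omega>) * N \<omega> - g2 (B s \<omega>) / 2 * (N \<omega>)\<^sup>2)" for \<omega>
  define D where "D \<omega> = e * (N \<omega>)\<^sup>2 + K * (N \<omega>) ^ 4" for \<omega>
  have w1: "(\<lambda>\<omega>. weight s \<omega> * g1 (B s \<omega>)) \<in> borel_measurable (F s)"
    "(\<lambda>\<omega>. weight s \<omega> * g2 (B s \<omega>)) \<in> borel_measurable (F s)"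
    using weight_adapted[OF s] measurable_comp_adapted[OF g1(1) s] measurable_comp_adapted[OF g2(1) s]
    by measurable
  have i1: "integrable M (\<lambda>\<omega>. weight s \<omega> * g1 (B s \<omega>))" "integrable M (\<lambda>\<omega>. weight s \<omega> * g2 (B s \<omega>))"
    by (intro integrable_sq_integrable sq_integrable_weight_mult s sq_integrable_comp_B[OF g1]
        sq_integrable_comp_B[OF g2])+
  have iN: "integrable M (\<lambda>\<omega>. weight s \<omega> * g1 (B s \<omega>) * N \<omega>)"
    "integrable M (\<lambda>\<omega>. weight s \<omega> * g2 (B s \<omega>) * (N \<omega>)\<^sup>2)"
    using integrable_mult_increment_power[OF s st w1(1) i1(1), of 1]
      integrable_mult_increment_power[OF s st w1(2) i1(2), of 2] by (simp_all add: N_def)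
  have eN: "expectation (\<lambda>\<omega>. weight s \<omega> * g1 (B s \<omega>) * N \<omega>) = 0"
    "expectation (\<lambda>\<omega>. weight s \<omega> * g2 (B s \<omega>) * (N \<omega>)\<^sup>2) = (t - s) * expectation (\<lambda>\<omega>. weight s \<omega> * g2 (B s \<omega>))"
    using expectation_mult_increment[OF s st w1(1) i1(1)]
      expectation_mult_increment_sq[OF s st w1(2) i1(2)] by (simp_all add: N_def)
  have iD: "integrable M D"
    unfolding D_def[abs_def] N_def
    using integrable_increment_power[OF s st, of 2] integrable_increment_power[OF s st, of 4] by auto
  have eD: "expectation D = e * (t - s) + 3 * K * (t - s)\<^sup>2"
    unfolding D_def[abs_def] N_def
    using integrable_increment_power[OF s st, of 2] integrable_increment_power[OF s st, of 4]
      increment_second_moment[OF s st] increment_fourth_moment[OF s st] by simp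
  have RD: "\<bar>R \<omega>\<bar> \<le> D \<omega>" if \<omega>: "\<omega> \<in> space M" for \<omega>
  proof -
    let ?r = "g (B t \<omega>) - g (B s \<omega>) - g1 (B s \<omega>) * N \<omega> - g2 (B s \<omega>) / 2 * (N \<omega>)\<^sup>2"
    have "\<bar>R \<omega>\<bar> \<le> \<bar>?r\<bar>"
      unfolding R_def abs_mult by (rule mult_left_le_one_le) (use abs_weight_le_1[OF \<omega> s] in auto)
    also have "\<dots> \<le> D \<omega>" unfolding D_def N_def by (rule rem)
    finally show ?thesis .
  qed
  have [measurable]: "R \<in> borel_measurable M"
    using weight_measurable[OF s] measurable_comp_B[OF g s] measurable_comp_B[OF g t]
      measurable_comp_B[OF g1(1) s] measurable_comp_B[OF g2(1) s] B_measurable[OF s] B_measurable[OF t]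
    unfolding R_def[abs_def] N_def by measurable
  have iR: "integrable M R"
    by (rule Bochner_Integration.integrable_bound[OF iD]) (use RD in \<open>auto intro!: AE_I2 intro: order.trans abs_ge_self\<close>)
  have eR: "\<bar>expectation R\<bar> \<le> expectation D"
  proof -
    have "\<bar>expectation R\<bar> \<le> expectation (\<lambda>\<omega>. \<bar>R \<omega>\<bar>)" using integral_norm_bound[of M R] by simp
    also have "\<dots> \<le> expectation D" by (intro integral_mono integrable_abs iR iD RD)
    finally show ?thesis .
  qed
  have eq: "weight s \<omega> * (g (B t \<omega>) - g (B s \<omega>))
    = weight s \<omega> * g1 (B s \<omega>) * N \<omega> + weight s \<omega> * g2 (B s \<omega>) * (N \<omega>)\<^sup>2 / 2 + R \<omega>" for \<omega>
    by (simp add: R_def algebra_simps)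
  show "integrable M (\<lambda>\<omega>. weight s \<omega> * (g (B t \<omega>) - g (B s \<omega>)))"
    unfolding eq using iN iR by auto
  have "expectation (\<lambda>\<omega>. weight s \<omega> * (g (B t \<omega>) - g (B s \<omega>)))
    = (t - s) * expectation (\<lambda>\<omega>. weight s \<omega> * g2 (B s \<omega>)) / 2 + expectation R"
    unfolding eq using iN iR eN by simp
  then show "\<bar>expectation (\<lambda>\<omega>. weight s \<omega> * (g (B t \<omega>) - g (B s \<omega>)))
      - (t - s) * expectation (\<lambda>\<omega>. weight s \<omega> * g2 (B s \<omega>)) / 2\<bar> \<le> e * (t - s) + 3 * K * (t - s)\<^sup>2"
    using eR eD by simp
qed

lemma sum_ito_step_tendsto:
  fixes g g1 g2 :: "real \<Rightarrow> real"
  assumes T: "0 < T"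
    and g: "\<And>b. (g has_real_derivative g1 b) (at b)"
    and g1: "\<And>b. (g1 has_real_derivative g2 b) (at b)"
    and C1: "\<And>b. \<bar>g1 b\<bar> \<le> C1"
    and uc: "uniformly_continuous_on UNIV g2" and C2: "\<And>b. \<bar>g2 b\<bar> \<le> C2"
  shows "(\<lambda>n. \<Sum>i<n. expectation (\<lambda>\<omega>. weight (grid T n i) \<omega> * (g (B (grid T n (Suc i)) \<omega>) - g (B (grid T n i) \<omega>)))
      - T / n * expectation (\<lambda>\<omega>. weight (grid T n i) \<omega> * g2 (B (grid T n i) \<omega>)) / 2) \<longlonglongrightarrow> 0"
    (is "?S \<longlonglongrightarrow> 0")
proof (rule tendsto_0_of_le)
  fix e :: real assume e: "0 < e"
  \<comment> \<open>There are \<open>n\<close> steps of length \<open>T / n\<close>, so the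
    tolerance \<open>e / T\<close> adds up to \<open>e\<close>.\<close>
  then have eT: "0 < e / T" using T by simp
  obtain K where K: "0 \<le> K" "\<forall>b b'. \<bar>g b' - g b - g1 b * (b' - b) - g2 b / 2 * (b' - b)\<^sup>2\<bar>
    \<le> e / T * (b' - b)\<^sup>2 + K * (b' - b) ^ 4"
    using second_order_taylor_remainder[OF g g1 uc C2 eT] by blast
  have meas: "g \<in> borel_measurable borel" "g1 \<in> borel_measurable borel" "g2 \<in> borel_measurable borel"
    using DERIV_isCont[OF g] DERIV_isCont[OF g1] uniformly_continuous_imp_continuous[OF uc]
    by (auto intro!: borel_measurable_continuous_onI continuous_at_imp_continuous_on)
  have "\<bar>?S n\<bar> \<le> e + 3 * K * T\<^sup>2 / real n" if n: "0 < n" for n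
  proof -
    have "\<bar>?S n\<bar> \<le> (\<Sum>i<n. \<bar>expectation (\<lambda>\<omega>. weight (grid T n i) \<omega> * (g (B (grid T n (Suc i)) \<omega>) - g (B (grid T n i) \<omega>)))
      - T / n * expectation (\<lambda>\<omega>. weight (grid T n i) \<omega> * g2 (B (grid T n i) \<omega>)) / 2\<bar>)"
      by (rule sum_abs)
    also have "\<dots> \<le> real n * (e / T * (T / n) + 3 * K * (T / n)\<^sup>2)"
    proof (rule sum_le_const_times)
      fix i assume i: "i < n"
      show "\<bar>expectation (\<lambda>\<omega>. weight (grid T n i) \<omega> * (g (B (grid T n (Suc i)) \<omega>) - g (B (grid T n i) \<omega>)))
      - T / n * expectation (\<lambda>\<omega>. weight (grid T n i) \<omega> * g2 (B (grid T n i) \<omega>)) / 2\<bar>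
      \<le> e / T * (T / n) + 3 * K * (T / n)\<^sup>2"
        using ito_step(2)[OF grid_nonneg[OF T] grid_less_Suc[OF T i] meas(1) meas(2) C1 meas(3) C2 K(1)
            less_imp_le[OF eT] K(2)[rule_format]]
        by (simp add: grid_Suc)
    qed
    also have "\<dots> = e + 3 * K * T\<^sup>2 / real n"
      using n T by (simp add: field_simps power2_eq_square)
    finally show ?thesis .
  qed
  then have "\<forall>\<^sub>F n in sequentially. \<bar>?S n\<bar> \<le> e + 3 * K * T\<^sup>2 / real n"
    by (rule eventually_mono[OF eventually_gt_at_top[of 0]])
  moreover have "(\<lambda>n. 3 * K * T\<^sup>2 / real n) \<longlonglongrightarrow> 0" by (rule lim_const_over_n)
  ultimately show "\<exists>r. r \<longlonglongrightarrow> 0 \<and> (\<forall>\<^sub>F n in sequentially. \<bar>?S n\<bar> \<le> e + r n)" by blast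
qed

text \<open>|\<phi>(b) - \<phi>(0)| is at most a small constant plus a multiple of |b|. The constant
  is multiplied by at most E(L T), and the multiple of |b| disappears in the limit since
  \<open>dL\<close> sits on the zeros of \<open>B\<close>.\<close>

lemma sum_L_increment_localization:
  fixes \<phi> :: "real \<Rightarrow> real"
  assumes T: "0 < T" and \<phi>: "\<phi> \<in> borel_measurable borel" "isCont \<phi> 0" and C: "\<And>b. \<bar>\<phi> b\<bar> \<le> C"
  shows "(\<lambda>n. \<Sum>i<n. expectation (\<lambda>\<omega>. (\<phi> (B (grid T n i) \<omega>) - \<phi> 0) *
      (weight (grid T n i) \<omega> * (L (grid T n (Suc i)) \<omega> - L (grid T n i) \<omega>)))) \<longlonglongrightarrow> 0"
    (is "?S \<longlonglongrightarrow> 0")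
proof (rule tendsto_0_of_le)
  fix e :: real assume e: "0 < e"
  have T0: "0 \<le> T" using T by simp
  define EL where "EL = expectation (L T)"
  have EL: "0 \<le> EL" unfolding EL_def by (intro integral_nonneg_AE AE_I2 L_nonneg T0)
  define d where "d = e / (EL + 1)"
  have d: "0 < d" "d * EL \<le> e" using e EL by (auto simp: d_def field_simps)
  obtain r where r: "0 < r" "\<And>b. \<bar>b\<bar> < r \<Longrightarrow> \<bar>\<phi> b - \<phi> 0\<bar> < d"
    using \<phi>(2) d(1) unfolding continuous_at_eps_delta by (auto simp: dist_real_def)
  \<comment> \<open>For |b| \<ge> r the crude bound \<open>2 * C\<close> is then at most
    \<open>K * |b|\<close>.\<close>
  define K where "K = 2 * C / r"
  have C0: "0 \<le> C" using C[of 0] by linarith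
  have K0: "0 \<le> K" using r C0 by (simp add: K_def)
  have bound: "\<bar>\<phi> b - \<phi> 0\<bar> \<le> d + K * \<bar>b\<bar>" for b
  proof (cases "\<bar>b\<bar> < r")
    case True
    moreover have "0 \<le> K * \<bar>b\<bar>" using K0 by simp
    ultimately show ?thesis using r(2)[of b] by linarith
  next
    case False
    have "\<bar>\<phi> b - \<phi> 0\<bar> \<le> 2 * C" using C[of b] C[of 0] by linarith
    also have "2 * C = K * r" using r by (simp add: K_def)
    also have "K * r \<le> K * \<bar>b\<bar>" using False K0 by (intro mult_left_mono) auto
    finally show ?thesis using d by linarith
  qed
  have "\<bar>?S n\<bar> \<le> e + K * (\<Sum>i<n. expectation (\<lambda>\<omega>. \<bar>B (grid T n i) \<omega>\<bar> * (L (grid T n (Suc i)) \<omega> - L (grid T n i) \<omega>)))"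
    if n: "0 < n" for n
  proof -
    note s = grid_nonneg[OF T, of n]
    have step: "\<bar>expectation (\<lambda>\<omega>. (\<phi> (B (grid T n i) \<omega>) - \<phi> 0) *
      (weight (grid T n i) \<omega> * (L (grid T n (Suc i)) \<omega> - L (grid T n i) \<omega>)))\<bar>
      \<le> d * (expectation (L (grid T n (Suc i))) - expectation (L (grid T n i)))
        + K * expectation (\<lambda>\<omega>. \<bar>B (grid T n i) \<omega>\<bar> * (L (grid T n (Suc i)) \<omega> - L (grid T n i) \<omega>))"
      (is "\<bar>expectation ?X\<bar> \<le> ?R") if i: "i < n" for i
    proof -
      let ?dL = "\<lambda>\<omega>. L (grid T n (Suc i)) \<omega> - L (grid T n i) \<omega>"
      have dL: "sq_integrable M ?dL" by (intro sq_integrable_diff sq_integrable_L s)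
      have BdL: "integrable M (\<lambda>\<omega>. \<bar>B (grid T n i) \<omega>\<bar> * ?dL \<omega>)"
        by (intro integrable_mult_sq_integrable sq_integrable_abs sq_integrable_B s dL)
      have bdd: "\<bar>\<phi> b - \<phi> 0\<bar> \<le> 2 * C" for b using C[of b] C[of 0] by linarith
      have X: "integrable M ?X"
        by (intro integrable_mult_sq_integrable sq_integrable_weight_mult dL s
            sq_integrable_comp_B[where f = "\<lambda>b. \<phi> b - \<phi> 0", OF _ bdd]) (use \<phi>(1) in measurable)
      have "\<bar>expectation ?X\<bar> \<le> expectation (\<lambda>\<omega>. \<bar>?X \<omega>\<bar>)" using integral_norm_bound[of M ?X] by simp
      also have "\<dots> \<le> expectation (\<lambda>\<omega>. d * ?dL \<omega> + K * (\<bar>B (grid T n i) \<omega>\<bar> * ?dL \<omega>))"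
      proof (rule integral_mono)
        show "integrable M (\<lambda>\<omega>. d * ?dL \<omega> + K * (\<bar>B (grid T n i) \<omega>\<bar> * ?dL \<omega>))"
          using integrable_sq_integrable[OF dL] BdL by auto
        fix \<omega> assume \<omega>: "\<omega> \<in> space M"
        have dL0: "0 \<le> ?dL \<omega>"
          using L_mono[OF \<omega> s less_imp_le[OF grid_less_Suc[OF T i]]] by simp
        have "\<bar>weight (grid T n i) \<omega> * ?dL \<omega>\<bar> \<le> ?dL \<omega>"
          unfolding abs_mult using abs_weight_le_1[OF \<omega> s] dL0 by (simp add: mult_left_le_one_le)
        then have "\<bar>?X \<omega>\<bar> \<le> (d + K * \<bar>B (grid T n i) \<omega>\<bar>) * ?dL \<omega>"
          unfolding abs_mult[of "\<phi> _ - _"] using d K0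
          by (intro mult_mono bound) auto
        then show "\<bar>?X \<omega>\<bar> \<le> d * ?dL \<omega> + K * (\<bar>B (grid T n i) \<omega>\<bar> * ?dL \<omega>)"
          by (simp add: algebra_simps)
      qed (rule integrable_abs[OF X])
      also have "\<dots> = d * expectation ?dL + K * expectation (\<lambda>\<omega>. \<bar>B (grid T n i) \<omega>\<bar> * ?dL \<omega>)"
        using integrable_sq_integrable[OF dL] BdL by simp
      also have "expectation ?dL = expectation (L (grid T n (Suc i))) - expectation (L (grid T n i))"
        by (rule Bochner_Integration.integral_diff) (intro integrable_sq_integrable sq_integrable_L s)+
      finally show ?thesis .
    qed
    have E0: "expectation (L 0) = 0"
      by (subst Bochner_Integration.integral_cong[OF refl L_0]) auto
    have "\<bar>?S n\<bar> \<le> (\<Sum>i<n. d * (expectation (L (grid T n (Suc i))) - expectation (L (grid T n i)))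
        + K * expectation (\<lambda>\<omega>. \<bar>B (grid T n i) \<omega>\<bar> * (L (grid T n (Suc i)) \<omega> - L (grid T n i) \<omega>)))"
      by (rule order.trans[OF sum_abs sum_mono]) (use step in auto)
    also have "\<dots> = d * (\<Sum>i<n. expectation (L (grid T n (Suc i))) - expectation (L (grid T n i)))
        + K * (\<Sum>i<n. expectation (\<lambda>\<omega>. \<bar>B (grid T n i) \<omega>\<bar> * (L (grid T n (Suc i)) \<omega> - L (grid T n i) \<omega>)))"
      by (simp only: sum.distrib sum_distrib_left)
    also have "(\<Sum>i<n. expectation (L (grid T n (Suc i))) - expectation (L (grid T n i))) = EL"
      using sum_lessThan_telescope[of "\<lambda>i. expectation (L (grid T n i))" n] n by (simp add: E0 EL_def)
    finally show ?thesis using d(2) by linarith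
  qed
  then have "\<forall>\<^sub>F n in sequentially. \<bar>?S n\<bar> \<le> e + K * (\<Sum>i<n. expectation (\<lambda>\<omega>. \<bar>B (grid T n i) \<omega>\<bar> * (L (grid T n (Suc i)) \<omega> - L (grid T n i) \<omega>)))"
    by (rule eventually_mono[OF eventually_gt_at_top[of 0]])
  moreover have "(\<lambda>n. K * (\<Sum>i<n. expectation (\<lambda>\<omega>. \<bar>B (grid T n i) \<omega>\<bar> * (L (grid T n (Suc i)) \<omega> - L (grid T n i) \<omega>)))) \<longlonglongrightarrow> 0"
    using tendsto_mult_left[OF sum_abs_B_mult_L_increment_tendsto[OF T], of K] by simp
  ultimately show "\<exists>r. r \<longlonglongrightarrow> 0 \<and> (\<forall>\<^sub>F n in sequentially. \<bar>?S n\<bar> \<le> e + r n)"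
    by (intro exI conjI)
qed

end

section \<open>The resolvent of the free Brownian motion\<close>

text \<open>At 0, passing from \<open>h\<close> to |h| does not change the absolute value of the
  difference quotient, and since the limit is 0 absolute values suffice. The hypothesis
  \<open>p1 0 = 0\<close> says that the reflected function has no kink.\<close>

lemma has_real_derivative_even_extension:
  fixes p :: "real \<Rightarrow> real"
  assumes p: "\<And>y. (p has_real_derivative p1 y) (at y)" and p1: "p1 0 = 0"
  shows "((\<lambda>b. p \<bar>b\<bar>) has_real_derivative sgn b * p1 \<bar>b\<bar>) (at b)"
proof -
  consider "0 < b" | "b < 0" | "b = 0" by linarith
  then show ?thesis
  proof cases
    case 1
    have "((\<lambda>b. p \<bar>b\<bar>) has_real_derivative p1 b) (at b)"
      by (rule has_field_derivative_transform_within_open[OF p, where S = "{0<..}"]) (use 1 in auto)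
    then show ?thesis using 1 by simp
  next
    case 2
    have "((\<lambda>b. p (- b)) has_real_derivative p1 (- b) * (- 1)) (at b)"
      by (rule DERIV_chain2[OF p]) (auto intro!: derivative_eq_intros)
    then have "((\<lambda>b. p \<bar>b\<bar>) has_real_derivative p1 (- b) * (- 1)) (at b)"
      by (rule has_field_derivative_transform_within_open[where S = "{..<0}"]) (use 2 in auto)
    then show ?thesis using 2 by simp
  next
    case 3
    have "(\<lambda>h. (p (0 + h) - p 0) / h) \<midarrow>0\<rightarrow> 0" using p[of 0] p1 unfolding DERIV_def by simp
    moreover have "filterlim (\<lambda>h::real. \<bar>h\<bar>) (at 0) (at 0)"
      by (intro filterlim_atI tendsto_rabs_zero tendsto_ident_at) (auto simp: eventually_at_filter)
    ultimately have "((\<lambda>h. (p (0 + \<bar>h\<bar>) - p 0) / \<bar>h\<bar>) \<longlongrightarrow> 0) (at 0)" by (rule filterlim_compose)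
    then have "((\<lambda>h. \<bar>(p \<bar>h\<bar> - p 0) / h\<bar>) \<longlongrightarrow> 0) (at 0)" 
      by (auto dest: tendsto_rabs_zero simp: abs_divide)
    then have "((\<lambda>h. (p \<bar>h\<bar> - p 0) / h) \<longlongrightarrow> 0) (at 0)"
      by (rule tendsto_rabs_zero_cancel)
    then show ?thesis using 3 by (simp add: DERIV_def)
  qed
qed

text \<open>Applied to the derivative of an even extension, this yields the second derivative. At 0
  the difference quotient at \<open>h\<close> is that of \<open>q\<close> at |h|.\<close>

lemma has_real_derivative_odd_extension:
  fixes q :: "real \<Rightarrow> real"
  assumes q: "\<And>y. (q has_real_derivative q1 y) (at y)" and q0: "q 0 = 0"
  shows "((\<lambda>b. sgn b * q \<bar>b\<bar>) has_real_derivative q1 \<bar>b\<bar>) (at b)"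
proof -
  consider "0 < b" | "b < 0" | "b = 0" by linarith
  then show ?thesis
  proof cases
    case 1
    have "((\<lambda>b. sgn b * q \<bar>b\<bar>) has_real_derivative q1 b) (at b)"
      by (rule has_field_derivative_transform_within_open[OF q, where S = "{0<..}"]) (use 1 in auto)
    then show ?thesis using 1 by simp
  next
    case 2
    have "((\<lambda>b. - q (- b)) has_real_derivative - (q1 (- b) * (- 1))) (at b)"
      by (intro DERIV_minus DERIV_chain2[OF q]) (auto intro!: derivative_eq_intros)
    then have "((\<lambda>b. sgn b * q \<bar>b\<bar>) has_real_derivative - (q1 (- b) * (- 1))) (at b)"
      by (rule has_field_derivative_transform_within_open[where S = "{..<0}"]) (use 2 in auto)
    then show ?thesis using 2 by simp
  next
    case 3
    have "(\<lambda>h. (q (0 + h) - q 0) / h) \<midarrow>0\<rightarrow> q1 0" using q[of 0] unfolding DERIV_def by simp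
    moreover have "filterlim (\<lambda>h::real. \<bar>h\<bar>) (at 0) (at 0)"
      by (intro filterlim_atI tendsto_rabs_zero tendsto_ident_at) (auto simp: eventually_at_filter)
    ultimately have "((\<lambda>h. (q (0 + \<bar>h\<bar>) - q 0) / \<bar>h\<bar>) \<longlongrightarrow> q1 0) (at 0)" by (rule filterlim_compose)
    moreover have "(q (0 + \<bar>h\<bar>) - q 0) / \<bar>h\<bar> = (sgn (0 + h) * q \<bar>0 + h\<bar> - sgn 0 * q \<bar>0\<bar>) / h" for h
      using q0 by (cases "h > 0"; cases "h = 0") auto
    ultimately show ?thesis using 3 by (simp add: DERIV_def)
  qed
qed

section \<open>Exponentially weighted tail integrals\<close>

lemma
  fixes l p :: real
  assumes l: "0 < l"
  shows set_integrable_exp_tail: "set_integrable lborel {p..} (\<lambda>s. exp (- l * s))"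
    and set_integral_exp_tail: "(LINT s:{p..}|lborel. exp (- l * s)) = exp (- l * p) / l"
proof -
  have lim: "((\<lambda>s. - exp (- l * s) / l) \<longlongrightarrow> - 0 / l) at_top"
    using l by (intro tendsto_intros filterlim_compose[OF exp_at_bot])
      (auto simp: filterlim_uminus_at_bot intro!: filterlim_tendsto_pos_mult_at_top[OF tendsto_const _ filterlim_ident])
  have nn: "(\<integral>\<^sup>+s. ennreal (exp (- l * s)) * indicator {p..} s \<partial>lborel) = ennreal (- 0 / l - (- exp (- l * p) / l))"
    by (rule nn_integral_FTC_atLeast[OF _ _ _ lim]) (use l in \<open>auto intro!: derivative_eq_intros\<close>)
  have "has_bochner_integral lborel (\<lambda>s. indicator {p..} s * exp (- l * s)) (exp (- l * p) / l)"
    by (rule has_bochner_integral_nn_integral)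
      (use l nn in \<open>auto simp: indicator_mult_ennreal ennreal_mult'' mult.commute\<close>)
  then show "set_integrable lborel {p..} (\<lambda>s. exp (- l * s))"
    "(LINT s:{p..}|lborel. exp (- l * s)) = exp (- l * p) / l"
    unfolding set_integrable_def set_lebesgue_integral_def
    by (auto simp: has_bochner_integral_iff)
qed

text \<open>Measurability and the bound are required only on the ray, since a path of the sticky
  process is controlled only at nonnegative times.\<close>

lemma
  fixes f :: "real \<Rightarrow> real"
  assumes a: "0 < a" and f: "set_borel_measurable borel {p..} f"
    and C: "\<And>y. p \<le> y \<Longrightarrow> \<bar>f y\<bar> \<le> C"
  shows set_integrable_exp_mult: "set_integrable lborel {p..} (\<lambda>s. exp (- a * s) * f s)"
    and set_integral_exp_mult_le: "\<bar>LINT s:{p..}|lborel. exp (- a * s) * f s\<bar> \<le> C * exp (- a * p) / a"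
proof -
  have tail: "set_integrable lborel {p..} (\<lambda>s. C * exp (- a * s))"
    using set_integrable_exp_tail[OF a] by (rule set_integrable_mult_right) 
  have meas: "set_borel_measurable lborel {p..} (\<lambda>s. exp (- a * s) * f s)"
  proof -
    have "(\<lambda>s. exp (- a * s) * (indicator {p..} s *\<^sub>R f s)) \<in> borel_measurable borel"
      using f unfolding set_borel_measurable_def by (intro borel_measurable_times) auto
    then show ?thesis unfolding set_borel_measurable_def by (simp add: mult_ac)
  qed
  have le: "norm (exp (- a * s) * f s) \<le> C * exp (- a * s)" if "p \<le> s" for s
    using C[OF that] by (simp add: abs_mult)
  show int: "set_integrable lborel {p..} (\<lambda>s. exp (- a * s) * f s)"
    by (rule set_integrable_bound[OF tail meas]) (use le in \<open>auto intro!: AE_I2 intro: order.trans abs_ge_self\<close>)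
  have "\<bar>LINT s:{p..}|lborel. exp (- a * s) * f s\<bar> \<le> (LINT s:{p..}|lborel. norm (exp (- a * s) * f s))"
    using set_integral_norm_bound[OF int] by simp
  also have "\<dots> \<le> (LINT s:{p..}|lborel. C * exp (- a * s))"
    by (intro set_integral_mono set_integrable_norm int tail le) auto
  also have "\<dots> = C * exp (- a * p) / a" by (simp only: set_integral_mult_right set_integral_exp_tail[OF a] times_divide_eq_right)
  finally show "\<bar>LINT s:{p..}|lborel. exp (- a * s) * f s\<bar> \<le> C * exp (- a * p) / a" .
qed

text \<open>Near \<open>b\<close> the tail is the constant tail from \<open>b - 1\<close> minus an
  integral over a compact interval, to which the fundamental theorem of calculus applies.\<close>

lemma has_real_derivative_tail_integral:
  fixes h :: "real \<Rightarrow> real"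
  assumes h: "continuous_on UNIV h" and int: "\<And>p. set_integrable lborel {p..} h"
  shows "((\<lambda>b. LINT s:{b..}|lborel. h s) has_real_derivative - h b) (at b)"
proof -
  define J where "J b = (LINT s:{b..}|lborel. h s)" for b
  have split: "J b' = J (b - 1) - integral {b - 1..b'} h" if "b' \<in> {b-1<..<b+1}" for b'
  proof -
    have i: "set_integrable lborel {b - 1..b'} h"
      by (rule borel_integrable_atLeastAtMost') (rule continuous_on_subset[OF h], simp)
    have "J (b - 1) = (LINT s:{b - 1..b'} \<union> {b'..}|lborel. h s)"
      using that unfolding J_def by (intro arg_cong2[where f = "set_lebesgue_integral lborel"]) auto
    also have "\<dots> = (LINT s:{b - 1..b'}|lborel. h s) + J b'"
      \<comment> \<open>The two closed pieces overlap in the single point \<open>b'\<close>, a null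
        set.\<close>
      unfolding J_def using int i AE_lborel_singleton[of b']
      by (intro set_integral_Un_AE) (auto elim: eventually_mono)
    also have "(LINT s:{b - 1..b'}|lborel. h s) = integral {b - 1..b'} h"
      using set_borel_integral_eq_integral(2)[OF i] .
    finally show ?thesis by simp
  qed
  have "((\<lambda>u. integral {b - 1..u} h) has_real_derivative h b) (at b within {b-1..b+1})"
    by (rule integral_has_real_derivative) (auto intro: continuous_on_subset[OF h])
  then have "((\<lambda>u. integral {b - 1..u} h) has_real_derivative h b) (at b)"
    by (subst (asm) at_within_Icc_at) auto
  then have "((\<lambda>u. J (b - 1) - integral {b - 1..u} h) has_real_derivative 0 - h b) (at b)"
    by (intro DERIV_diff DERIV_const)
  then have "(J has_real_derivative 0 - h b) (at b)"
    by (rule has_field_derivative_transform_within_open[where S = "{b-1<..<b+1}"]) (use split in auto)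
  then show ?thesis unfolding J_def by simp
qed

section \<open>Even extensions of continuous functions vanishing at infinity\<close>

lemma uniformly_continuous_even_extension:
  fixes \<phi> :: "real \<Rightarrow> real"
  assumes \<phi>: "continuous_on {0..} \<phi>" and lim: "(\<phi> \<longlongrightarrow> 0) at_top"
  shows "uniformly_continuous_on UNIV (\<lambda>b. \<phi> \<bar>b\<bar>)"
  unfolding uniformly_continuous_on_def
proof (intro allI impI)
  fix e :: real assume e: "0 < e"
  from tendstoD[OF lim half_gt_zero[OF e]] obtain R0 where R0: "\<And>y. R0 \<le> y \<Longrightarrow> \<bar>\<phi> y\<bar> < e / 2"
    by (auto simp: eventually_at_top_linorder)
  define R where "R = max R0 0"
  have R: "0 \<le> R" "\<And>y. R \<le> y \<Longrightarrow> \<bar>\<phi> y\<bar> < e / 2" using R0 by (auto simp: R_def)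
  have "uniformly_continuous_on {0..R + 1} \<phi>"
    by (rule compact_uniformly_continuous) (auto intro: continuous_on_subset[OF \<phi>])
  then obtain d where d: "0 < d" "\<And>y z. y \<in> {0..R+1} \<Longrightarrow> z \<in> {0..R+1} \<Longrightarrow> dist z y < d \<Longrightarrow> dist (\<phi> z) (\<phi> y) < e"
    using e unfolding uniformly_continuous_on_def by metis
  show "\<exists>d>0. \<forall>b\<in>UNIV. \<forall>b'\<in>UNIV. dist b' b < d \<longrightarrow> dist (\<phi> \<bar>b'\<bar>) (\<phi> \<bar>b\<bar>) < e"
  \<comment> \<open>The margin 1 ensures that two close points either both have modulus at most
    \<open>R + 1\<close>, where compactness applies, or both have modulus at least \<open>R\<close>,
    where the function is small.\<close>
  proof (intro exI[of _ "min d 1"] conjI ballI impI)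
    fix b b' :: real assume *: "dist b' b < min d 1"
    then have dd: "\<bar>\<bar>b'\<bar> - \<bar>b\<bar>\<bar> < d" "\<bar>\<bar>b'\<bar> - \<bar>b\<bar>\<bar> < 1" by (auto simp: dist_real_def)
    show "dist (\<phi> \<bar>b'\<bar>) (\<phi> \<bar>b\<bar>) < e"
    proof (cases "\<bar>b\<bar> \<le> R + 1 \<and> \<bar>b'\<bar> \<le> R + 1")
      case True
      then show ?thesis using dd by (intro d(2)) (auto simp: dist_real_def)
    next
      case False
      then have "R \<le> \<bar>b\<bar>" "R \<le> \<bar>b'\<bar>" using dd by auto
      from R(2)[OF this(1)] R(2)[OF this(2)] show ?thesis by (simp add: dist_real_def)
    qed
  qed (use d in auto)
qed

lemma bounded_even_extension:
  fixes \<phi> :: "real \<Rightarrow> real"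
  assumes \<phi>: "continuous_on {0..} \<phi>" and lim: "(\<phi> \<longlongrightarrow> 0) at_top"
  obtains C where "\<forall>b. \<bar>\<phi> \<bar>b\<bar>\<bar> \<le> C"
proof -
  from tendstoD[OF lim zero_less_one] obtain R where R: "\<And>y. R \<le> y \<Longrightarrow> \<bar>\<phi> y\<bar> < 1"
    by (auto simp: eventually_at_top_linorder)
  have "compact (\<phi> ` {0..max R 0})"
    by (intro compact_continuous_image continuous_on_subset[OF \<phi>]) auto
  then obtain K where K: "\<forall>y\<in>{0..max R 0}. \<bar>\<phi> y\<bar> \<le> K"
    using compact_imp_bounded[of "\<phi> ` {0..max R 0}"] by (auto simp: bounded_real)
  have "\<bar>\<phi> \<bar>b\<bar>\<bar> \<le> max K 1" for b
    using bspec[OF K, of "\<bar>b\<bar>"] R[of "\<bar>b\<bar>"] by (cases "R \<le> \<bar>b\<bar>") auto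
  then show thesis using that by blast
qed

text \<open>For \<open>a > 0\<close> and bounded continuous \<open>f\<close>, this is the bounded
  solution of h' = a h - f on the line.\<close>

definition exp_tail :: "real \<Rightarrow> (real \<Rightarrow> real) \<Rightarrow> real \<Rightarrow> real" where
  "exp_tail a f b = exp (a * b) * (LINT s:{b..}|lborel. exp (- a * s) * f s)"

text \<open>For even \<open>f\<close> and \<open>a = sqrt (2 * lam)\<close>, \<open>green a f\<close> is the resolvent of the free Brownian
  motion applied to \<open>f\<close>.\<close>

definition green :: "real \<Rightarrow> (real \<Rightarrow> real) \<Rightarrow> real \<Rightarrow> real" where
  "green a f b = (exp_tail a f b + exp_tail a f (- b)) / a"

lemma
  fixes f :: "real \<Rightarrow> real"
  assumes a: "0 < a" and f: "continuous_on UNIV f" and C: "\<And>y. \<bar>f y\<bar> \<le> C"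
  shows exp_tail_deriv: "(exp_tail a f has_real_derivative a * exp_tail a f b - f b) (at b)"
    and exp_tail_bound: "\<bar>exp_tail a f b\<bar> \<le> C / a"
proof -
  have fm: "set_borel_measurable borel {p..} f" for p
    using borel_measurable_continuous_onI[OF f] unfolding set_borel_measurable_def by measurable
  have int: "set_integrable lborel {p..} (\<lambda>s. exp (- a * s) * f s)" for p
    by (rule set_integrable_exp_mult[OF a fm C])
  have "((\<lambda>b. LINT s:{b..}|lborel. exp (- a * s) * f s) has_real_derivative - (exp (- a * b) * f b)) (at b)"
    by (rule has_real_derivative_tail_integral[OF _ int]) (intro continuous_intros f)
  moreover have "((\<lambda>b. exp (a * b)) has_real_derivative exp (a * b) * a) (at b)"
    by (auto intro!: derivative_eq_intros)
  ultimately
  have "(exp_tail a f has_real_derivative exp (a * b) * a * (LINT s:{b..}|lborel. exp (- a * s) * f s)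
      + - (exp (- a * b) * f b) * exp (a * b)) (at b)"
    unfolding exp_tail_def[abs_def] by (intro DERIV_mult)
  moreover have "exp (- a * b) * exp (a * b) = 1" by (simp add: exp_add[symmetric])
  then have "exp (a * b) * a * (LINT s:{b..}|lborel. exp (- a * s) * f s)
      + - (exp (- a * b) * f b) * exp (a * b) = a * exp_tail a f b - f b"
    unfolding exp_tail_def by algebra
  ultimately show "(exp_tail a f has_real_derivative a * exp_tail a f b - f b) (at b)"
    by (simp only:)
  have "\<bar>exp_tail a f b\<bar> = exp (a * b) * \<bar>LINT s:{b..}|lborel. exp (- a * s) * f s\<bar>"
    by (simp add: exp_tail_def abs_mult)
  also have "\<dots> \<le> exp (a * b) * (C * exp (- a * b) / a)"
    by (intro mult_left_mono set_integral_exp_mult_le[OF a fm C]) auto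
  also have "\<dots> = C / a" by (simp add: exp_minus)
  finally show "\<bar>exp_tail a f b\<bar> \<le> C / a" .
qed

text \<open>Differentiating twice gives g'' = a^2 g - 2 f, where evenness merges f(b) and f(- b).
  With a^2 = 2 lam this is the resolvent equation lam g - g''/2 = f.\<close>

lemma
  fixes f :: "real \<Rightarrow> real"
  assumes a: "0 < a" and f: "continuous_on UNIV f" and C: "\<And>y. \<bar>f y\<bar> \<le> C"
    and even: "\<And>y. f (- y) = f y"
  shows green_deriv: "(green a f has_real_derivative exp_tail a f b - exp_tail a f (- b)) (at b)"
    and green_deriv2: "((\<lambda>b. exp_tail a f b - exp_tail a f (- b)) has_real_derivative a\<^sup>2 * green a f b - 2 * f b) (at b)"
proof -
  note d = exp_tail_deriv[OF a f C]
  have m: "((\<lambda>b. exp_tail a f (- b)) has_real_derivative (a * exp_tail a f (- b) - f (- b)) * (- 1)) (at b)"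
    by (rule DERIV_chain2[OF d]) (auto intro!: derivative_eq_intros)
  show "(green a f has_real_derivative exp_tail a f b - exp_tail a f (- b)) (at b)"
    using DERIV_cdivide[OF DERIV_add[OF d[of b] m], of a] a
    unfolding green_def[abs_def] by (simp add: even diff_divide_distrib)
  have "a * exp_tail a f b - f b - (a * exp_tail a f (- b) - f (- b)) * (- 1) = a\<^sup>2 * green a f b - 2 * f b"
    using a by (simp add: green_def even power2_eq_square field_simps)
  then show "((\<lambda>b. exp_tail a f b - exp_tail a f (- b)) has_real_derivative a\<^sup>2 * green a f b - 2 * f b) (at b)"
    using DERIV_diff[OF d[of b] m] by (simp only:)
qed

lemma
  fixes f :: "real \<Rightarrow> real"
  assumes a: "0 < a" and f: "continuous_on UNIV f" and C: "\<And>y. \<bar>f y\<bar> \<le> C"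
  shows green_deriv_bound: "\<bar>exp_tail a f b - exp_tail a f (- b)\<bar> \<le> 2 * (C / a)"
    and green_bound: "\<bar>green a f b\<bar> \<le> 2 * (C / a) / a"
proof -
  note bound = exp_tail_bound[OF a f C, of b] exp_tail_bound[OF a f C, of "- b"]
  show "\<bar>exp_tail a f b - exp_tail a f (- b)\<bar> \<le> 2 * (C / a)" using bound by linarith
  have "\<bar>exp_tail a f b + exp_tail a f (- b)\<bar> \<le> 2 * (C / a)" using bound by linarith
  then have "\<bar>exp_tail a f b + exp_tail a f (- b)\<bar> / a \<le> 2 * (C / a) / a"
    by (rule divide_right_mono) (use a in simp)
  then show "\<bar>green a f b\<bar> \<le> 2 * (C / a) / a" using a by (simp only: green_def abs_divide abs_of_pos)
qed

section \<open>Expected value of the discretized resolvent\<close>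

context sticky_brownian
begin

text \<open>The three sums in this group discretize, on [0, T], the expectations of the integrals of
  w \<phi>(B) against dt, of w against dL, and of \<phi>(B) against - dw / lam. Integrands are taken
  at left endpoints, where they are known to the filtration.\<close>

definition occ_sum :: "real \<Rightarrow> (real \<Rightarrow> real) \<Rightarrow> nat \<Rightarrow> real" where
  "occ_sum T \<phi> n = T / n * (\<Sum>i<n. expectation (\<lambda>\<omega>. weight (grid T n i) \<omega> * \<phi> (B (grid T n i) \<omega>)))"

definition loc_sum :: "real \<Rightarrow> nat \<Rightarrow> real" where
  "loc_sum T n = (\<Sum>i<n. expectation (\<lambda>\<omega>.
     weight (grid T n i) \<omega> * (L (grid T n (Suc i)) \<omega> - L (grid T n i) \<omega>)))"

definition res_sum :: "real \<Rightarrow> (real \<Rightarrow> real) \<Rightarrow> nat \<Rightarrow> real" where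
  "res_sum T \<phi> n = (\<Sum>i<n. expectation (\<lambda>\<omega>.
     \<phi> (B (grid T n i) \<omega>) * ((weight (grid T n i) \<omega> - weight (grid T n (Suc i)) \<omega>) / lam)))"

lemma sq_integrable_weight: "0 \<le> s \<Longrightarrow> sq_integrable M (weight s)"
  using weight_measurable abs_weight_le_1 by (rule sq_integrable_bounded)

text \<open>Expected, summed form of - dw / lam = w (dt + \<gamma> dL): the clock errors vanish in
  the limit, and against \<open>dL\<close> the factor \<phi>(B) may be replaced by
  \<phi>(0).\<close>

lemma res_sum_asymp:
  fixes \<phi> :: "real \<Rightarrow> real"
  assumes T: "0 < T" and \<phi>: "\<phi> \<in> borel_measurable borel" "isCont \<phi> 0" and C: "\<And>b. \<bar>\<phi> b\<bar> \<le> C"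
  shows "(\<lambda>n. res_sum T \<phi> n - (occ_sum T \<phi> n + \<gamma> * \<phi> 0 * loc_sum T n)) \<longlonglongrightarrow> 0"
proof -
  define err where "err n i = expectation (\<lambda>\<omega>. \<phi> (B (grid T n i) \<omega>) * clock_error (grid T n i) (grid T n (Suc i)) \<omega>)" for n i
  define loc where "loc n i = expectation (\<lambda>\<omega>. (\<phi> (B (grid T n i) \<omega>) - \<phi> 0) *
      (weight (grid T n i) \<omega> * (L (grid T n (Suc i)) \<omega> - L (grid T n i) \<omega>)))" for n i
  note g = grid_nonneg[OF T]
  have ce: "integrable M (clock_error (grid T n i) (grid T n (Suc i)))" if "i < n" for n i
    using integrable_clock_error[OF g less_imp_le[OF grid_less_Suc[OF T that]]] .
  have pce: "integrable M (\<lambda>\<omega>. \<phi> (B (grid T n i) \<omega>) * clock_error (grid T n i) (grid T n (Suc i)) \<omega>)"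
    if i: "i < n" for n i
  proof (rule Bochner_Integration.integrable_bound)
    show "integrable M (\<lambda>\<omega>. C * clock_error (grid T n i) (grid T n (Suc i)) \<omega>)" using ce[OF i] by simp
    have C0: "0 \<le> C" using C[of 0] by linarith
    show "AE \<omega> in M. norm (\<phi> (B (grid T n i) \<omega>) * clock_error (grid T n i) (grid T n (Suc i)) \<omega>)
      \<le> norm (C * clock_error (grid T n i) (grid T n (Suc i)) \<omega>)"
      using C C0 by (intro AE_I2) (simp add: abs_mult mult_right_mono)
  qed (use measurable_comp_B[OF \<phi>(1) g] clock_error_measurable[OF g g] in measurable)
  have step: "expectation (\<lambda>\<omega>. \<phi> (B (grid T n i) \<omega>) * ((weight (grid T n i) \<omega> - weight (grid T n (Suc i)) \<omega>) / lam))
     = err n i + T / n * expectation (\<lambda>\<omega>. weight (grid T n i) \<omega> * \<phi> (B (grid T n i) \<omega>)) + \<gamma> * loc n i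
      + \<gamma> * \<phi> 0 * expectation (\<lambda>\<omega>. weight (grid T n i) \<omega> * (L (grid T n (Suc i)) \<omega> - L (grid T n i) \<omega>))"
    if i: "i < n" for n i
  proof -
    have eq: "\<phi> (B (grid T n i) \<omega>) * ((weight (grid T n i) \<omega> - weight (grid T n (Suc i)) \<omega>) / lam)
      = \<phi> (B (grid T n i) \<omega>) * clock_error (grid T n i) (grid T n (Suc i)) \<omega>
       + T / n * (weight (grid T n i) \<omega> * \<phi> (B (grid T n i) \<omega>))
       + \<gamma> * ((\<phi> (B (grid T n i) \<omega>) - \<phi> 0) * (weight (grid T n i) \<omega> * (L (grid T n (Suc i)) \<omega> - L (grid T n i) \<omega>)))
       + \<gamma> * \<phi> 0 * (weight (grid T n i) \<omega> * (L (grid T n (Suc i)) \<omega> - L (grid T n i) \<omega>))" for \<omega>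
    proof -
      have h: "T / real n = grid T n (Suc i) - grid T n i" by (simp add: grid_Suc)
      show ?thesis unfolding clock_error_def h by (simp add: algebra_simps)
    qed
    have bdd: "\<bar>\<phi> b - \<phi> 0\<bar> \<le> 2 * C" for b using C[of b] C[of 0] by linarith
    have dL: "sq_integrable M (\<lambda>\<omega>. weight (grid T n i) \<omega> * (L (grid T n (Suc i)) \<omega> - L (grid T n i) \<omega>))"
      by (intro sq_integrable_weight_mult sq_integrable_diff sq_integrable_L g)
    have i2: "integrable M (\<lambda>\<omega>. weight (grid T n i) \<omega> * \<phi> (B (grid T n i) \<omega>))"
      by (intro integrable_sq_integrable sq_integrable_weight_mult g sq_integrable_comp_B[OF \<phi>(1) C])
    have i3: "integrable M (\<lambda>\<omega>. (\<phi> (B (grid T n i) \<omega>) - \<phi> 0) * (weight (grid T n i) \<omega> * (L (grid T n (Suc i)) \<omega> - L (grid T n i) \<omega>)))"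
      by (intro integrable_mult_sq_integrable dL
          sq_integrable_comp_B[where f = "\<lambda>b. \<phi> b - \<phi> 0", OF _ bdd] g) (use \<phi>(1) in measurable)
    show ?thesis unfolding eq err_def loc_def
      using pce[OF i] i2 i3 integrable_sq_integrable[OF dL] by simp
  qed
  have diff: "res_sum T \<phi> n - (occ_sum T \<phi> n + \<gamma> * \<phi> 0 * loc_sum T n) = (\<Sum>i<n. err n i) + \<gamma> * (\<Sum>i<n. loc n i)" for n
  proof -
    have "res_sum T \<phi> n = (\<Sum>i<n. err n i + T / n * expectation (\<lambda>\<omega>. weight (grid T n i) \<omega> * \<phi> (B (grid T n i) \<omega>)) + \<gamma> * loc n i
      + \<gamma> * \<phi> 0 * expectation (\<lambda>\<omega>. weight (grid T n i) \<omega> * (L (grid T n (Suc i)) \<omega> - L (grid T n i) \<omega>)))"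
      unfolding res_sum_def by (rule sum.cong) (use step in auto)
    then have "res_sum T \<phi> n = (\<Sum>i<n. err n i) + occ_sum T \<phi> n + \<gamma> * (\<Sum>i<n. loc n i) + \<gamma> * \<phi> 0 * loc_sum T n"
      by (simp only: sum.distrib sum_distrib_left[symmetric] occ_sum_def loc_sum_def)
    then show ?thesis by simp
  qed
  have "(\<lambda>n. \<Sum>i<n. err n i) \<longlonglongrightarrow> 0"
  proof (rule Lim_null_comparison)
    show "(\<lambda>n. C * (\<Sum>i<n. expectation (\<lambda>\<omega>. \<bar>clock_error (grid T n i) (grid T n (Suc i)) \<omega>\<bar>))) \<longlonglongrightarrow> 0"
      using tendsto_mult_left[OF sum_clock_error_tendsto[OF T], of C] by simp
    have "norm (\<Sum>i<n. err n i) \<le> C * (\<Sum>i<n. expectation (\<lambda>\<omega>. \<bar>clock_error (grid T n i) (grid T n (Suc i)) \<omega>\<bar>))" for n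
    proof -
      have "norm (\<Sum>i<n. err n i) \<le> (\<Sum>i<n. norm (err n i))" by (rule norm_sum)
      also have "\<dots> \<le> (\<Sum>i<n. C * expectation (\<lambda>\<omega>. \<bar>clock_error (grid T n i) (grid T n (Suc i)) \<omega>\<bar>))"
      proof (rule sum_mono)
        fix i assume "i \<in> {..<n}"
        then have i: "i < n" by simp
        have "norm (err n i) \<le> expectation (\<lambda>\<omega>. norm (\<phi> (B (grid T n i) \<omega>) * clock_error (grid T n i) (grid T n (Suc i)) \<omega>))"
          unfolding err_def by (rule integral_norm_bound)
        also have "\<dots> \<le> expectation (\<lambda>\<omega>. C * \<bar>clock_error (grid T n i) (grid T n (Suc i)) \<omega>\<bar>)"
          by (intro integral_mono integrable_norm pce i integrable_mult_right integrable_abs ce)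
            (auto simp: abs_mult intro!: mult_right_mono C)
        finally show "norm (err n i) \<le> C * expectation (\<lambda>\<omega>. \<bar>clock_error (grid T n i) (grid T n (Suc i)) \<omega>\<bar>)"
          by simp
      qed
      finally show ?thesis by (simp only: sum_distrib_left)
    qed
    then show "\<forall>\<^sub>F n in sequentially. norm (\<Sum>i<n. err n i)
      \<le> C * (\<Sum>i<n. expectation (\<lambda>\<omega>. \<bar>clock_error (grid T n i) (grid T n (Suc i)) \<omega>\<bar>))" by simp
  qed
  from tendsto_add[OF this tendsto_mult_left[OF sum_L_increment_localization[OF T \<phi> C], of \<gamma>]]
  show ?thesis unfolding diff loc_def by simp
qed

text \<open>Only the combination of the two sums is claimed to converge. Each later use chooses
  \<open>u\<close> so that this combination isolates the quantity wanted.\<close>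

lemma dynkin:
  fixes g g1 g2 u :: "real \<Rightarrow> real"
  assumes T: "0 < T"
    and g: "\<And>b. (g has_real_derivative g1 b) (at b)"
    and g1: "\<And>b. (g1 has_real_derivative g2 b) (at b)"
    and C1: "\<And>b. \<bar>g1 b\<bar> \<le> C1"
    and uc: "uniformly_continuous_on UNIV g2" and C2: "\<And>b. \<bar>g2 b\<bar> \<le> C2"
    and u: "\<And>b. u b = g b - a * \<bar>b\<bar>" and C: "\<And>b. \<bar>u b\<bar> \<le> C"
  shows "(\<lambda>n. occ_sum T (\<lambda>b. lam * u b - g2 b / 2) n + (a + lam * \<gamma> * u 0) * loc_sum T n)
    \<longlonglongrightarrow> u x - expectation (\<lambda>\<omega>. weight T \<omega> * u (B T \<omega>))"
proof -
  note s = grid_nonneg[OF T]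
  have gcont: "continuous_on UNIV g" "isCont g b" for b
    using DERIV_isCont[OF g] by (auto intro!: continuous_at_imp_continuous_on)
  have ucont: "continuous_on UNIV u" "isCont u 0"
    unfolding u[abs_def] by (intro continuous_intros gcont)+
  have meas: "g \<in> borel_measurable borel" "g1 \<in> borel_measurable borel" "g2 \<in> borel_measurable borel"
    "u \<in> borel_measurable borel"
    using DERIV_isCont[OF g] DERIV_isCont[OF g1] uniformly_continuous_imp_continuous[OF uc] ucont(1)
    by (auto intro!: borel_measurable_continuous_onI continuous_at_imp_continuous_on)
  define cross where "cross n i = expectation (\<lambda>\<omega>. (u (B (grid T n (Suc i)) \<omega>) - u (B (grid T n i) \<omega>))
    * (weight (grid T n (Suc i)) \<omega> - weight (grid T n i) \<omega>))" for n i
  define ito where "ito n i = expectation (\<lambda>\<omega>. weight (grid T n i) \<omega> * (g (B (grid T n (Suc i)) \<omega>) - g (B (grid T n i) \<omega>)))" for n i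
  \<comment> \<open>The tolerance 1 is arbitrary: this bound only provides integrability of the
    increments of the possibly unbounded \<open>g\<close>.\<close>
  obtain K where K: "0 \<le> K" "\<forall>b b'. \<bar>g b' - g b - g1 b * (b' - b) - g2 b / 2 * (b' - b)\<^sup>2\<bar>
    \<le> 1 * (b' - b)\<^sup>2 + K * (b' - b) ^ 4"
    using second_order_taylor_remainder[OF g g1 uc C2 zero_less_one] by blast
  have step: "expectation (\<lambda>\<omega>. weight (grid T n (Suc i)) \<omega> * u (B (grid T n (Suc i)) \<omega>))
      - expectation (\<lambda>\<omega>. weight (grid T n i) \<omega> * u (B (grid T n i) \<omega>))
    = ito n i - a * expectation (\<lambda>\<omega>. weight (grid T n i) \<omega> * (L (grid T n (Suc i)) \<omega> - L (grid T n i) \<omega>))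
      - lam * expectation (\<lambda>\<omega>. u (B (grid T n i) \<omega>) * ((weight (grid T n i) \<omega> - weight (grid T n (Suc i)) \<omega>) / lam))
      + cross n i" if i: "i < n" for n i
  proof -
    let ?s = "grid T n i" and ?t = "grid T n (Suc i)"
    have st: "?s < ?t" using grid_less_Suc[OF T i] .
    have iu: "integrable M (\<lambda>\<omega>. weight r \<omega> * u (B r \<omega>))" if "0 \<le> r" for r
      by (intro integrable_sq_integrable sq_integrable_weight_mult that sq_integrable_comp_B[OF meas(4) C])
    have i1: "integrable M (\<lambda>\<omega>. weight ?s \<omega> * (g (B ?t \<omega>) - g (B ?s \<omega>)))"
      using ito_step(1)[OF s st meas(1) meas(2) C1 meas(3) C2 K(1) zero_le_one K(2)[rule_format]] .
    have i2: "integrable M (\<lambda>\<omega>. weight ?s \<omega> * (\<bar>B ?t \<omega>\<bar> - \<bar>B ?s \<omega>\<bar>))"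
      by (intro integrable_sq_integrable sq_integrable_weight_mult s sq_integrable_diff
          sq_integrable_abs sq_integrable_B)
    have i3: "integrable M (\<lambda>\<omega>. u (B ?s \<omega>) * (weight ?s \<omega> - weight ?t \<omega>))"
      by (intro integrable_mult_sq_integrable sq_integrable_comp_B[OF meas(4) C] s sq_integrable_diff sq_integrable_weight)
    have i4: "integrable M (\<lambda>\<omega>. (u (B ?t \<omega>) - u (B ?s \<omega>)) * (weight ?t \<omega> - weight ?s \<omega>))"
      by (intro integrable_mult_sq_integrable sq_integrable_comp_B[OF meas(4) C] s sq_integrable_diff sq_integrable_weight)
    have "expectation (\<lambda>\<omega>. weight ?t \<omega> * u (B ?t \<omega>)) - expectation (\<lambda>\<omega>. weight ?s \<omega> * u (B ?s \<omega>))
      = expectation (\<lambda>\<omega>. weight ?t \<omega> * u (B ?t \<omega>) - weight ?s \<omega> * u (B ?s \<omega>))"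
      by (rule Bochner_Integration.integral_diff[symmetric]) (intro iu s)+
    \<comment> \<open>Discrete product rule for w u with its second order cross term, after
      splitting the increment of \<open>u\<close> into those of \<open>g\<close> and of the absolute
      value.\<close>
    also have "\<dots> = expectation (\<lambda>\<omega>. weight ?s \<omega> * (g (B ?t \<omega>) - g (B ?s \<omega>))
        - a * (weight ?s \<omega> * (\<bar>B ?t \<omega>\<bar> - \<bar>B ?s \<omega>\<bar>))
        - u (B ?s \<omega>) * (weight ?s \<omega> - weight ?t \<omega>)
        + (u (B ?t \<omega>) - u (B ?s \<omega>)) * (weight ?t \<omega> - weight ?s \<omega>))"
      by (simp add: u algebra_simps)
    also have "\<dots> = ito n i - a * expectation (\<lambda>\<omega>. weight ?s \<omega> * (\<bar>B ?t \<omega>\<bar> - \<bar>B ?s \<omega>\<bar>))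
        - expectation (\<lambda>\<omega>. u (B ?s \<omega>) * (weight ?s \<omega> - weight ?t \<omega>)) + cross n i"
      unfolding ito_def cross_def using i1 i2 i3 i4 by simp
    \<comment> \<open>This is where the kink produces local time: \<open>weight ?s\<close> is
      bounded and known at time \<open>?s\<close>, so Tanaka's formula applies under the
      expectation.\<close>
    also have "expectation (\<lambda>\<omega>. weight ?s \<omega> * (\<bar>B ?t \<omega>\<bar> - \<bar>B ?s \<omega>\<bar>)) = expectation (\<lambda>\<omega>. weight ?s \<omega> * (L ?t \<omega> - L ?s \<omega>))"
      using expectation_mult_L_increment[OF s less_imp_le[OF st] weight_adapted[OF s] sq_integrable_weight[OF s]] by simp
    also have "expectation (\<lambda>\<omega>. u (B ?s \<omega>) * (weight ?s \<omega> - weight ?t \<omega>))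
      = lam * expectation (\<lambda>\<omega>. u (B ?s \<omega>) * ((weight ?s \<omega> - weight ?t \<omega>) / lam))"
      using lam_pos by simp
    finally show ?thesis .
  qed
  have w0: "expectation (\<lambda>\<omega>. weight 0 \<omega> * u (B 0 \<omega>)) = u x"
  proof -
    have "expectation (\<lambda>\<omega>. weight 0 \<omega> * u (B 0 \<omega>)) = expectation (\<lambda>\<omega>. u x)"
      using weight_measurable[of 0] measurable_comp_B[OF meas(4), of 0] start
      by (intro integral_cong_AE) (auto simp: weight_0)
    then show ?thesis by (simp add: prob_space)
  qed
  define S1 where "S1 n = (\<Sum>i<n. ito n i - T / n * expectation (\<lambda>\<omega>. weight (grid T n i) \<omega> * g2 (B (grid T n i) \<omega>)) / 2)" for n
  have S1: "S1 \<longlonglongrightarrow> 0"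
    unfolding S1_def[abs_def] ito_def by (rule sum_ito_step_tendsto[OF T g g1 C1 uc C2])
  have cr: "(\<lambda>n. \<Sum>i<n. cross n i) \<longlonglongrightarrow> 0"
    unfolding cross_def by (rule sum_cross_increments_tendsto[OF T ucont(1) C])
  have S1': "(\<Sum>i<n. ito n i) = S1 n + occ_sum T g2 n / 2" for n
    by (simp add: S1_def occ_sum_def sum_subtractf sum_distrib_left sum_divide_distrib)
  have occ: "occ_sum T (\<lambda>b. lam * u b - g2 b / 2) n = lam * occ_sum T u n - occ_sum T g2 n / 2" for n
  proof -
    have "expectation (\<lambda>\<omega>. weight (grid T n i) \<omega> * (lam * u (B (grid T n i) \<omega>) - g2 (B (grid T n i) \<omega>) / 2))
      = lam * expectation (\<lambda>\<omega>. weight (grid T n i) \<omega> * u (B (grid T n i) \<omega>))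
        - expectation (\<lambda>\<omega>. weight (grid T n i) \<omega> * g2 (B (grid T n i) \<omega>)) / 2" for i
    proof -
      have i1: "integrable M (\<lambda>\<omega>. weight (grid T n i) \<omega> * u (B (grid T n i) \<omega>))"
        by (intro integrable_sq_integrable sq_integrable_weight_mult s sq_integrable_comp_B[OF meas(4) C])
      have i2: "integrable M (\<lambda>\<omega>. weight (grid T n i) \<omega> * g2 (B (grid T n i) \<omega>))"
        by (intro integrable_sq_integrable sq_integrable_weight_mult s sq_integrable_comp_B[OF meas(3) C2])
      have "expectation (\<lambda>\<omega>. weight (grid T n i) \<omega> * (lam * u (B (grid T n i) \<omega>) - g2 (B (grid T n i) \<omega>) / 2))
        = expectation (\<lambda>\<omega>. lam * (weight (grid T n i) \<omega> * u (B (grid T n i) \<omega>))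
          - weight (grid T n i) \<omega> * g2 (B (grid T n i) \<omega>) / 2)" by (simp add: algebra_simps)
      also have "\<dots> = lam * expectation (\<lambda>\<omega>. weight (grid T n i) \<omega> * u (B (grid T n i) \<omega>))
        - expectation (\<lambda>\<omega>. weight (grid T n i) \<omega> * g2 (B (grid T n i) \<omega>)) / 2"
        using i1 i2 by simp
      finally show ?thesis .
    qed
    then show ?thesis
      by (simp only: occ_sum_def sum_subtractf sum_distrib_left[symmetric] sum_divide_distrib[symmetric])
        (simp add: algebra_simps)
  qed
  let ?Z = "u x - expectation (\<lambda>\<omega>. weight T \<omega> * u (B T \<omega>))"
  have eq: "occ_sum T (\<lambda>b. lam * u b - g2 b / 2) n + (a + lam * \<gamma> * u 0) * loc_sum T n - ?Z
    = S1 n + (\<Sum>i<n. cross n i) - lam * (res_sum T u n - (occ_sum T u n + \<gamma> * u 0 * loc_sum T n))" if n: "0 < n" for n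
  proof -
    have "- ?Z = (\<Sum>i<n. expectation (\<lambda>\<omega>. weight (grid T n (Suc i)) \<omega> * u (B (grid T n (Suc i)) \<omega>))
      - expectation (\<lambda>\<omega>. weight (grid T n i) \<omega> * u (B (grid T n i) \<omega>)))"
      using n w0 by (subst sum_lessThan_telescope) simp
    also have "\<dots> = (\<Sum>i<n. ito n i - a * expectation (\<lambda>\<omega>. weight (grid T n i) \<omega> * (L (grid T n (Suc i)) \<omega> - L (grid T n i) \<omega>))
      - lam * expectation (\<lambda>\<omega>. u (B (grid T n i) \<omega>) * ((weight (grid T n i) \<omega> - weight (grid T n (Suc i)) \<omega>) / lam))
      + cross n i)"
      by (rule sum.cong) (use step in auto)
    also have "\<dots> = (\<Sum>i<n. ito n i) - a * loc_sum T n - lam * res_sum T u n + (\<Sum>i<n. cross n i)"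
      by (simp only: sum.distrib sum_subtractf sum_distrib_left[symmetric] loc_sum_def res_sum_def)
    finally show ?thesis unfolding S1' occ by (simp add: algebra_simps)
  qed
  have "(\<lambda>n. S1 n + (\<Sum>i<n. cross n i) - lam * (res_sum T u n - (occ_sum T u n + \<gamma> * u 0 * loc_sum T n))) \<longlonglongrightarrow> 0 + 0 - lam * 0"
    by (intro tendsto_intros S1 cr res_sum_asymp[OF T meas(4) ucont(2) C])
  then have "(\<lambda>n. S1 n + (\<Sum>i<n. cross n i) - lam * (res_sum T u n - (occ_sum T u n + \<gamma> * u 0 * loc_sum T n))) \<longlonglongrightarrow> 0"
    by simp
  then have "(\<lambda>n. occ_sum T (\<lambda>b. lam * u b - g2 b / 2) n + (a + lam * \<gamma> * u 0) * loc_sum T n - ?Z) \<longlonglongrightarrow> 0"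
    by (rule Lim_transform_eventually)
      (use eq in \<open>auto intro!: eventually_mono[OF eventually_gt_at_top[of 0]]\<close>)
  then show ?thesis by (simp only: LIM_zero_iff)
qed

section \<open>Expected discounted local time and limit of the discretized resolvent\<close>

definition rate :: real where "rate = sqrt (2 * lam)"

lemma rate_pos: "0 < rate" and rate_sq: "rate\<^sup>2 = 2 * lam"
  using lam_pos by (simp_all add: rate_def)

text \<open>The value of the expected integral of w against dL over [0, T], up to the unevaluated
  terminal term, which vanishes as \<open>T\<close> grows.\<close>

definition loc_limit :: "real \<Rightarrow> real" where
  "loc_limit T = (exp (- rate * \<bar>x\<bar>) - expectation (\<lambda>\<omega>. weight T \<omega> * exp (- rate * \<bar>B T \<omega>\<bar>))) / (rate + lam * \<gamma>)"

lemma loc_sum_tendsto: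
  assumes T: "0 < T"
  shows "loc_sum T \<longlonglongrightarrow> loc_limit T"
proof -
  \<comment> \<open>The added linear term cancels the slope of the exponential at 0, so the even
    extension of \<open>p\<close> is twice differentiable; the kink of \<open>u\<close> is moved
    entirely into \<open>rate * |b|\<close>.\<close>
  define p where "p y = exp (- rate * y) + rate * y" for y
  define p1 where "p1 y = - rate * exp (- rate * y) + rate" for y
  define p2 where "p2 y = rate\<^sup>2 * exp (- rate * y)" for y
  define u where "u b = exp (- rate * \<bar>b\<bar>)" for b :: real
  have p: "(p has_real_derivative p1 y) (at y)" for y
    unfolding p_def[abs_def] p1_def by (auto intro!: derivative_eq_intros)
  have p1: "(p1 has_real_derivative p2 y) (at y)" for y
    unfolding p1_def[abs_def] p2_def by (auto intro!: derivative_eq_intros simp: power2_eq_square)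
  have p10: "p1 0 = 0" by (simp add: p1_def)
  have e1: "exp (- rate * \<bar>b\<bar>) \<le> 1" for b using rate_pos by simp
  have lim: "((\<lambda>y. rate\<^sup>2 * exp (- rate * y)) \<longlongrightarrow> rate\<^sup>2 * 0) at_top"
    using rate_pos by (intro tendsto_intros filterlim_compose[OF exp_at_bot])
      (auto simp: filterlim_uminus_at_bot intro!: filterlim_tendsto_pos_mult_at_top[OF tendsto_const _ filterlim_ident])
  have uc: "uniformly_continuous_on UNIV (\<lambda>b. p2 \<bar>b\<bar>)"
    using lim by (intro uniformly_continuous_even_extension) (auto simp: p2_def[abs_def] intro!: continuous_intros)
  have b1: "\<bar>sgn b * p1 \<bar>b\<bar>\<bar> \<le> rate" for b
  proof -
    have "p1 \<bar>b\<bar> = rate * (1 - exp (- rate * \<bar>b\<bar>))" by (simp add: p1_def algebra_simps)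
    also have "\<bar>\<dots>\<bar> \<le> rate * 1" unfolding abs_mult using e1[of b] rate_pos by (intro mult_mono) auto
    finally have "\<bar>p1 \<bar>b\<bar>\<bar> \<le> rate" by simp
    then show ?thesis using rate_pos by (cases "b = 0") (auto simp: abs_mult abs_sgn_eq)
  qed
  have b2: "\<bar>p2 \<bar>b\<bar>\<bar> \<le> rate\<^sup>2" for b using e1[of b] by (simp add: p2_def abs_mult mult_left_le)
  have ub: "u b = p \<bar>b\<bar> - rate * \<bar>b\<bar>" for b by (simp add: u_def p_def)
  have uC: "\<bar>u b\<bar> \<le> 1" for b using e1[of b] by (simp add: u_def)
  \<comment> \<open>\<open>u\<close> is annihilated by \<open>lam - u''/2\<close> off the origin, so only its kink contributes.\<close>
  have zero: "lam * u b - p2 \<bar>b\<bar> / 2 = 0" for b by (simp add: u_def p2_def rate_sq)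
  have "(\<lambda>n. occ_sum T (\<lambda>b. lam * u b - p2 \<bar>b\<bar> / 2) n + (rate + lam * \<gamma> * u 0) * loc_sum T n)
    \<longlonglongrightarrow> u x - expectation (\<lambda>\<omega>. weight T \<omega> * u (B T \<omega>))"
    by (rule dynkin[OF T has_real_derivative_even_extension[OF p p10]
        has_real_derivative_odd_extension[OF p1 p10] b1 uc b2 ub uC])
  moreover have "u 0 = 1" by (simp add: u_def)
  moreover have "occ_sum T (\<lambda>b. lam * u b - p2 \<bar>b\<bar> / 2) n = 0" for n by (simp add: zero occ_sum_def)
  ultimately have "(\<lambda>n. (rate + lam * \<gamma>) * loc_sum T n) \<longlonglongrightarrow> u x - expectation (\<lambda>\<omega>. weight T \<omega> * u (B T \<omega>))"
    by simp
  from tendsto_divide[OF this tendsto_const[of "rate + lam * \<gamma>"]] show ?thesis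
    using rate_pos lam_pos gamma_pos
    by (simp add: loc_limit_def u_def add_pos_pos less_imp_neq[THEN not_sym])
qed

text \<open>The free resolvent of \<open>f\<close> has no kink, so the preceding expansion with
  \<open>a = 0\<close> evaluates the occupation sum of \<open>f\<close> up to a multiple of the
  local time sum, whose limit is already known.\<close>

lemma res_sum_tendsto:
  fixes f :: "real \<Rightarrow> real"
  assumes T: "0 < T" and uc: "uniformly_continuous_on UNIV f" and C: "\<And>b. \<bar>f b\<bar> \<le> C"
    and even: "\<And>b. f (- b) = f b"
  shows "res_sum T f \<longlonglongrightarrow> green rate f x - expectation (\<lambda>\<omega>. weight T \<omega> * green rate f (B T \<omega>))
    + \<gamma> * (f 0 - lam * green rate f 0) * loc_limit T"
proof -
  let ?g = "green rate f" and ?h = "exp_tail rate f"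
  have f: "continuous_on UNIV f" "f \<in> borel_measurable borel" "isCont f 0"
    using uniformly_continuous_imp_continuous[OF uc]
    by (auto intro: borel_measurable_continuous_onI simp: continuous_on_eq_continuous_at)
  note d1 = green_deriv[OF rate_pos f(1) C even] and d2 = green_deriv2[OF rate_pos f(1) C even]
  note b1 = green_deriv_bound[OF rate_pos f(1) C] and gb = green_bound[OF rate_pos f(1) C]
  have b2: "\<bar>rate\<^sup>2 * ?g b - 2 * f b\<bar> \<le> rate\<^sup>2 * (2 * (C / rate) / rate) + 2 * C" for b
  proof -
    have "\<bar>rate\<^sup>2 * ?g b\<bar> \<le> rate\<^sup>2 * (2 * (C / rate) / rate)"
      unfolding abs_mult by (intro mult_mono gb) simp_all
    then show ?thesis using C[of b] by linarith
  qed
  \<comment> \<open>The second derivative is a combination of \<open>?g\<close> and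
    \<open>f\<close>, and its uniform continuity is required; for \<open>?g\<close> a bounded
    derivative suffices.\<close>
  have guc: "uniformly_continuous_on UNIV ?g"
  proof (rule lipschitz_on_uniformly_continuous)
    show "(2 * (C / rate))-lipschitz_on UNIV ?g"
    proof (rule lipschitz_onI)
      show "dist (?g b) (?g b') \<le> 2 * (C / rate) * dist b b'" for b b'
        using field_differentiable_bound[of UNIV ?g "\<lambda>b. ?h b - ?h (- b)" "2 * (C / rate)" b b'] d1 b1
        by (simp add: dist_norm)
      show "0 \<le> 2 * (C / rate)" using C[of 0] rate_pos by (auto intro: order.trans[OF abs_ge_zero])
    qed
  qed
  have uc2: "uniformly_continuous_on UNIV (\<lambda>b. rate\<^sup>2 * ?g b - 2 * f b)"
    by (intro uniformly_continuous_on_diff uniformly_continuous_on_cmul_left guc uc)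
  have "(\<lambda>n. occ_sum T (\<lambda>b. lam * ?g b - (rate\<^sup>2 * ?g b - 2 * f b) / 2) n + (0 + lam * \<gamma> * ?g 0) * loc_sum T n)
    \<longlonglongrightarrow> ?g x - expectation (\<lambda>\<omega>. weight T \<omega> * ?g (B T \<omega>))"
    by (rule dynkin[OF T d1 d2 b1 uc2 b2 _ gb]) simp
  moreover have "lam * ?g b - (rate\<^sup>2 * ?g b - 2 * f b) / 2 = f b" for b
    by (simp add: rate_sq field_simps)
  ultimately have D: "(\<lambda>n. occ_sum T f n + lam * \<gamma> * ?g 0 * loc_sum T n)
    \<longlonglongrightarrow> ?g x - expectation (\<lambda>\<omega>. weight T \<omega> * ?g (B T \<omega>))" by simp
  \<comment> \<open>The occupation sums cancel, and the three local time terms add up to 0.\<close>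
  have "(\<lambda>n. (res_sum T f n - (occ_sum T f n + \<gamma> * f 0 * loc_sum T n))
      + (occ_sum T f n + lam * \<gamma> * ?g 0 * loc_sum T n) + \<gamma> * (f 0 - lam * ?g 0) * loc_sum T n)
    \<longlonglongrightarrow> 0 + (?g x - expectation (\<lambda>\<omega>. weight T \<omega> * ?g (B T \<omega>))) + \<gamma> * (f 0 - lam * ?g 0) * loc_limit T"
    by (intro tendsto_add D res_sum_asymp[OF T f(2,3) C] tendsto_mult_left loc_sum_tendsto[OF T])
  then show ?thesis by (simp add: algebra_simps)
qed

end

section \<open>The path integral of the sticky process\<close>

text \<open>Between two clock values the exact integral of the exponential is the decrement of
  \<open>weight\<close> divided by \<open>lam\<close>. The estimate thus compares the path integral
  over one clock interval with one term of its Riemann sum.\<close>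

lemma exp_tail_increment:
  fixes q :: "real \<Rightarrow> real"
  assumes l: "0 < l" and p: "p \<le> p'" and q: "set_integrable lborel {p..} (\<lambda>s. exp (- l * s) * q s)"
    and e: "\<And>s. p \<le> s \<Longrightarrow> s < p' \<Longrightarrow> \<bar>q s - c\<bar> \<le> e"
  shows "\<bar>(LINT s:{p..}|lborel. exp (- l * s) * q s) - (LINT s:{p'..}|lborel. exp (- l * s) * q s)
      - c * ((exp (- l * p) - exp (- l * p')) / l)\<bar> \<le> e * ((exp (- l * p) - exp (- l * p')) / l)"
proof -
  have tail: "set_integrable lborel {p..<p'} h"
    "(LINT s:{p..}|lborel. h s) - (LINT s:{p'..}|lborel. h s) = (LINT s:{p..<p'}|lborel. h s)"
    if h: "set_integrable lborel {p..} h" for h :: "real \<Rightarrow> real"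
  proof -
    have U: "{p..} = {p..<p'} \<union> {p'..}" using p by auto
    show i: "set_integrable lborel {p..<p'} h" by (rule set_integrable_subset[OF h]) auto
    have i': "set_integrable lborel {p'..} h" by (rule set_integrable_subset[OF h]) (use p in auto)
    show "(LINT s:{p..}|lborel. h s) - (LINT s:{p'..}|lborel. h s) = (LINT s:{p..<p'}|lborel. h s)"
      unfolding U by (subst set_integral_Un[OF _ i i']) auto
  qed
  note ex = set_integrable_exp_tail[OF l, of p]
  have E: "(LINT s:{p..<p'}|lborel. exp (- l * s)) = (exp (- l * p) - exp (- l * p')) / l"
    using tail(2)[OF ex] by (simp only: set_integral_exp_tail[OF l] diff_divide_distrib)
  have cint: "set_integrable lborel {p..<p'} (\<lambda>s. k * exp (- l * s))" for k
    using tail(1)[OF ex] by (rule set_integrable_mult_right)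
  have "(LINT s:{p..<p'}|lborel. exp (- l * s) * q s) - c * ((exp (- l * p) - exp (- l * p')) / l)
    = (LINT s:{p..<p'}|lborel. exp (- l * s) * q s) - (LINT s:{p..<p'}|lborel. c * exp (- l * s))"
    by (simp only: set_integral_mult_right E)
  also have "\<dots> = (LINT s:{p..<p'}|lborel. exp (- l * s) * q s - c * exp (- l * s))"
    by (rule set_integral_diff(2)[symmetric, OF tail(1)[OF q] cint])
  finally have 1: "(LINT s:{p..<p'}|lborel. exp (- l * s) * q s) - c * ((exp (- l * p) - exp (- l * p')) / l)
    = (LINT s:{p..<p'}|lborel. exp (- l * s) * q s - c * exp (- l * s))" .
  have i: "set_integrable lborel {p..<p'} (\<lambda>s. exp (- l * s) * q s - c * exp (- l * s))"
    by (rule set_integral_diff(1)[OF tail(1)[OF q] cint])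
  have "\<bar>LINT s:{p..<p'}|lborel. exp (- l * s) * q s - c * exp (- l * s)\<bar>
    \<le> (LINT s:{p..<p'}|lborel. norm (exp (- l * s) * q s - c * exp (- l * s)))"
    using set_integral_norm_bound[OF i] by simp
  also have "\<dots> \<le> (LINT s:{p..<p'}|lborel. e * exp (- l * s))"
  proof (intro set_integral_mono set_integrable_norm i cint)
    fix s assume "s \<in> {p..<p'}"
    then have "\<bar>q s - c\<bar> * exp (- l * s) \<le> e * exp (- l * s)" using e by (intro mult_right_mono) auto
    moreover have "norm (exp (- l * s) * q s - c * exp (- l * s)) = \<bar>q s - c\<bar> * exp (- l * s)"
      by (simp add: left_diff_distrib[symmetric] abs_mult mult.commute)
    ultimately show "norm (exp (- l * s) * q s - c * exp (- l * s)) \<le> e * exp (- l * s)" by simp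
  qed
  also have "\<dots> = e * ((exp (- l * p) - exp (- l * p')) / l)"
    by (simp only: set_integral_mult_right E)
  finally show ?thesis unfolding tail(2)[OF q] 1 .
qed

context sticky_brownian
begin

section \<open>The inverse clock and continuity of the sticky paths\<close>

abbreviation inv_clock :: "'a \<Rightarrow> real \<Rightarrow> real" where
  "inv_clock \<omega> t \<equiv> sticky_time L \<gamma> t \<omega>"

lemma inv_clock_eq: "inv_clock \<omega> t = the_inv_into {0..} (\<lambda>u. clock u \<omega>) t"
  by (simp add: sticky_time_def clock_def)

lemma clock_inj:
  assumes \<omega>: "\<omega> \<in> space M"
  shows "inj_on (\<lambda>u. clock u \<omega>) {0..}"
proof (rule linorder_inj_onI)
  show "clock u \<omega> \<noteq> clock v \<omega>" if "u < v" "u \<in> {0..}" "v \<in> {0..}" for u v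
    using clock_diff_ge[OF \<omega>, of u v] that by auto
qed auto

lemma clock_surj:
  assumes \<omega>: "\<omega> \<in> space M" and t: "0 \<le> t"
  shows "t \<in> (\<lambda>u. clock u \<omega>) ` {0..}"
proof -
  \<comment> \<open>The clock runs at least as fast as time, so the intermediate value theorem
    applies on [0, t].\<close>
  have "\<exists>u\<ge>0. u \<le> t \<and> clock u \<omega> = t"
    by (rule IVT') (use clock_0[OF \<omega>] clock_ge[OF \<omega> t] t in \<open>auto intro: continuous_on_subset[OF clock_cont[OF \<omega>]]\<close>)
  then show ?thesis by force
qed

lemma
  assumes \<omega>: "\<omega> \<in> space M"
  shows inv_clock_nonneg: "0 \<le> t \<Longrightarrow> 0 \<le> inv_clock \<omega> t"
    and clock_inv_clock: "0 \<le> t \<Longrightarrow> clock (inv_clock \<omega> t) \<omega> = t"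
    and inv_clock_clock: "0 \<le> u \<Longrightarrow> inv_clock \<omega> (clock u \<omega>) = u"
  unfolding inv_clock_eq
  using the_inv_into_into[OF clock_inj[OF \<omega>] clock_surj[OF \<omega>], of t "{0..}"]
    f_the_inv_into_f[OF clock_inj[OF \<omega>] clock_surj[OF \<omega>], of t]
    the_inv_into_f_f[OF clock_inj[OF \<omega>], of u]
  by auto

text \<open>Clock increments dominate time increments, hence the inverse is nondecreasing and
  1-Lipschitz.\<close>

lemma inv_clock_diff:
  assumes \<omega>: "\<omega> \<in> space M" and s: "0 \<le> s" and st: "s \<le> t"
  shows "inv_clock \<omega> s \<le> inv_clock \<omega> t" and "inv_clock \<omega> t - inv_clock \<omega> s \<le> t - s"
proof -
  have t: "0 \<le> t" using s st by simp
  note c = clock_inv_clock[OF \<omega> s] clock_inv_clock[OF \<omega> t] inv_clock_nonneg[OF \<omega> s] inv_clock_nonneg[OF \<omega> t]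
  show le: "inv_clock \<omega> s \<le> inv_clock \<omega> t"
  proof (rule ccontr)
    assume "\<not> inv_clock \<omega> s \<le> inv_clock \<omega> t"
    then have "inv_clock \<omega> t < inv_clock \<omega> s" by simp
    with clock_diff_ge[OF \<omega> c(4), of "inv_clock \<omega> s"] c st show False by simp
  qed
  show "inv_clock \<omega> t - inv_clock \<omega> s \<le> t - s"
    using clock_diff_ge[OF \<omega> c(3) le] c by simp
qed

lemma inv_clock_cont:
  assumes \<omega>: "\<omega> \<in> space M"
  shows "continuous_on {0..} (inv_clock \<omega>)"
proof (rule lipschitz_on_continuous_on[of 1], rule lipschitz_onI)
  show "dist (inv_clock \<omega> s) (inv_clock \<omega> t) \<le> 1 * dist s t" if "s \<in> {0..}" "t \<in> {0..}" for s t
    using inv_clock_diff[OF \<omega>, of s t] inv_clock_diff[OF \<omega>, of t s] that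
    by (cases "s \<le> t") (auto simp: dist_real_def)
qed simp

lemma sticky_path_cont:
  assumes \<omega>: "\<omega> \<in> space M" and f: "continuous_on UNIV f"
  shows "continuous_on {0..} (\<lambda>t. f (B (inv_clock \<omega> t) \<omega>))"
proof (rule continuous_on_compose2[OF f], rule continuous_on_compose2[OF B_cont[OF \<omega>] inv_clock_cont[OF \<omega>]])
  show "inv_clock \<omega> ` {0..} \<subseteq> {0..}" using inv_clock_nonneg[OF \<omega>] by auto
qed auto

text \<open>Taken over the tail from \<open>p\<close>, so that integrals over bounded intervals are
  differences of tails and telescope along the grid.\<close>

definition path_integral :: "(real \<Rightarrow> real) \<Rightarrow> 'a \<Rightarrow> real \<Rightarrow> real" where
  "path_integral f \<omega> p = (LINT t:{p..}|lborel. exp (- lam * t) * f (B (inv_clock \<omega> t) \<omega>))"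

lemma
  assumes \<omega>: "\<omega> \<in> space M" and f: "continuous_on UNIV f" and C: "\<And>b. \<bar>f b\<bar> \<le> C" and p: "0 \<le> p"
  shows path_integrable: "set_integrable lborel {p..} (\<lambda>t. exp (- lam * t) * f (B (inv_clock \<omega> t) \<omega>))"
    and path_integral_bound: "\<bar>path_integral f \<omega> p\<bar> \<le> C * exp (- lam * p) / lam"
proof -
  have "set_borel_measurable borel {p..} (\<lambda>t. f (B (inv_clock \<omega> t) \<omega>))"
    unfolding set_borel_measurable_def
    by (rule borel_measurable_continuous_on_indicator)
      (use p in \<open>auto intro: continuous_on_subset[OF sticky_path_cont[OF \<omega> f]]\<close>)
  from set_integrable_exp_mult[OF lam_pos this C] set_integral_exp_mult_le[OF lam_pos this C]
  show "set_integrable lborel {p..} (\<lambda>t. exp (- lam * t) * f (B (inv_clock \<omega> t) \<omega>))"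
    "\<bar>path_integral f \<omega> p\<bar> \<le> C * exp (- lam * p) / lam" unfolding path_integral_def by auto
qed

definition path_sum :: "real \<Rightarrow> (real \<Rightarrow> real) \<Rightarrow> nat \<Rightarrow> 'a \<Rightarrow> real" where
  "path_sum T f n \<omega> = (\<Sum>i<n. f (B (grid T n i) \<omega>) *
     ((weight (grid T n i) \<omega> - weight (grid T n (Suc i)) \<omega>) / lam))"

text \<open>The change of variables: while sticky time runs through one clock interval, the inverse
  clock stays in the corresponding grid interval, where f(B) oscillates by less than
  \<open>e\<close>. The weights sum to at most 1 / lam.\<close>

lemma path_sum_error:
  assumes \<omega>: "\<omega> \<in> space M" and f: "continuous_on UNIV f" and C: "\<And>b. \<bar>f b\<bar> \<le> C"
    and T: "0 < T" and n: "0 < n" and e: "0 \<le> e"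
    and osc: "\<forall>i<n. \<forall>r\<in>{grid T n i..grid T n (Suc i)}. \<bar>f (B r \<omega>) - f (B (grid T n i) \<omega>)\<bar> < e"
  shows "\<bar>path_integral f \<omega> 0 - path_integral f \<omega> (clock T \<omega>) - path_sum T f n \<omega>\<bar> \<le> e / lam"
proof -
  define A where "A i = clock (grid T n i) \<omega>" for i
  note g = grid_nonneg[OF T]
  have A: "0 \<le> A i" for i unfolding A_def using clock_ge[OF \<omega> g, of n i] g[of n i] by linarith
  have w: "weight (grid T n i) \<omega> = exp (- lam * A i)" for i by (simp add: weight_def A_def)
  have step: "\<bar>path_integral f \<omega> (A i) - path_integral f \<omega> (A (Suc i))
      - f (B (grid T n i) \<omega>) * ((weight (grid T n i) \<omega> - weight (grid T n (Suc i)) \<omega>) / lam)\<bar>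
    \<le> e * ((weight (grid T n i) \<omega> - weight (grid T n (Suc i)) \<omega>) / lam)" if i: "i < n" for i
    unfolding w path_integral_def
  proof (rule exp_tail_increment[OF lam_pos])
    show "A i \<le> A (Suc i)" unfolding A_def by (rule clock_mono[OF \<omega> g less_imp_le[OF grid_less_Suc[OF T i]]])
    show "set_integrable lborel {A i..} (\<lambda>s. exp (- lam * s) * f (B (inv_clock \<omega> s) \<omega>))"
      by (rule path_integrable[OF \<omega> f C A])
    fix s assume s: "A i \<le> s" "s < A (Suc i)"
    have "0 \<le> s" using A[of i] s by simp
    then have "inv_clock \<omega> (A i) \<le> inv_clock \<omega> s" "inv_clock \<omega> s \<le> inv_clock \<omega> (A (Suc i))"
      using inv_clock_diff(1)[OF \<omega>] A s by auto
    then have "inv_clock \<omega> s \<in> {grid T n i..grid T n (Suc i)}"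
      unfolding A_def using inv_clock_clock[OF \<omega> g] by simp
    with osc i show "\<bar>f (B (inv_clock \<omega> s) \<omega>) - f (B (grid T n i) \<omega>)\<bar> \<le> e" by (auto intro: less_imp_le)
  qed
  have "path_integral f \<omega> 0 - path_integral f \<omega> (clock T \<omega>)
    = (\<Sum>i<n. path_integral f \<omega> (A i) - path_integral f \<omega> (A (Suc i)))"
    by (subst sum_lessThan_telescope') (use n clock_0[OF \<omega>] in \<open>simp add: A_def\<close>)
  then have "\<bar>path_integral f \<omega> 0 - path_integral f \<omega> (clock T \<omega>) - path_sum T f n \<omega>\<bar>
    = \<bar>\<Sum>i<n. path_integral f \<omega> (A i) - path_integral f \<omega> (A (Suc i))
      - f (B (grid T n i) \<omega>) * ((weight (grid T n i) \<omega> - weight (grid T n (Suc i)) \<omega>) / lam)\<bar>"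
    by (simp only: path_sum_def sum_subtractf)
  also have "\<dots> \<le> (\<Sum>i<n. e * ((weight (grid T n i) \<omega> - weight (grid T n (Suc i)) \<omega>) / lam))"
    by (rule order.trans[OF sum_abs sum_mono]) (use step in auto)
  also have "\<dots> = e * ((1 - weight T \<omega>) / lam)"
    by (simp only: sum_distrib_left[symmetric] sum_divide_distrib[symmetric] sum_weight_decrements[OF \<omega> n])
  also have "\<dots> \<le> e * (1 / lam)"
    using e lam_pos weight_pos[of T \<omega>] by (intro mult_left_mono divide_right_mono) auto
  finally show ?thesis by simp
qed

lemma path_sum_tendsto:
  assumes \<omega>: "\<omega> \<in> space M" and f: "continuous_on UNIV f" and C: "\<And>b. \<bar>f b\<bar> \<le> C" and T: "0 < T"
  shows "(\<lambda>n. path_sum T f n \<omega>) \<longlonglongrightarrow> path_integral f \<omega> 0 - path_integral f \<omega> (clock T \<omega>)"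
proof (rule tendstoI)
  fix e :: real assume e: "0 < e"
  define d where "d = e * lam / 2"
  have d: "0 < d" "d / lam < e" using e lam_pos by (auto simp: d_def)
  have "continuous_on {0..T} (\<lambda>t. f (B t \<omega>))"
    by (rule continuous_on_compose2[OF f continuous_on_subset[OF B_cont[OF \<omega>]]]) auto
  from grid_oscillation[OF T this d(1)]
  show "\<forall>\<^sub>F n in sequentially. dist (path_sum T f n \<omega>) (path_integral f \<omega> 0 - path_integral f \<omega> (clock T \<omega>)) < e"
    using eventually_gt_at_top[of 0]
  proof eventually_elim
    case (elim n)
    from path_sum_error[OF \<omega> f C T elim(2) less_imp_le[OF d(1)] elim(1)] d(2)
    show ?case by (simp add: dist_real_def)
  qed
qed

lemma path_sum_bound:
  assumes \<omega>: "\<omega> \<in> space M" and C: "\<And>b. \<bar>f b\<bar> \<le> C" and T: "0 < T"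
  shows "\<bar>path_sum T f n \<omega>\<bar> \<le> C / lam"
proof (cases "n = 0")
  case True
  have "0 \<le> C" using C[of 0] by linarith
  with True show ?thesis using lam_pos by (simp add: path_sum_def)
next
  case False
  have C0: "0 \<le> C" using C[of 0] by linarith
  have "\<bar>path_sum T f n \<omega>\<bar> \<le> (\<Sum>i<n. C * ((weight (grid T n i) \<omega> - weight (grid T n (Suc i)) \<omega>) / lam))"
    unfolding path_sum_def
  proof (rule order.trans[OF sum_abs sum_mono])
    fix i assume "i \<in> {..<n}"
    then have "weight (grid T n (Suc i)) \<omega> \<le> weight (grid T n i) \<omega>"
      using weight_antimono[OF \<omega> grid_nonneg[OF T] less_imp_le[OF grid_less_Suc[OF T]]] by auto
    then have "0 \<le> (weight (grid T n i) \<omega> - weight (grid T n (Suc i)) \<omega>) / lam" using lam_pos by simp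
    then show "\<bar>f (B (grid T n i) \<omega>) * ((weight (grid T n i) \<omega> - weight (grid T n (Suc i)) \<omega>) / lam)\<bar>
      \<le> C * ((weight (grid T n i) \<omega> - weight (grid T n (Suc i)) \<omega>) / lam)"
      unfolding abs_mult by (intro mult_mono C C0) auto
  qed
  also have "\<dots> = C * ((1 - weight T \<omega>) / lam)"
    using False by (simp only: sum_distrib_left[symmetric] sum_divide_distrib[symmetric] sum_weight_decrements[OF \<omega>] neq0_conv)
  also have "\<dots> \<le> C * (1 / lam)"
    using C0 lam_pos weight_pos[of T \<omega>] by (intro mult_left_mono divide_right_mono) auto
  finally show ?thesis by simp
qed

lemma path_sum_measurable:
  assumes "f \<in> borel_measurable borel" and T: "0 < T"
  shows "path_sum T f n \<in> borel_measurable M"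
  unfolding path_sum_def[abs_def]
  using measurable_comp_B[OF assms(1) grid_nonneg[OF T]] weight_measurable[OF grid_nonneg[OF T]]
  by (intro borel_measurable_sum borel_measurable_times borel_measurable_divide borel_measurable_diff) auto

lemma expectation_path_sum:
  assumes f: "f \<in> borel_measurable borel" and C: "\<And>b. \<bar>f b\<bar> \<le> C" and T: "0 < T"
  shows "expectation (path_sum T f n) = res_sum T f n"
proof -
  note s = grid_nonneg[OF T]
  have "integrable M (\<lambda>\<omega>. f (B (grid T n i) \<omega>) * ((weight (grid T n i) \<omega> - weight (grid T n (Suc i)) \<omega>) / lam))" for i
  proof -
    have "integrable M (\<lambda>\<omega>. f (B (grid T n i) \<omega>) * (weight (grid T n i) \<omega> - weight (grid T n (Suc i)) \<omega>))"
      by (intro integrable_mult_sq_integrable sq_integrable_comp_B[OF f C] s sq_integrable_diff sq_integrable_weight)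
    then show ?thesis by simp
  qed
  then show ?thesis unfolding path_sum_def[abs_def] res_sum_def
    by (intro Bochner_Integration.integral_sum)
qed

text \<open>As a function \<open>u\<close> of \<open>x \<ge> 0\<close>, the right-hand side solves the resolvent equation on the half-line with the sticky
  boundary condition \<open>u' 0 = \<gamma> * (lam * u 0 - f 0)\<close>.\<close>

lemma expectation_path_integral:
  assumes uc: "uniformly_continuous_on UNIV f" and C: "\<And>b. \<bar>f b\<bar> \<le> C"
    and even: "\<And>b. f (- b) = f b"
  shows "expectation (\<lambda>\<omega>. path_integral f \<omega> 0)
    = green rate f x + \<gamma> * (f 0 - lam * green rate f 0) * (exp (- rate * \<bar>x\<bar>) / (rate + lam * \<gamma>))"
proof -
  let ?g = "green rate f"
  have f: "continuous_on UNIV f" "f \<in> borel_measurable borel"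
    using uniformly_continuous_imp_continuous[OF uc] by (auto intro: borel_measurable_continuous_onI)
  note gb = green_bound[OF rate_pos f(1) C]
  have gm: "?g \<in> borel_measurable borel"
    using DERIV_isCont[OF green_deriv[OF rate_pos f(1) C even]]
    by (intro borel_measurable_continuous_onI continuous_at_imp_continuous_on) auto
  have C0: "0 \<le> C" using C[of 0] by linarith
  define J where "J T \<omega> = path_integral f \<omega> 0 - path_integral f \<omega> (clock T \<omega>)" for T \<omega>
  \<comment> \<open>Measurability in the path is inherited from the finite sums, which avoids joint
    measurability of the sticky process in time and path.\<close>
  have Jm: "J T \<in> borel_measurable M" if T: "0 < T" for T
    by (rule borel_measurable_LIMSEQ_real[of _ "path_sum T f"])
      (use path_sum_tendsto[OF _ f(1) C T] path_sum_measurable[OF f(2) T] in \<open>auto simp: J_def\<close>)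
  have EJ: "expectation (J T) = ?g x - expectation (\<lambda>\<omega>. weight T \<omega> * ?g (B T \<omega>))
    + \<gamma> * (f 0 - lam * ?g 0) * loc_limit T" if T: "0 < T" for T
  proof -
    have "(\<lambda>n. expectation (path_sum T f n)) \<longlonglongrightarrow> expectation (J T)"
      by (rule integral_dominated_convergence[where w = "\<lambda>_. C / lam"])
        (use Jm[OF T] path_sum_measurable[OF f(2) T] path_sum_tendsto[OF _ f(1) C T] path_sum_bound[OF _ C T]
          in \<open>auto simp: J_def intro!: AE_I2\<close>)
    moreover have "(\<lambda>n. expectation (path_sum T f n)) \<longlonglongrightarrow> ?g x - expectation (\<lambda>\<omega>. weight T \<omega> * ?g (B T \<omega>))
      + \<gamma> * (f 0 - lam * ?g 0) * loc_limit T"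
      unfolding expectation_path_sum[OF f(2) C T] by (rule res_sum_tendsto[OF T uc C even])
    ultimately show ?thesis by (rule LIMSEQ_unique)
  qed
  \<comment> \<open>Horizons \<open>Suc m\<close> are positive, as the grid estimates
    require.\<close>
  have expT: "(\<lambda>m. K * exp (- lam * real (Suc m))) \<longlonglongrightarrow> 0" for K
  proof -
    have "(\<lambda>m. exp (- lam * real (Suc m))) \<longlonglongrightarrow> 0"
      using lam_pos by (intro filterlim_compose[OF exp_at_bot])
        (auto simp: filterlim_uminus_at_bot intro!: filterlim_tendsto_pos_mult_at_top[OF tendsto_const]
          filterlim_tendsto_add_at_top[OF tendsto_const filterlim_real_sequentially])
    from tendsto_mult_right_zero[OF this] show ?thesis .
  qed
  have Jlim: "(\<lambda>m. J (real (Suc m)) \<omega>) \<longlonglongrightarrow> path_integral f \<omega> 0" if \<omega>: "\<omega> \<in> space M" for \<omega>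
  proof -
    have "(\<lambda>m. path_integral f \<omega> (clock (real (Suc m)) \<omega>)) \<longlonglongrightarrow> 0"
    proof (rule Lim_null_comparison[OF _ expT[of "C / lam"]], intro always_eventually allI)
      fix m :: nat
      let ?T = "real (Suc m)"
      have "0 \<le> clock ?T \<omega>" using clock_ge[OF \<omega>, of ?T] by linarith
      from path_integral_bound[OF \<omega> f(1) C this]
      have "\<bar>path_integral f \<omega> (clock ?T \<omega>)\<bar> \<le> C * weight ?T \<omega> / lam" by (simp add: weight_def)
      also have "\<dots> \<le> C * exp (- lam * ?T) / lam"
        using weight_le[OF \<omega>, of ?T] C0 lam_pos by (intro divide_right_mono mult_left_mono) auto
      finally show "norm (path_integral f \<omega> (clock ?T \<omega>)) \<le> C / lam * exp (- lam * ?T)" by simp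
    qed
    from tendsto_diff[OF tendsto_const this] show ?thesis by (simp add: J_def)
  qed
  \<comment> \<open>The bound on the sums does not depend on \<open>T\<close>, so it passes to the
    limit and dominates all horizons at once.\<close>
  have Jb: "\<bar>J T \<omega>\<bar> \<le> C / lam" if \<omega>: "\<omega> \<in> space M" and T: "0 < T" for T \<omega>
    using path_sum_tendsto[OF \<omega> f(1) C T] path_sum_bound[OF \<omega> C T]
    unfolding J_def by (intro LIMSEQ_le_const2[OF tendsto_rabs]) auto
  have "(\<lambda>m. expectation (J (real (Suc m)))) \<longlonglongrightarrow> expectation (\<lambda>\<omega>. path_integral f \<omega> 0)"
  proof (rule integral_dominated_convergence[where w = "\<lambda>_. C / lam"])
    show "(\<lambda>\<omega>. path_integral f \<omega> 0) \<in> borel_measurable M"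
      by (rule borel_measurable_LIMSEQ_real[of _ "\<lambda>m. J (real (Suc m))"]) (use Jlim Jm in auto)
  qed (use Jm Jlim Jb in \<open>auto intro!: AE_I2\<close>)
  moreover have "(\<lambda>m. expectation (J (real (Suc m)))) \<longlonglongrightarrow>
    ?g x - 0 + \<gamma> * (f 0 - lam * ?g 0) * ((exp (- rate * \<bar>x\<bar>) - 0) / (rate + lam * \<gamma>))"
  proof -
    have vanish: "(\<lambda>m. expectation (\<lambda>\<omega>. weight (real (Suc m)) \<omega> * h (B (real (Suc m)) \<omega>))) \<longlonglongrightarrow> 0"
      if h: "h \<in> borel_measurable borel" "\<And>b. \<bar>h b\<bar> \<le> K" for h :: "real \<Rightarrow> real" and K
    proof (rule Lim_null_comparison[OF _ expT[of K]], intro always_eventually allI)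
      fix m :: nat
      let ?T = "real (Suc m)"
      have i: "integrable M (\<lambda>\<omega>. weight ?T \<omega> * h (B ?T \<omega>))"
        by (intro integrable_sq_integrable sq_integrable_weight_mult sq_integrable_comp_B[OF h]) auto
      have "norm (expectation (\<lambda>\<omega>. weight ?T \<omega> * h (B ?T \<omega>))) \<le> expectation (\<lambda>\<omega>. norm (weight ?T \<omega> * h (B ?T \<omega>)))"
        by (rule integral_norm_bound)
      also have "\<dots> \<le> expectation (\<lambda>\<omega>. K * exp (- lam * ?T))"
      proof (intro integral_mono integrable_norm i)
        fix \<omega> assume \<omega>: "\<omega> \<in> space M"
        have "\<bar>weight ?T \<omega>\<bar> * \<bar>h (B ?T \<omega>)\<bar> \<le> exp (- lam * ?T) * K"
          using weight_le[OF \<omega>, of ?T] weight_pos[of ?T \<omega>] h(2) by (intro mult_mono) auto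
        then show "norm (weight ?T \<omega> * h (B ?T \<omega>)) \<le> K * exp (- lam * ?T)"
          by (simp add: abs_mult mult.commute)
      qed simp
      finally show "norm (expectation (\<lambda>\<omega>. weight ?T \<omega> * h (B ?T \<omega>))) \<le> K * exp (- lam * ?T)"
        by (simp add: prob_space)
    qed
    have e: "\<bar>exp (- rate * \<bar>b\<bar>)\<bar> \<le> 1" for b using rate_pos by simp
    have "rate + lam * \<gamma> \<noteq> 0" using rate_pos lam_pos gamma_pos by (simp add: add_pos_pos less_imp_neq[THEN not_sym])
    then show ?thesis
      unfolding EJ[OF of_nat_0_less_iff[THEN iffD2, OF zero_less_Suc]] loc_limit_def
      by (intro tendsto_add tendsto_diff tendsto_mult tendsto_divide tendsto_const vanish[OF gm gb] vanish[OF _ e]) measurable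
  qed
  ultimately have "expectation (\<lambda>\<omega>. path_integral f \<omega> 0)
    = ?g x - 0 + \<gamma> * (f 0 - lam * ?g 0) * ((exp (- rate * \<bar>x\<bar>) - 0) / (rate + lam * \<gamma>))"
    by (rule LIMSEQ_unique)
  then show ?thesis by simp
qed

end

section \<open>Identification of the kernel\<close>

lemma nn_integral_add_measure:
  assumes sets: "sets N = sets M" and f: "f \<in> borel_measurable M"
  shows "(\<integral>\<^sup>+y. f y \<partial>add_measure M N) = (\<integral>\<^sup>+y. f y \<partial>M) + (\<integral>\<^sup>+y. f y \<partial>N)"
  using f
proof (induction rule: borel_measurable_induct)
  case (cong f g)
  have "space N = space M" using sets by (rule sets_eq_imp_space_eq)
  with cong show ?case
    by (simp cong: nn_integral_cong_simp)
next
  case (set A)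
  then show ?case using sets by (simp add: emeasure_add_measure)
next
  case (mult u c)
  have "u \<in> borel_measurable N" using mult(2) sets by (simp cong: measurable_cong_sets)
  moreover have "u \<in> borel_measurable (add_measure M N)" using mult(2) by (simp cong: measurable_cong_sets)
  ultimately show ?case using mult by (simp add: nn_integral_cmult distrib_left)
next
  case (add u v)
  have "u \<in> borel_measurable N" "v \<in> borel_measurable N" using add sets by (simp_all cong: measurable_cong_sets)
  moreover have "u \<in> borel_measurable (add_measure M N)" "v \<in> borel_measurable (add_measure M N)"
    using add by (simp_all cong: measurable_cong_sets)
  ultimately show ?case using add by (simp add: nn_integral_add ac_simps)
next
  case (seq U)
  have N: "U i \<in> borel_measurable N" for i using seq(1) sets by (simp cong: measurable_cong_sets)
  have A: "U i \<in> borel_measurable (add_measure M N)" for i using seq(1) by (simp cong: measurable_cong_sets)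
  have inc: "incseq (\<lambda>i. \<integral>\<^sup>+y. U i y \<partial>K)" for K
    using seq(3) by (auto simp: incseq_def le_fun_def intro!: nn_integral_mono)
  have S: "(\<integral>\<^sup>+y. (SUP i. U i) y \<partial>K) = (SUP i. \<integral>\<^sup>+y. U i y \<partial>K)" if "\<And>i. U i \<in> borel_measurable K" for K
    unfolding SUP_apply using seq(3) that by (rule nn_integral_monotone_convergence_SUP)
  show ?case unfolding S[OF N] S[OF A] S[OF seq(1)] seq(4)
    by (simp only: seq.IH ennreal_SUP_add[OF inc inc])
qed

lemma
  fixes f :: "'b \<Rightarrow> real"
  assumes sets: "sets N = sets M" and M: "integrable M f" and N: "integrable N f"
  shows integrable_add_measure: "integrable (add_measure M N) f"
    and integral_add_measure: "(\<integral>y. f y \<partial>add_measure M N) = (\<integral>y. f y \<partial>M) + (\<integral>y. f y \<partial>N)"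
proof -
  have fm: "f \<in> borel_measurable M" using M by simp
  show i: "integrable (add_measure M N) f"
    unfolding integrable_iff_bounded
  proof
    show "f \<in> borel_measurable (add_measure M N)" using fm by (simp cong: measurable_cong_sets)
    show "(\<integral>\<^sup>+y. ennreal (norm (f y)) \<partial>add_measure M N) < \<infinity>"
      using M N fm by (subst nn_integral_add_measure[OF sets]) (auto simp: integrable_iff_bounded)
  qed
  show "(\<integral>y. f y \<partial>add_measure M N) = (\<integral>y. f y \<partial>M) + (\<integral>y. f y \<partial>N)"
    unfolding real_lebesgue_integral_def[OF i] real_lebesgue_integral_def[OF M] real_lebesgue_integral_def[OF N]
    using M N fm by (simp add: nn_integral_add_measure[OF sets] enn2real_plus real_integrable_def less_top)
qed

lemma scale_measure_eq_density: "scale_measure r M = density M (\<lambda>_. r)"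
  by (rule measure_eqI) (auto simp: emeasure_density_const)

lemma
  fixes f :: "'b \<Rightarrow> real"
  assumes f: "integrable M f" and c: "0 \<le> c"
  shows integrable_scale_measure: "integrable (scale_measure (ennreal c) M) f"
    and integral_scale_measure: "(\<integral>y. f y \<partial>scale_measure (ennreal c) M) = c * (\<integral>y. f y \<partial>M)"
  unfolding scale_measure_eq_density using f c
  by (auto simp: integrable_density integral_density)

lemma
  fixes d f :: "real \<Rightarrow> real"
  assumes d: "d \<in> borel_measurable borel" "\<And>y. 0 \<le> y \<Longrightarrow> 0 \<le> d y"
    and f: "set_borel_measurable borel {0..} f" and int: "set_integrable lborel {0..} (\<lambda>y. d y * f y)"
  shows integrable_density_halfline: "integrable (density lborel_halfline (\<lambda>y. ennreal (d y))) f"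
    and integral_density_halfline:
      "(\<integral>y. f y \<partial>density lborel_halfline (\<lambda>y. ennreal (d y))) = (LINT y:{0..}|lborel. d y * f y)"
proof -
  have fm: "f \<in> borel_measurable lborel_halfline"
    using f by (subst borel_measurable_restrict_space_iff) (auto simp: set_borel_measurable_def)
  have dm: "d \<in> borel_measurable lborel_halfline"
    using d(1) by (simp add: measurable_restrict_space1)
  have nn: "AE y in lborel_halfline. 0 \<le> d y"
    using d(2) by (intro AE_I2) (simp add: space_restrict_space)
  show "integrable (density lborel_halfline (\<lambda>y. ennreal (d y))) f"
    using int by (simp add: integrable_density[OF fm dm nn] integrable_restrict_space set_integrable_def)
  show "(\<integral>y. f y \<partial>density lborel_halfline (\<lambda>y. ennreal (d y))) = (LINT y:{0..}|lborel. d y * f y)"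
    by (simp add: integral_density[OF fm dm nn] integral_restrict_space set_lebesgue_integral_def)
qed

text \<open>Continuous ramps converge to indicators of {..c}, so the two measures agree on all
  {0..c}. Pushed forward to the line, they are finite Borel measures with equal distribution
  functions.\<close>

lemma halfline_measure_eqI:
  fixes \<mu> \<nu> :: "real measure"
  assumes sets: "sets \<mu> = sets (restrict_space borel {0..})" "sets \<nu> = sets (restrict_space borel {0..})"
    and fin: "finite_measure \<mu>" "finite_measure \<nu>"
    and eq: "\<And>f. f \<in> C0_halfline \<Longrightarrow> (\<integral>y. f y \<partial>\<mu>) = (\<integral>y. f y \<partial>\<nu>)"
  shows "\<mu> = \<nu>"
proof -
  \<comment> \<open>For \<open>k > 0\<close>, \<open>chi c k\<close> is 1 up to \<open>c\<close>,
    falls linearly and is 0 from \<open>c + 1 / k\<close> on; it therefore vanishes at infinity. The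
    index \<open>Suc k\<close> below excludes \<open>k = 0\<close>.\<close>
  define chi :: "real \<Rightarrow> nat \<Rightarrow> real \<Rightarrow> real" where "chi c k y = max 0 (min 1 (1 - real k * (y - c)))" for c k y
  have chi_cont: "continuous_on UNIV (chi c k)" for c k
    unfolding chi_def[abs_def] by (intro continuous_intros)
  have chi_C0: "chi c k \<in> C0_halfline" if "0 < k" for c k
    unfolding C0_halfline_def
  proof (intro CollectI conjI)
    show "continuous_on {0..} (chi c k)" using chi_cont by (rule continuous_on_subset) simp
    have "\<forall>\<^sub>F y in at_top. chi c k y = 0"
      using eventually_ge_at_top[of "c + 1"]
    proof eventually_elim
      case (elim y)
      have "1 * 1 \<le> real k * (y - c)" using elim that by (intro mult_mono) auto
      then show ?case by (simp add: chi_def)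
    qed
    then show "(chi c k \<longlongrightarrow> 0) at_top" by (rule tendsto_eventually)
  qed
  have lim: "(\<lambda>k. chi c (Suc k) y) \<longlonglongrightarrow> indicator {..c} y" for c y
  proof (cases "y \<le> c")
    case True
    have "chi c (Suc k) y = 1" for k
    proof -
      have "real (Suc k) * (y - c) \<le> 0" using True by (intro mult_nonneg_nonpos) auto
      then show ?thesis by (simp add: chi_def)
    qed
    then show ?thesis using True by simp
  next
    case False
    obtain K where K: "1 / (y - c) < real K" using reals_Archimedean2 by blast
    have "\<forall>\<^sub>F k in sequentially. chi c (Suc k) y = 0"
      using eventually_ge_at_top[of K]
    proof eventually_elim
      case (elim k)
      have "1 \<le> real K * (y - c)" using K False by (simp add: field_simps)
      also have "\<dots> \<le> real (Suc k) * (y - c)" using elim False by (intro mult_right_mono) auto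
      finally show ?case by (simp add: chi_def)
    qed
    then show ?thesis using False by (simp add: tendsto_eventually)
  qed
  have conv: "(\<lambda>k. \<integral>y. chi c (Suc k) y \<partial>K) \<longlonglongrightarrow> measure K ({..c} \<inter> {0..})"
    if K: "sets K = sets (restrict_space borel {0..})" "finite_measure K" for K :: "real measure" and c
  proof -
    interpret finite_measure K by (rule K(2))
    have sp: "space K = {0..}" using sets_eq_imp_space_eq[OF K(1)] by (simp add: space_restrict_space)
    have m: "g \<in> borel_measurable K" if "g \<in> borel_measurable borel" for g :: "real \<Rightarrow> real"
      using measurable_restrict_space1[OF that] K(1) by (simp cong: measurable_cong_sets)
    have "(\<lambda>k. \<integral>y. chi c (Suc k) y \<partial>K) \<longlonglongrightarrow> (\<integral>y. indicator {..c} y \<partial>K)"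
    proof (rule integral_dominated_convergence[where w = "\<lambda>_. 1"])
      show "chi c (Suc k) \<in> borel_measurable K" for k
        by (rule m[OF borel_measurable_continuous_onI[OF chi_cont]])
      show "(\<lambda>y. indicator {..c} y :: real) \<in> borel_measurable K" by (rule m) simp
    qed (use lim in \<open>auto simp: chi_def\<close>)
    also have "(\<integral>y. indicator {..c} y \<partial>K) = (\<integral>y. indicator ({..c} \<inter> {0..}) y \<partial>K)"
      by (rule Bochner_Integration.integral_cong) (auto simp: sp indicator_def)
    also have "\<dots> = measure K ({..c} \<inter> {0..})" by (simp add: sp Int_absorb1)
    finally show ?thesis .
  qed
  have meq: "measure \<mu> ({..c} \<inter> {0..}) = measure \<nu> ({..c} \<inter> {0..})" for c
    using conv[OF sets(1) fin(1), of c] conv[OF sets(2) fin(2), of c] eq[OF chi_C0]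
    by (intro LIMSEQ_unique) auto
  have ext: "finite_borel_measure (distr K borel (\<lambda>y. y))" "cdf (distr K borel (\<lambda>y. y)) c = measure K ({..c} \<inter> {0..})"
      "(\<lambda>y. y) \<in> borel_measurable K" "space K = {0..}"
    if K: "sets K = sets (restrict_space borel {0..})" "finite_measure K" for K :: "real measure" and c
  proof -
    interpret finite_measure K by (rule K(2))
    show sp: "space K = {0..}" using sets_eq_imp_space_eq[OF K(1)] by (simp add: space_restrict_space)
    show id: "(\<lambda>y. y) \<in> borel_measurable K"
      using measurable_restrict_space1[of "\<lambda>y. y" borel borel] K(1) by (simp cong: measurable_cong_sets)
    show "finite_borel_measure (distr K borel (\<lambda>y. y))"
      by (intro finite_borel_measure.intro finite_borel_measure_axioms.intro finite_measure_distr id) simp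
    show "cdf (distr K borel (\<lambda>y. y)) c = measure K ({..c} \<inter> {0..})"
      using id by (simp add: cdf_def measure_distr sp)
  qed
  have "distr \<mu> borel (\<lambda>y. y) = distr \<nu> borel (\<lambda>y. y)"
    by (rule cdf_unique'[OF ext(1)[OF sets(1) fin(1)] ext(1)[OF sets(2) fin(2)]])
      (auto simp: ext(2)[OF sets(1) fin(1)] ext(2)[OF sets(2) fin(2)] meq)
  then have D: "emeasure (distr \<mu> borel (\<lambda>y. y)) A = emeasure (distr \<nu> borel (\<lambda>y. y)) A" for A by simp
  show ?thesis
  proof (rule measure_eqI)
    show "sets \<mu> = sets \<nu>" using sets by simp
    fix A assume "A \<in> sets \<mu>"
    then have A: "A \<in> sets borel" "A \<subseteq> {0..}"
      using sets(1) by (auto simp: sets_restrict_space)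
    then have "A \<inter> {0..} = A" by auto
    then show "emeasure \<mu> A = emeasure \<nu> A"
      using D[of A] A(1) ext(3,4)[OF sets(1) fin(1)] ext(3,4)[OF sets(2) fin(2)]
      by (simp add: emeasure_distr)
  qed
qed

lemma set_integral_cmult_exp:
  fixes f :: "real \<Rightarrow> real"
  shows "exp k * (LINT s:S|lborel. exp (- a * s) * f s) = (LINT s:S|lborel. exp (k - a * s) * f s)"
proof -
  have "exp k * (LINT s:S|lborel. exp (- a * s) * f s) = (LINT s:S|lborel. exp k * (exp (- a * s) * f s))"
    by (simp only: set_integral_mult_right)
  also have "\<dots> = (LINT s:S|lborel. exp (k - a * s) * f s)"
    by (simp add: mult.assoc[symmetric] exp_add[symmetric])
  finally show ?thesis .
qed

text \<open>Passage from an integral over the line to one over the half-line: the tail from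
  \<open>x\<close> and the reflected piece over [- x, 0] combine to the kernel exp(- a |x - y|), and
  the rest of the tail from \<open>- x\<close> gives exp(- a (x + y)).\<close>

lemma
  fixes f :: "real \<Rightarrow> real"
  assumes a: "0 < a" and f: "continuous_on UNIV f" and C: "\<And>y. \<bar>f y\<bar> \<le> C"
    and even: "\<And>y. f (- y) = f y" and x: "0 \<le> x"
  shows set_integrable_exp_abs_diff: "set_integrable lborel {0..} (\<lambda>y. exp (- a * \<bar>x - y\<bar>) * f y)"
    and set_integrable_exp_add: "set_integrable lborel {0..} (\<lambda>y. exp (- a * (x + y)) * f y)"
    and set_integral_exp_add: "(LINT y:{0..}|lborel. exp (- a * (x + y)) * f y) = exp (- a * x) * exp_tail a f 0"
    and green_eq: "a * green a f x = (LINT y:{0..}|lborel. exp (- a * \<bar>x - y\<bar>) * f y)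
      + exp (- a * x) * exp_tail a f 0"
proof -
  have fm: "set_borel_measurable borel {p..} f" for p
    using borel_measurable_continuous_onI[OF f] unfolding set_borel_measurable_def by measurable
  have int: "set_integrable lborel {p..} (\<lambda>s. exp (- a * s) * f s)" for p
    by (rule set_integrable_exp_mult[OF a fm C])
  have intk: "set_integrable lborel {p..} (\<lambda>s. exp (k - a * s) * f s)" for p k
    using set_integrable_mult_right[OF int[of p], of "exp k"]
    by (simp add: mult.assoc[symmetric] exp_add[symmetric])
  have Icc: "set_integrable lborel {p..q} h" if "continuous_on UNIV h" for p q and h :: "real \<Rightarrow> real"
    by (rule borel_integrable_atLeastAtMost') (rule continuous_on_subset[OF that], simp)
  have split: "(LINT s:{p..}|lborel. h s) = (LINT s:{p..q}|lborel. h s) + (LINT s:{q..}|lborel. h s)"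
    if "p \<le> q" "set_integrable lborel {p..q} h" "set_integrable lborel {q..} h" for p q and h :: "real \<Rightarrow> real"
  proof -
    have U: "{p..} = {p..q} \<union> {q..}" using that(1) by auto
    show ?thesis unfolding U using that AE_lborel_singleton[of q]
      by (intro set_integral_Un_AE) (auto elim: eventually_mono)
  qed
  have exp_add_eq: "- a * (x + y) = - a * x - a * y" for y by (simp add: algebra_simps)
  show "set_integrable lborel {0..} (\<lambda>y. exp (- a * (x + y)) * f y)"
    unfolding exp_add_eq by (rule intk)
  have T0: "exp_tail a f 0 = (LINT s:{0..}|lborel. exp (- a * s) * f s)" by (simp add: exp_tail_def)
  show "(LINT y:{0..}|lborel. exp (- a * (x + y)) * f y) = exp (- a * x) * exp_tail a f 0"
    unfolding T0 set_integral_cmult_exp exp_add_eq ..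
  let ?h = "\<lambda>y. exp (- a * \<bar>x - y\<bar>) * f y"
  have he: "?h s = exp (a * x - a * s) * f s" if "s \<in> {x..}" for s
  proof -
    have "\<bar>x - s\<bar> = s - x" using that by simp
    then show ?thesis by (simp add: algebra_simps)
  qed
  have right: "set_integrable lborel {x..} ?h"
    by (rule set_integrable_cong[OF refl refl he, THEN iffD2, OF _ intk])
  have right_eq: "(LINT s:{x..}|lborel. ?h s) = (LINT s:{x..}|lborel. exp (a * x - a * s) * f s)"
    by (rule set_lebesgue_integral_cong) (use he in auto)
  have left: "set_integrable lborel {0..x} ?h" by (intro Icc continuous_intros f)
  have U: "{0..} = {0..x} \<union> {x..}" using x by auto
  show "set_integrable lborel {0..} ?h" unfolding U using left right by (rule set_integrable_Un) auto
  have "a * green a f x = exp_tail a f x + exp_tail a f (- x)" using a by (simp add: green_def)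
  also have "exp_tail a f x = (LINT s:{x..}|lborel. ?h s)"
    unfolding exp_tail_def set_integral_cmult_exp right_eq ..
  also have "exp_tail a f (- x) = (LINT s:{-x..}|lborel. exp (- a * x - a * s) * f s)"
    unfolding exp_tail_def set_integral_cmult_exp by simp
  also have "\<dots> = (LINT s:{-x..0}|lborel. exp (- a * x - a * s) * f s) + (LINT s:{0..}|lborel. exp (- a * x - a * s) * f s)"
    using x by (intro split intk Icc continuous_intros f) auto
  also have "(LINT s:{0..}|lborel. exp (- a * x - a * s) * f s) = exp (- a * x) * exp_tail a f 0"
    unfolding T0 set_integral_cmult_exp ..
  also have "(LINT s:{-x..0}|lborel. exp (- a * x - a * s) * f s) = (LINT s:{0..x}|lborel. ?h s)"
  proof -
    \<comment> \<open>Reflection s = - y turns the exponent into - a (x - y) with 0 \<le> y \<le> x,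
      and evenness restores \<open>f y\<close>.\<close>
    have "(LINT s:{-x..0}|lborel. exp (- a * x - a * s) * f s) = (LINT s:{s. - s \<in> {-x..0}}|lborel. exp (- a * x - a * (- s)) * f (- s))"
      by (rule set_integral_reflect)
    also have "{s. - s \<in> {-x..0}} = {0..x}" by auto
    also have "(LINT s:{0..x}|lborel. exp (- a * x - a * (- s)) * f (- s)) = (LINT s:{0..x}|lborel. ?h s)"
      by (rule set_lebesgue_integral_cong) (auto simp: even algebra_simps)
    finally show ?thesis .
  qed
  finally show "a * green a f x = (LINT y:{0..}|lborel. ?h y) + exp (- a * x) * exp_tail a f 0"
    using split[OF x left right] by simp
qed

definition sticky_kernel :: "real \<Rightarrow> real \<Rightarrow> real \<Rightarrow> real measure" where
  "sticky_kernel \<gamma> lam x = add_measure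
      (density lborel_halfline (\<lambda>y. ennreal (dirichlet_resolvent_density lam x y)))
      (scale_measure (ennreal (1 / (sqrt (2 * lam) + \<gamma> * lam)))
        (add_measure
          (density lborel_halfline (\<lambda>y. ennreal (2 * exp (- sqrt (2 * lam) * (x + y)))))
          (scale_measure (ennreal (\<gamma> * exp (- sqrt (2 * lam) * x)))
            (return (restrict_space borel {0..}) 0))))"

lemma sets_sticky_kernel: "sets (sticky_kernel \<gamma> lam x) = sets (restrict_space borel {0..})"
  by (simp add: sticky_kernel_def sets_restrict_space)

text \<open>In terms of the direct part \<open>P\<close> and the reflected part \<open>Q\<close>,
  the Dirichlet density contributes (P - Q) / a and the second density 2 Q, whereas the free
  resolvent is (P + Q) / a. The claim is then an algebraic identity.\<close>

lemma
  fixes f :: "real \<Rightarrow> real"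
  assumes gamma: "0 < \<gamma>" and lam: "0 < lam" and x: "0 \<le> x"
    and f: "continuous_on UNIV f" and C: "\<And>y. \<bar>f y\<bar> \<le> C" and even: "\<And>y. f (- y) = f y"
  shows integrable_sticky_kernel: "integrable (sticky_kernel \<gamma> lam x) f"
    and integral_sticky_kernel: "(\<integral>y. f y \<partial>sticky_kernel \<gamma> lam x)
      = green (sqrt (2 * lam)) f x + \<gamma> * (f 0 - lam * green (sqrt (2 * lam)) f 0)
        * (exp (- sqrt (2 * lam) * \<bar>x\<bar>) / (sqrt (2 * lam) + lam * \<gamma>))"
proof -
  define a where "a = sqrt (2 * lam)"
  have a: "0 < a" and a2: "a\<^sup>2 = 2 * lam" using lam by (simp_all add: a_def)
  define c where "c = 1 / (a + \<gamma> * lam)"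
  have den: "0 < a + \<gamma> * lam" using a gamma lam by (simp add: add_pos_pos)
  have c: "0 \<le> c" using den by (simp add: c_def)
  define D where "D = density lborel_halfline (\<lambda>y. ennreal (dirichlet_resolvent_density lam x y))"
  define E where "E = density lborel_halfline (\<lambda>y. ennreal (2 * exp (- a * (x + y))))"
  define R where "R = return (restrict_space borel {0::real..}) 0"
  define P where "P = (LINT y:{0..}|lborel. exp (- a * \<bar>x - y\<bar>) * f y)"
  define Q where "Q = exp (- a * x) * exp_tail a f 0"
  have fm: "set_borel_measurable borel {0..} f"
    using borel_measurable_continuous_onI[OF f] unfolding set_borel_measurable_def by measurable
  have fR: "f \<in> borel_measurable (restrict_space borel {0..})"
    by (rule measurable_restrict_space1) (rule borel_measurable_continuous_onI[OF f])
  note i1 = set_integrable_exp_abs_diff[OF a f C even x]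
  note i2 = set_integrable_exp_add[OF a f C even x]
  have rD: "dirichlet_resolvent_density lam x y * f y
      = 1 / a * (exp (- a * \<bar>x - y\<bar>) * f y - exp (- a * (x + y)) * f y)" for y
    by (simp add: dirichlet_resolvent_density_def a_def algebra_simps)
  have iD: "set_integrable lborel {0..} (\<lambda>y. dirichlet_resolvent_density lam x y * f y)"
    unfolding rD by (intro set_integrable_mult_right set_integral_diff(1) i1 i2)
  have Dm: "dirichlet_resolvent_density lam x \<in> borel_measurable borel"
    unfolding dirichlet_resolvent_density_def[abs_def] by measurable
  \<comment> \<open>Since |x - y| \<le> x + y on the half-line. Without this, \<open>ennreal\<close>
    would truncate the density.\<close>
  have D0: "0 \<le> dirichlet_resolvent_density lam x y" if "0 \<le> y" for y
    using a x that unfolding dirichlet_resolvent_density_def a_def[symmetric]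
    by (intro mult_nonneg_nonneg) (auto simp: mult_left_mono)
  have ID: "integrable D f" "(\<integral>y. f y \<partial>D) = (P - Q) / a"
  proof -
    show "integrable D f" unfolding D_def by (rule integrable_density_halfline[OF Dm D0 fm iD])
    have "(\<integral>y. f y \<partial>D) = (LINT y:{0..}|lborel. dirichlet_resolvent_density lam x y * f y)"
      unfolding D_def by (rule integral_density_halfline[OF Dm D0 fm iD])
    also have "\<dots> = 1 / a * ((LINT y:{0..}|lborel. exp (- a * \<bar>x - y\<bar>) * f y) - (LINT y:{0..}|lborel. exp (- a * (x + y)) * f y))"
      unfolding rD set_integral_mult_right by (simp only: set_integral_diff(2)[OF i1 i2])
    also have "\<dots> = (P - Q) / a"
      unfolding set_integral_exp_add[OF a f C even x] P_def Q_def by simp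
    finally show "(\<integral>y. f y \<partial>D) = (P - Q) / a" .
  qed
  have IE: "integrable E f" "(\<integral>y. f y \<partial>E) = 2 * Q"
  proof -
    have m: "(\<lambda>y. 2 * exp (- a * (x + y))) \<in> borel_measurable borel" by measurable
    have i: "set_integrable lborel {0..} (\<lambda>y. 2 * exp (- a * (x + y)) * f y)"
      unfolding mult.assoc by (rule set_integrable_mult_right[OF i2])
    show "integrable E f" unfolding E_def by (rule integrable_density_halfline[OF m _ fm i]) simp
    have "(\<integral>y. f y \<partial>E) = (LINT y:{0..}|lborel. 2 * exp (- a * (x + y)) * f y)"
      unfolding E_def by (rule integral_density_halfline[OF m _ fm i]) simp
    also have "\<dots> = 2 * Q"
      unfolding mult.assoc set_integral_mult_right Q_def set_integral_exp_add[OF a f C even x] ..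
    finally show "(\<integral>y. f y \<partial>E) = 2 * Q" .
  qed
  have IR: "integrable R f" "(\<integral>y. f y \<partial>R) = f 0"
    unfolding R_def using fR
    by (auto simp: integrable_iff_bounded nn_integral_return integral_return space_restrict_space)
  have sE: "sets (scale_measure k R) = sets E" for k by (simp add: R_def E_def sets_restrict_space)
  have sD: "sets (scale_measure k (add_measure E N)) = sets D" for k N by (simp add: D_def E_def)
  have g: "0 \<le> \<gamma> * exp (- a * x)" using gamma by simp
  note IS = integrable_scale_measure[OF IR(1) g] integral_scale_measure[OF IR(1) g]
  note IA = integrable_add_measure[OF sE IE(1) IS(1)] integral_add_measure[OF sE IE(1) IS(1)]
  note IC = integrable_scale_measure[OF IA(1) c] integral_scale_measure[OF IA(1) c]
  note IT = integrable_add_measure[OF sD ID(1) IC(1)] integral_add_measure[OF sD ID(1) IC(1)]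
  have K: "sticky_kernel \<gamma> lam x = add_measure D (scale_measure (ennreal c)
      (add_measure E (scale_measure (ennreal (\<gamma> * exp (- a * x))) R)))"
    by (simp add: sticky_kernel_def D_def E_def R_def c_def a_def)
  show "integrable (sticky_kernel \<gamma> lam x) f" unfolding K by (rule IT(1))
  have "(\<integral>y. f y \<partial>sticky_kernel \<gamma> lam x) = (P - Q) / a + c * (2 * Q + \<gamma> * exp (- a * x) * f 0)"
    unfolding K IT(2) IC(2) IA(2) IS(2) ID(2) IE(2) IR(2) ..
  \<comment> \<open>The free resolvent exceeds the Dirichlet part by 2 Q / a. The relation c (a +
    \<gamma> lam) = 1 splits this excess into 2 c Q and the term with lam times the free resolvent
    at 0.\<close>
  also have "\<dots> = (P + Q) / a + \<gamma> * (f 0 - lam * (2 * exp_tail a f 0 / a)) * (exp (- a * x) * c)"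
  proof -
    have "c * (a + \<gamma> * lam) = 1" using den by (simp add: c_def)
    then have "2 * Q / a = 2 * Q * (c * (a + \<gamma> * lam)) / a" by simp
    also have "\<dots> = c * (2 * Q) + \<gamma> * lam * (2 * exp_tail a f 0 / a) * (exp (- a * x) * c)"
      using a by (simp add: Q_def field_simps)
    finally have "c * (2 * Q) = 2 * Q / a - \<gamma> * lam * (2 * exp_tail a f 0 / a) * (exp (- a * x) * c)" by simp
    then show ?thesis by (simp add: algebra_simps add_divide_distrib diff_divide_distrib)
  qed
  also have "(P + Q) / a = green a f x"
    using green_eq[OF a f C even x] a by (simp add: P_def Q_def field_simps)
  also have "2 * exp_tail a f 0 / a = green a f 0" by (simp add: green_def)
  finally show "(\<integral>y. f y \<partial>sticky_kernel \<gamma> lam x)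
      = green (sqrt (2 * lam)) f x + \<gamma> * (f 0 - lam * green (sqrt (2 * lam)) f 0)
        * (exp (- sqrt (2 * lam) * \<bar>x\<bar>) / (sqrt (2 * lam) + lam * \<gamma>))"
    using x by (simp add: a_def c_def mult.commute)
qed

text \<open>The integrability lemma asks for boundedness and evenness but no decay, so it covers the
  constant 1.\<close>

lemma finite_measure_sticky_kernel:
  assumes "0 < \<gamma>" "0 < lam" "0 \<le> x"
  shows "finite_measure (sticky_kernel \<gamma> lam x)"
proof (rule finite_measureI)
  have "integrable (sticky_kernel \<gamma> lam x) (\<lambda>_. 1 :: real)"
    by (rule integrable_sticky_kernel[OF assms, of _ 1]) auto
  then show "emeasure (sticky_kernel \<gamma> lam x) (space (sticky_kernel \<gamma> lam x)) \<noteq> \<infinity>"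
    by (simp add: integrable_iff_bounded less_top)
qed

text \<open>The kernel lives on {0..}, so \<open>\<phi>\<close> may be replaced by its even
  extension. Composed with \<open>B\<close>, that extension is \<open>\<phi>\<close> evaluated at
  \<open>|B|\<close>, hence at the sticky process after the time change.\<close>

lemma (in sticky_brownian) integral_sticky_kernel_C0:
  assumes \<phi>: "\<phi> \<in> C0_halfline" and x: "0 \<le> x"
  shows "(\<integral>y. \<phi> y \<partial>sticky_kernel \<gamma> lam x)
    = expectation (\<lambda>\<omega>. LINT t:{0..}|lborel. exp (- lam * t) * \<phi> (sticky_bm B L \<gamma> t \<omega>))"
proof -
  define f where "f b = \<phi> \<bar>b\<bar>" for b
  have \<phi>': "continuous_on {0..} \<phi>" "(\<phi> \<longlongrightarrow> 0) at_top" using \<phi> by (auto simp: C0_halfline_def)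
  have uc: "uniformly_continuous_on UNIV f"
    unfolding f_def[abs_def] by (rule uniformly_continuous_even_extension[OF \<phi>'])
  obtain C where C: "\<forall>b. \<bar>\<phi> \<bar>b\<bar>\<bar> \<le> C" by (rule bounded_even_extension[OF \<phi>'])
  have C': "\<bar>f b\<bar> \<le> C" for b using C by (simp add: f_def)
  have even: "f (- b) = f b" for b by (simp add: f_def)
  have "(\<integral>y. \<phi> y \<partial>sticky_kernel \<gamma> lam x) = (\<integral>y. f y \<partial>sticky_kernel \<gamma> lam x)"
    using sets_eq_imp_space_eq[OF sets_sticky_kernel]
    by (intro Bochner_Integration.integral_cong) (auto simp: f_def space_restrict_space)
  also have "\<dots> = expectation (\<lambda>\<omega>. path_integral f \<omega> 0)"
    unfolding expectation_path_integral[OF uc C' even] rate_def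
    by (rule integral_sticky_kernel[OF gamma_pos lam_pos x uniformly_continuous_imp_continuous[OF uc] C' even])
  also have "\<dots> = expectation (\<lambda>\<omega>. LINT t:{0..}|lborel. exp (- lam * t) * \<phi> (sticky_bm B L \<gamma> t \<omega>))"
    by (simp add: path_integral_def f_def sticky_bm_def)
  finally show ?thesis .
qed

theorem corollary3p10:
  fixes A :: "'a measure" and F P :: "real \<Rightarrow> 'a measure"
    and B L :: "real \<Rightarrow> 'a \<Rightarrow> real" and \<theta> :: "real \<Rightarrow> 'a \<Rightarrow> 'a"
    and \<gamma> lam x :: real
  assumes "brownian_family A F P B \<theta>"
    and "is_local_time_at_zero P F B L"
    and "\<gamma> > 0" and "lam > 0" and "x \<ge> 0"
  shows "resolvent_kernel P (sticky_bm B L \<gamma>) lam x =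
    add_measure
      (density lborel_halfline (\<lambda>y. ennreal (dirichlet_resolvent_density lam x y)))
      (scale_measure (ennreal (1 / (sqrt (2 * lam) + \<gamma> * lam)))
        (add_measure
          (density lborel_halfline (\<lambda>y. ennreal (2 * exp (- sqrt (2 * lam) * (x + y)))))
          (scale_measure (ennreal (\<gamma> * exp (- sqrt (2 * lam) * x)))
            (return (restrict_space borel {0..}) 0))))"
proof -
  interpret bf: brownian_family A F P B \<theta> by fact
  interpret prob_space "P x" by (rule bf.prob_P)
  have sp: "space (P x) = space A" by (rule sets_eq_imp_space_eq[OF bf.sets_P])
  have lt: "\<And>t. 0 \<le> t \<Longrightarrow> L t \<in> borel_measurable (F t)"
    "\<And>\<omega>. \<omega> \<in> space A \<Longrightarrow> L 0 \<omega> = 0 \<and> mono_on {0..} (\<lambda>t. L t \<omega>) \<and> continuous_on {0..} (\<lambda>t. L t \<omega>)"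
    "is_ito_integral (P x) F B (\<lambda>s \<omega>. sgn (B s \<omega>)) (\<lambda>t \<omega>. \<bar>B t \<omega>\<bar> - \<bar>B 0 \<omega>\<bar> - L t \<omega>)"
    using assms(2) by (auto simp: is_local_time_at_zero_def bf.space_F)
  interpret sticky_brownian "P x" F B L x \<gamma> lam
  proof
    show "brownian_motion_rel (P x) F B" by (rule bf.brownian)
    show "subalgebra (P x) (F t)" if "0 \<le> t" for t
      using bf.subalgebra_F[OF that] by (simp add: subalgebra_def sp bf.sets_P)
    show "sets (F s) \<subseteq> sets (F t)" if "s \<le> t" for s t by (rule bf.sets_F_mono[OF that])
    show "AE \<omega> in P x. B 0 \<omega> = x" using AE_prob_1[OF bf.start[of x]] by eventually_elim simp
  qed (use lt assms sp in auto)
  have rep: "represents_resolvent P (sticky_bm B L \<gamma>) lam x (sticky_kernel \<gamma> lam x)"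
    unfolding represents_resolvent_def resolvent_def
    using sets_sticky_kernel finite_measure_sticky_kernel integral_sticky_kernel_C0 assms by blast
  \<comment> \<open>A definite description needs existence and uniqueness: two representing measures
    have the same integrals over \<open>C0_halfline\<close> and therefore coincide.\<close>
  have "resolvent_kernel P (sticky_bm B L \<gamma>) lam x = sticky_kernel \<gamma> lam x"
    unfolding resolvent_kernel_def
  proof (rule the_equality)
    show "represents_resolvent P (sticky_bm B L \<gamma>) lam x (sticky_kernel \<gamma> lam x)" by (rule rep)
    fix \<mu> assume "represents_resolvent P (sticky_bm B L \<gamma>) lam x \<mu>"
    with rep show "\<mu> = sticky_kernel \<gamma> lam x"
      unfolding represents_resolvent_def by (intro halfline_measure_eqI) auto
  qed
  then show ?thesis by (simp only: sticky_kernel_def)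
qed

end
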